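(* Let $\alpha\in\mathbb{R}$, let $m$ be a positive integer, and let $(s_j)_{j=0}^m\in\mathcal{K}^{\ge,e}_{q,m,\alpha}$ with first $\alpha$-S-transform $(s_j^{[1,\alpha]})_{j=0}^{m-1}$. Then $(s_j^{[1,\alpha]})_{j=0}^{m-1}\in\mathcal{K}^{\ge}_{q,m-1,\alpha}$ and $\mathcal{S}_{q,\alpha}[(s_j^{[1,\alpha]})_{j=0}^{m-1},\le]\neq\emptyset$. Furthermore, if $F\in\mathcal{S}_{q,\alpha}[(s_j^{[1,\alpha]})_{j=0}^{m-1},\le]$, then $F^{[-,\alpha,s_0]}\in\mathcal{S}_{q,\alpha}[(s_j)_{j=0}^m,\le]$.
   Context: Notation: $q$ is a positive integer; $A^*$ is the conjugate transpose and $A^\dagger$ the Moore-Penrose inverse of a complex matrix $A$; $A\ge0$ means non-negative Hermitian; $\operatorname{Im}A=\frac1{2i}(A-A^* )$; $\|\cdot\|$ is the operator norm. Classes of sequences. For complex $q\times q$ matrices put $H_n=(s_{j+k})_{j,k=0}^n$ and $K_n=(s_{j+k+1})_{j,k=0}^n$ (block Hankel matrices). $\mathcal{K}^{\ge}_{q,0,\alpha}$ is the set of $(s_0)$ with $s_0\ge0$; for $n\ge1$, $\mathcal{K}^{\ge}_{q,2n,\alpha}$ is the set of $(s_j)_{j=0}^{2n}$ with $H_n\ge0$ and $-\alpha H_{n-1}+K_{n-1}\ge0$; for $n\ge0$, $\mathcal{K}^{\ge}_{q,2n+1,\alpha}$ is the set of $(s_j)_{j=0}^{2n+1}$ with $H_n\ge0$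 and $-\alpha H_n+K_n\ge0$. $\mathcal{K}^{\ge,e}_{q,m,\alpha}$ is the set of $(s_j)_{j=0}^m$ for which there is a complex $q\times q$ matrix $s_{m+1}$ with $(s_j)_{j=0}^{m+1}\in\mathcal{K}^{\ge}_{q,m+1,\alpha}$. First $\alpha$-S-transform. Put $u_j=-\alpha s_{j-1}+s_j$ for $0\le j\le m$, with $s_{-1}=0$; let $u_0^\sharp=u_0^\dagger$, $u_j^\sharp=-u_0^\dagger\sum_{l=0}^{j-1}u_{j-l}u_l^\sharp$ for $1\le j\le m$; then $s_j^{[1,\alpha]}=-s_0u_{j+1}^\sharp s_0$ for $0\le j\le m-1$. Transform of functions. For $A\in\mathbb{C}^{q\times q}$ and $F:\mathbb{C}\setminus[\alpha,\infty)\to\mathbb{C}^{q\times q}$, $F^{[-,\alpha,A]}(z)=-(z-\alpha)^{-1}A\,[I_q+A^\dagger F(z)]^\dagger$ for $z\in\mathbb{C}\setminus[\alpha,\infty)$. Classes of functions. $\mathcal{S}_{q,\alpha}$ is the set of holomorphic $F:\mathbb{C}\setminus[\alpha,\infty)\to\mathbb{C}^{q\times q}$ with $\operatorname{Im}F(w)\ge0$ whenever $\operatorname{Im}w>0$ and $F(w)\ge0$ for $w\in(-\infty,\alpha)$. $\mathcal{S}_{0,q,\alpha}$ is the set of $F\in\mathcal{S}_{q,\alpha}$ with $\sup_{y\in[1,\infty)}y\|F(iy)\|<\infty$. For each $F\in\mathcal{S}_{0,q,\alpha}$ there is a unique non-negative Hermitian $q\times q$ measure $\sigma_F$ (a $\sigma$-additive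 map from the Borel subsets of $[\alpha,\infty)$ to the non-negative Hermitian matrices) with $F(z)=\int_{[\alpha,\infty)}(t-z)^{-1}\sigma_F(dt)$ (known fact). For a sequence $(t_j)_{j=0}^n$ of complex $q\times q$ matrices, $\mathcal{S}_{q,\alpha}[(t_j)_{j=0}^n,\le]$ is the set of $F\in\mathcal{S}_{0,q,\alpha}$ such that the moments $s_j^{(\sigma_F)}=\int_{[\alpha,\infty)}t^j\sigma_F(dt)$ exist for $j=0,\dots,n$, $s_j^{(\sigma_F)}=t_j$ for $0\le j\le n-1$, and $t_n-s_n^{(\sigma_F)}\ge0$. *)

theory Defs
  imports "HOL-Analysis.Analysis"
begin

subsection \<open>Complex matrices\<close>

definition ctranspose :: "complex^'n^'m \<Rightarrow> complex^'m^'n" where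
  "ctranspose A = (\<chi> i j. cnj (A $ j $ i))"

definition cscale :: "complex \<Rightarrow> complex^'n^'m \<Rightarrow> complex^'n^'m" where
  "cscale c A = (\<chi> i j. c * A $ i $ j)"

definition im_part :: "complex^'n^'n \<Rightarrow> complex^'n^'n" where
  "im_part A = cscale (1 / (2 * \<i>)) (A - ctranspose A)"

definition op_norm :: "complex^'n^'m \<Rightarrow> real" where
  "op_norm A = onorm (\<lambda>x. A *v x)"

definition moore_penrose :: "complex^'n^'m \<Rightarrow> complex^'m^'n" where
  "moore_penrose A = (THE X. A ** X ** A = A \<and> X ** A ** X = X \<and>
     ctranspose (A ** X) = A ** X \<and> ctranspose (X ** A) = X ** A)"

text \<open>
  Matrices whose size is not fixed by a type are functions \<open>'i \<Rightarrow> 'i \<Rightarrow> complex\<close>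
  read on a finite index set \<open>I\<close>. Since the matrix is Hermitian, the
  quadratic form is real, so taking the real part below loses nothing.
\<close>

definition nonneg_herm_on :: "'i set \<Rightarrow> ('i \<Rightarrow> 'i \<Rightarrow> complex) \<Rightarrow> bool" where
  "nonneg_herm_on I A \<longleftrightarrow>
     (\<forall>p\<in>I. \<forall>r\<in>I. cnj (A r p) = A p r) \<and>
     (\<forall>x. 0 \<le> Re (\<Sum>p\<in>I. \<Sum>r\<in>I. cnj (x p) * A p r * x r))"

definition nonneg_herm :: "complex^'n^'n \<Rightarrow> bool" where
  "nonneg_herm A \<longleftrightarrow> nonneg_herm_on UNIV (\<lambda>i j. A $ i $ j)"


subsection \<open>Matrix sequences\<close>

text \<open>
  A finite sequence \<open>(s\<^sub>j)\<close>, \<open>j = 0, \<dots>, m\<close>, is a function on \<open>nat\<close> of which only the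
  values at \<open>0, \<dots>, m\<close> are used; the size \<open>q\<close> of the matrices is \<open>CARD('q)\<close>.
  The entries of the block Hankel matrices \<open>H\<^sub>n\<close> and \<open>K\<^sub>n\<close> are indexed by
  (block index, index within the block), ranging over \<open>block_index n\<close>.
\<close>

definition block_index :: "nat \<Rightarrow> (nat \<times> 'q) set" where
  "block_index n = {..n} \<times> UNIV"

definition hankel_H :: "(nat \<Rightarrow> complex^'q^'q) \<Rightarrow> nat \<times> 'q \<Rightarrow> nat \<times> 'q \<Rightarrow> complex" where
  "hankel_H s = (\<lambda>(j, a) (k, b). s (j + k) $ a $ b)"

definition hankel_K :: "(nat \<Rightarrow> complex^'q^'q) \<Rightarrow> nat \<times> 'q \<Rightarrow> nat \<times> 'q \<Rightarrow> complex" where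
  "hankel_K s = (\<lambda>(j, a) (k, b). s (j + k + 1) $ a $ b)"

definition H_nonneg :: "nat \<Rightarrow> (nat \<Rightarrow> complex^'q^'q) \<Rightarrow> bool" where
  "H_nonneg n s \<longleftrightarrow> nonneg_herm_on (block_index n) (hankel_H s)"

definition HK_nonneg :: "real \<Rightarrow> nat \<Rightarrow> (nat \<Rightarrow> complex^'q^'q) \<Rightarrow> bool" where
  "HK_nonneg \<alpha> n s \<longleftrightarrow> nonneg_herm_on (block_index n)
     (\<lambda>p r. - complex_of_real \<alpha> * hankel_H s p r + hankel_K s p r)"

definition K_ge :: "real \<Rightarrow> nat \<Rightarrow> (nat \<Rightarrow> complex^'q^'q) set" where
  "K_ge \<alpha> m = {s. let n = m div 2 in
     if m = 0 then nonneg_herm (s 0)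
     else if even m then H_nonneg n s \<and> HK_nonneg \<alpha> (n - 1) s
     else H_nonneg n s \<and> HK_nonneg \<alpha> n s}"

definition K_ge_ext :: "real \<Rightarrow> nat \<Rightarrow> (nat \<Rightarrow> complex^'q^'q) set" where
  "K_ge_ext \<alpha> m = {s. \<exists>t. s(Suc m := t) \<in> K_ge \<alpha> (Suc m)}"

definition shift_seq :: "real \<Rightarrow> (nat \<Rightarrow> complex^'q^'q) \<Rightarrow> nat \<Rightarrow> complex^'q^'q" where
  "shift_seq \<alpha> s j = (if j = 0 then 0 else - (\<alpha> *\<^sub>R s (j - 1))) + s j"

fun recip_seq :: "(nat \<Rightarrow> complex^'q^'q) \<Rightarrow> nat \<Rightarrow> complex^'q^'q" where
  "recip_seq u 0 = moore_penrose (u 0)"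
| "recip_seq u (Suc j) =
     - (moore_penrose (u 0) ** (\<Sum>l\<le>j. u (Suc j - l) ** recip_seq u l))"

definition S_transform :: "real \<Rightarrow> (nat \<Rightarrow> complex^'q^'q) \<Rightarrow> nat \<Rightarrow> complex^'q^'q" where
  "S_transform \<alpha> s j = - (s 0 ** recip_seq (shift_seq \<alpha> s) (j + 1) ** s 0)"


subsection \<open>Non-negative Hermitian measures and their integrals\<close>

text \<open>Below, the measure space \<open>M\<close> only serves as a carrier of its \<open>\<sigma>\<close>-algebra.\<close>

definition nonneg_herm_measure :: "'a measure \<Rightarrow> ('a set \<Rightarrow> complex^'q^'q) \<Rightarrow> bool" where
  "nonneg_herm_measure M \<sigma> \<longleftrightarrow>
     (\<forall>B\<in>sets M. nonneg_herm (\<sigma> B)) \<and>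
     (\<forall>A. range A \<subseteq> sets M \<longrightarrow> disjoint_family A \<longrightarrow>
        (\<lambda>n::nat. \<sigma> (A n)) sums \<sigma> (\<Union>n. A n))"

definition trace_measure :: "'a measure \<Rightarrow> ('a set \<Rightarrow> complex^'q^'q) \<Rightarrow> 'a measure" where
  "trace_measure M \<sigma> = measure_of (space M) (sets M) (\<lambda>B. ennreal (Re (trace (\<sigma> B))))"

text \<open>
  The entries \<open>\<sigma>\<^sub>i\<^sub>j\<close> are complex measures, absolutely continuous with respect to the
  (finite) trace measure \<open>\<tau>\<close>. The matrix \<open>D\<close> of their Radon--Nikodym densities
  exists and is unique up to \<open>\<tau>\<close>-null sets. As \<open>\<bar>\<sigma>\<^sub>i\<^sub>j\<bar> = \<bar>D\<^sub>i\<^sub>j\<bar> d\<tau>\<close>, the integral of a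
  scalar function \<open>f\<close> exists iff \<open>f\<close> is integrable with respect to every \<open>\<bar>\<sigma>\<^sub>i\<^sub>j\<bar>\<close>,
  and it is then the matrix of the integrals of \<open>f\<close> with respect to the \<open>\<sigma>\<^sub>i\<^sub>j\<close>.
\<close>

definition trace_density ::
  "'a measure \<Rightarrow> ('a set \<Rightarrow> complex^'q^'q) \<Rightarrow> ('a \<Rightarrow> complex^'q^'q) \<Rightarrow> bool" where
  "trace_density M \<sigma> D \<longleftrightarrow>
     (\<forall>i j. integrable (trace_measure M \<sigma>) (\<lambda>t. D t $ i $ j) \<and>
        (\<forall>B\<in>sets M. \<sigma> B $ i $ j = (LINT t:B|trace_measure M \<sigma>. D t $ i $ j)))"

definition has_matrix_integral ::
  "'a measure \<Rightarrow> ('a set \<Rightarrow> complex^'q^'q) \<Rightarrow> ('a \<Rightarrow> complex) \<Rightarrow> complex^'q^'q \<Rightarrow> bool" where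
  "has_matrix_integral M \<sigma> f J \<longleftrightarrow>
     f \<in> borel_measurable M \<and>
     (\<exists>D. trace_density M \<sigma> D \<and>
        (\<forall>i j. integrable (trace_measure M \<sigma>) (\<lambda>t. f t * D t $ i $ j) \<and>
           J $ i $ j = (LINT t|trace_measure M \<sigma>. f t * D t $ i $ j)))"

abbreviation half_line :: "real \<Rightarrow> real measure" where
  "half_line \<alpha> \<equiv> restrict_space borel {\<alpha>..}"

definition has_moment ::
  "real \<Rightarrow> (real set \<Rightarrow> complex^'q^'q) \<Rightarrow> nat \<Rightarrow> complex^'q^'q \<Rightarrow> bool" where
  "has_moment \<alpha> \<sigma> j J \<longleftrightarrow> has_matrix_integral (half_line \<alpha>) \<sigma> (\<lambda>t. complex_of_real (t ^ j)) J"


subsection \<open>Matrix functions\<close>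

text \<open>
  Functions on \<open>cut_plane \<alpha>\<close> are total functions whose values elsewhere are irrelevant.
\<close>

definition cut_plane :: "real \<Rightarrow> complex set" where
  "cut_plane \<alpha> = - (complex_of_real ` {\<alpha>..})"

definition S_class :: "real \<Rightarrow> (complex \<Rightarrow> complex^'q^'q) set" where
  "S_class \<alpha> = {F. (\<forall>i j. (\<lambda>z. F z $ i $ j) holomorphic_on cut_plane \<alpha>) \<and>
     (\<forall>w. 0 < Im w \<longrightarrow> nonneg_herm (im_part (F w))) \<and>
     (\<forall>x::real. x < \<alpha> \<longrightarrow> nonneg_herm (F (complex_of_real x)))}"

definition S0_class :: "real \<Rightarrow> (complex \<Rightarrow> complex^'q^'q) set" where
  "S0_class \<alpha> = {F \<in> S_class \<alpha>.
     bdd_above ((\<lambda>y::real. y * op_norm (F (\<i> * complex_of_real y))) ` {1..})}"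

text \<open>
  \<open>stieltjes_measure \<alpha> F \<sigma>\<close> says that \<open>\<sigma>\<close> is the measure \<open>\<sigma>\<^sub>F\<close> of \<open>F\<close>; for \<open>F \<in> S0_class \<alpha>\<close>
  there is exactly one such \<open>\<sigma>\<close>, as a function on the Borel subsets of \<open>{\<alpha>..}\<close>.
\<close>

definition stieltjes_measure ::
  "real \<Rightarrow> (complex \<Rightarrow> complex^'q^'q) \<Rightarrow> (real set \<Rightarrow> complex^'q^'q) \<Rightarrow> bool" where
  "stieltjes_measure \<alpha> F \<sigma> \<longleftrightarrow>
     nonneg_herm_measure (half_line \<alpha>) \<sigma> \<and>
     (\<forall>z\<in>cut_plane \<alpha>.
        has_matrix_integral (half_line \<alpha>) \<sigma> (\<lambda>t. 1 / (complex_of_real t - z)) (F z))"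

definition S_moment_class ::
  "real \<Rightarrow> nat \<Rightarrow> (nat \<Rightarrow> complex^'q^'q) \<Rightarrow> (complex \<Rightarrow> complex^'q^'q) set" where
  "S_moment_class \<alpha> n t = {F \<in> S0_class \<alpha>. \<exists>\<sigma>. stieltjes_measure \<alpha> F \<sigma> \<and>
     (\<forall>j<n. has_moment \<alpha> \<sigma> j (t j)) \<and>
     (\<exists>J. has_moment \<alpha> \<sigma> n J \<and> nonneg_herm (t n - J))}"

definition inv_S_transform ::
  "real \<Rightarrow> complex^'q^'q \<Rightarrow> (complex \<Rightarrow> complex^'q^'q) \<Rightarrow> complex \<Rightarrow> complex^'q^'q" where
  "inv_S_transform \<alpha> A F z =
     - cscale (inverse (z - complex_of_real \<alpha>))
         (A ** moore_penrose (mat 1 + moore_penrose A ** F z))"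

end

theory Submission
  imports Defs "HOL-Probability.Helly_Selection" "HOL-Complex_Analysis.Cauchy_Integral_Formula"
    "HOL-Real_Asymp.Real_Asymp"
begin

text \<open>
  Put \<open>A = s\<^sub>0\<close>, let \<open>P\<close> be the projection onto its range, and read sequences as formal power
  series: \<open>u(x) = (1 - \<alpha>x) s(x)\<close>, \<open>u\<^sup>\<sharp>\<close> is its inverse on the range of \<open>A\<close>, and
  \<open>x t(x) = A - A u\<^sup>\<sharp>(x) A\<close> for the transform \<open>t\<close>. The Hankel matrices of \<open>t\<close> are then congruent
  to those of \<open>s\<close>:
  \<open>(x t(x) - y t(y)) / (x - y) = A u\<^sup>\<sharp>(x) \<cdot> (u(x) - u(y)) / (x - y) \<cdot> u\<^sup>\<sharp>(y) A\<close> gives \<open>H(t)\<close> from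
  \<open>-\<alpha>H(s) + K(s)\<close>, and in the same way \<open>A s(x)\<^sup>-\<^sup>1 \<cdot> (x s(x) - y s(y)) / (x - y) \<cdot> s(y)\<^sup>-\<^sup>1 A\<close> is the
  block sum of \<open>A\<close> and \<open>-\<alpha>H(t) + K(t)\<close>.

  For a function \<open>F\<close>, every quadratic form of \<open>G = F\<^sup>[\<^sup>-\<^sup>,\<^sup>\<alpha>\<^sup>,\<^sup>A\<^sup>]\<close> is again a Stieltjes function with
  \<open>z G(z) \<rightarrow> -A\<close> at infinity. Its measure is a weak limit, by Helly's theorem, of the measures with
  densities \<open>Im G(x + i\<epsilon>) / \<pi>\<close>; one subsequence serves all polarisation vectors, which makes the
  limit a matrix measure. The moments of \<open>G\<close> are read off its expansion in powers of \<open>1/x\<close> as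
  \<open>x \<rightarrow> -\<infinity>\<close>: inverting \<open>I + A\<^sup>\<dagger>F\<close> turns the expansion of \<open>F\<close> with coefficients \<open>t\<^sub>0, \<dots>, t\<^sub>m\<^sub>-\<^sub>1 - D\<close>
  into that of \<open>G\<close> with coefficients \<open>s\<^sub>0, \<dots>, s\<^sub>m - D\<close>. Existence follows by induction on \<open>m\<close>.
\<close>

section \<open>Complex matrices and quadratic forms\<close>

text \<open>The additional coefficient in \<open>K_ge_ext\<close> forces the ranges of all
  \<open>s j\<close> with j up to m into the range of A; without it the last one can escape. Only on
  that range is \<open>recip_seq\<close> a true inverse, which the expansion of G needs up to order
  m.

  The top moment of F is known only up to an inequality, so its defect D has to travel through the
  matrix inversion. It comes out as P D = D, because the measure of F has no mass in the null
  directions of A.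

  Weak limits are available for finitely many vectors only, and a matrix put together from such
  limits is not visibly positive, nor does it visibly have the limits as its quadratic form. Both
  facts are inherited from the stage before the limit, where the matrix is an integral of
  non-negative matrices.

  Total mass and tightness rest on z G(z) tending to -A uniformly on every half-plane Im z \<ge>
  \<epsilon>, a consequence of F tending to 0 there. Moments are read off at minus infinity because
  for t \<ge> 0 the kernels k/(t + k) increase with k, so a finite limit already proves that the
  moment exists.\<close>

definition cdot :: "complex^'n \<Rightarrow> complex^'n \<Rightarrow> complex" where
  "cdot v w = (\<Sum>i\<in>UNIV. cnj (v $ i) * w $ i)"

definition qform :: "complex^'n^'n \<Rightarrow> complex^'n \<Rightarrow> complex" where
  "qform H v = cdot v (H *v v)"

lemma cdot_simps:
  "cdot v (w + w') = cdot v w + cdot v w'" "cdot (v + v') w = cdot v w + cdot v' w"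
  "cdot v (w - w') = cdot v w - cdot v w'" "cdot (v - v') w = cdot v w - cdot v' w"
  "cdot v (- w) = - cdot v w" "cdot (- v) w = - cdot v w"
  "cdot v (c *s w) = c * cdot v w" "cdot (c *s v) w = cnj c * cdot v w"
  "cdot v 0 = 0" "cdot 0 w = 0"
  by (simp_all add: cdot_def algebra_simps sum.distrib sum_subtractf sum_negf sum_distrib_left)

lemma cdot_sum_right: "cdot v (sum f S) = (\<Sum>i\<in>S. cdot v (f i))"
  by (induction S rule: infinite_finite_induct) (simp_all add: cdot_simps)

lemma cdot_sum_left: "cdot (sum f S) w = (\<Sum>i\<in>S. cdot (f i) w)"
  by (induction S rule: infinite_finite_induct) (simp_all add: cdot_simps)

lemma cnj_cdot: "cnj (cdot v w) = cdot w v"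
  by (simp add: cdot_def mult.commute)

lemma cdot_self: "cdot v v = complex_of_real (\<Sum>i\<in>UNIV. (cmod (v $ i))\<^sup>2)"
  by (simp add: cdot_def complex_norm_square mult.commute del: of_real_power)

lemma cdot_self_eq_0: "cdot v v = 0 \<longleftrightarrow> v = 0"
proof
  assume "cdot v v = 0"
  then have "(\<Sum>i\<in>UNIV. (cmod (v $ i))\<^sup>2) = 0"
    unfolding cdot_self by (metis of_real_eq_0_iff)
  then show "v = 0"
    by (subst (asm) sum_nonneg_eq_0_iff) (auto simp: vec_eq_iff)
qed (simp add: cdot_simps)

lemma ctranspose_ctranspose [simp]: "ctranspose (ctranspose A) = A"
  by (simp add: ctranspose_def vec_eq_iff)

lemma ctranspose_mult: "ctranspose (A ** B) = ctranspose B ** ctranspose A"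
  by (simp add: ctranspose_def vec_eq_iff matrix_matrix_mult_def mult.commute)

lemma ctranspose_linear:
  "ctranspose (A + B) = ctranspose A + ctranspose B"
  "ctranspose (A - B) = ctranspose A - ctranspose B"
  "ctranspose (- A) = - ctranspose A"
  "ctranspose (r *\<^sub>R A) = r *\<^sub>R ctranspose A"
  "ctranspose 0 = 0"
  by (simp_all add: ctranspose_def vec_eq_iff)

lemma ctranspose_mat_1 [simp]: "ctranspose (mat 1) = mat 1"
  by (auto simp add: ctranspose_def vec_eq_iff mat_def)

lemma ctranspose_sum: "ctranspose (sum f S) = (\<Sum>i\<in>S. ctranspose (f i))"
  by (induction S rule: infinite_finite_induct) (simp_all add: ctranspose_linear)

lemma cdot_mult_left: "cdot (A *v v) w = cdot v (ctranspose A *v w)"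
proof -
  have "cdot (A *v v) w = (\<Sum>i\<in>UNIV. \<Sum>j\<in>UNIV. cnj (A $ i $ j) * cnj (v $ j) * w $ i)"
    by (simp add: cdot_def matrix_vector_mult_def sum_distrib_right)
  also have "\<dots> = (\<Sum>j\<in>UNIV. \<Sum>i\<in>UNIV. cnj (A $ i $ j) * cnj (v $ j) * w $ i)"
    by (rule sum.swap)
  also have "\<dots> = cdot v (ctranspose A *v w)"
    by (simp add: cdot_def matrix_vector_mult_def ctranspose_def sum_distrib_left algebra_simps)
  finally show ?thesis .
qed

lemma matrix_smult_right: "A *v (c *s w) = c *s (A *v (w :: complex^'n))"
  by (simp add: matrix_vector_mult_def vec_eq_iff sum_distrib_left algebra_simps)

lemma cscale_mult_vector: "cscale c A *v w = c *s (A *v w)"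
  by (simp add: cscale_def matrix_vector_mult_def vec_eq_iff sum_distrib_left algebra_simps)

lemma scaleR_mult_vector: "(r *\<^sub>R A) *v w = complex_of_real r *s (A *v w)"
  by (simp add: matrix_vector_mult_def vec_eq_iff sum_distrib_left algebra_simps
      scaleR_conv_of_real[where 'a=complex])

lemma matrix_axis: "(A *v axis j 1) $ i = (A :: complex^'n^'m) $ i $ j"
  by (simp add: matrix_vector_mult_def axis_def if_distrib cong: if_cong)

lemma cdot_axis: "cdot (axis i 1) (A *v axis j 1) = A $ i $ j"
proof -
  have "cdot (axis i 1) (A *v axis j 1) = (\<Sum>k\<in>UNIV. if k = i then (A *v axis j 1) $ k else 0)"
    unfolding cdot_def by (intro sum.cong) (auto simp: axis_def)
  then show ?thesis by (simp add: matrix_axis)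
qed

section \<open>Polarisation, Hermitian and non-negative matrices\<close>

lemma polarisation:
  "cdot v (H *v w) = (qform H (v + w) - qform H (v - w)
     - \<i> * qform H (v + \<i> *s w) + \<i> * qform H (v - \<i> *s w)) / 4"
  by (simp add: qform_def cdot_simps matrix_vector_right_distrib matrix_vector_mult_diff_distrib
      matrix_smult_right algebra_simps)

text \<open>Over the complex numbers the quadratic form determines the matrix. Four fixed vectors
  per entry suffice, which later reduces matrix-valued limits and integrals to finitely many scalar
  ones.\<close>

lemma polarisation_entry:
  "H $ i $ j = (qform H (axis i 1 + axis j 1) - qform H (axis i 1 - axis j 1)
     - \<i> * qform H (axis i 1 + \<i> *s axis j 1) + \<i> * qform H (axis i 1 - \<i> *s axis j 1)) / 4"
  using polarisation[of "axis i 1" H "axis j 1"] by (simp add: cdot_axis)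

lemma qform_ext: "(\<And>v. qform A v = qform B v) \<Longrightarrow> A = B"
  by (simp add: vec_eq_iff polarisation_entry)

lemma qform_sum: "qform H v = (\<Sum>i\<in>UNIV. \<Sum>j\<in>UNIV. cnj (v $ i) * v $ j * H $ i $ j)"
  by (simp add: qform_def cdot_def matrix_vector_mult_def sum_distrib_left algebra_simps)

lemma qform_ctranspose: "qform (ctranspose H) v = cnj (qform H v)"
  by (simp add: qform_def cnj_cdot cdot_mult_left)

lemma hermitian_iff_real: "ctranspose H = H \<longleftrightarrow> (\<forall>v. qform H v \<in> \<real>)"
proof
  assume "ctranspose H = H"
  then show "\<forall>v. qform H v \<in> \<real>"
    using qform_ctranspose[of H] by (metis Reals_cnj_iff)
next
  assume "\<forall>v. qform H v \<in> \<real>"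
  then show "ctranspose H = H"
    by (intro qform_ext) (simp add: qform_ctranspose Reals_cnj_iff)
qed

lemma nonneg_herm_iff:
  "nonneg_herm H \<longleftrightarrow> ctranspose H = H \<and> (\<forall>v. 0 \<le> Re (qform H v))"
proof -
  have "(\<forall>x. 0 \<le> Re (\<Sum>p\<in>UNIV. \<Sum>r\<in>UNIV. cnj (x p) * H $ p $ r * x r)) \<longleftrightarrow>
        (\<forall>v. 0 \<le> Re (qform H v))" (is "?L \<longleftrightarrow> ?R")
  proof
    assume ?L then show ?R by (auto simp: qform_sum mult_ac)
  next
    assume R: ?R
    show ?L
    proof
      fix x
      show "0 \<le> Re (\<Sum>p\<in>UNIV. \<Sum>r\<in>UNIV. cnj (x p) * H $ p $ r * x r)"
        using R[rule_format, of "\<chi> i. x i"] by (simp add: qform_sum mult_ac)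
    qed
  qed
  then show ?thesis
    by (auto simp: nonneg_herm_def nonneg_herm_on_def ctranspose_def vec_eq_iff)
qed

lemma nonneg_hermD:
  assumes "nonneg_herm H"
  shows "ctranspose H = H" "0 \<le> Re (qform H v)" "qform H v = complex_of_real (Re (qform H v))"
  using assms hermitian_iff_real[of H] by (auto simp: nonneg_herm_iff)

lemma nonneg_hermI: "(\<And>v. qform H v \<in> \<real>) \<Longrightarrow> (\<And>v. 0 \<le> Re (qform H v)) \<Longrightarrow> nonneg_herm H"
  using hermitian_iff_real[of H] by (simp add: nonneg_herm_iff)

lemma qform_add: "qform (A + B) v = qform A v + qform B v"
  by (simp add: qform_def cdot_simps matrix_vector_mult_add_rdistrib)

lemma qform_diff: "qform (A - B) v = qform A v - qform B v"
  by (simp add: qform_def cdot_simps matrix_vector_mult_diff_rdistrib)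

lemma qform_cscale: "qform (cscale c A) v = c * qform A v"
  by (simp add: qform_def cdot_simps cscale_mult_vector)

lemma qform_zero [simp]: "qform 0 v = 0"
  by (simp add: qform_def cdot_simps)

lemma qform_im_part: "qform (im_part A) v = complex_of_real (Im (qform A v))"
  by (simp add: im_part_def qform_cscale qform_diff qform_ctranspose) (simp add: complex_eq_iff)

lemma nonneg_herm_im_part_iff: "nonneg_herm (im_part A) \<longleftrightarrow> (\<forall>v. 0 \<le> Im (qform A v))"
  using nonneg_hermI[of "im_part A"] by (auto simp: nonneg_herm_iff qform_im_part)

text \<open>If c were positive, the linear term would beat the quadratic one for small positive
  r.\<close>

lemma quadratic_nonneg_linear_zero:
  fixes c d :: real
  assumes ineq: "\<And>r. 0 \<le> - 2 * r * c + r\<^sup>2 * d" and "c \<ge> 0"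
  shows "c = 0"
proof (rule ccontr)
  assume "c \<noteq> 0"
  then have "c > 0" using assms by simp
  define D where "D = \<bar>d\<bar>"
  have "D \<ge> 0" by (simp add: D_def)
  \<comment> \<open>Any r > 0 with r d < 2 c gives a contradiction; dividing by \<open>D + 1\<close>
    rather than \<open>D\<close> also covers d = 0.\<close>
  have "0 \<le> - 2 * (c / (D + 1)) * c + (c / (D + 1))\<^sup>2 * d" using ineq by blast
  also have "\<dots> \<le> - 2 * (c / (D + 1)) * c + (c / (D + 1))\<^sup>2 * D"
    by (intro add_left_mono mult_left_mono) (auto simp: D_def)
  also have "\<dots> = (c / (D + 1))\<^sup>2 * (- 2 * (D + 1) + D)"
    using \<open>D \<ge> 0\<close> by (simp add: power2_eq_square divide_simps) (simp add: algebra_simps)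
  also have "\<dots> < 0"
    using \<open>c > 0\<close> \<open>D \<ge> 0\<close> by (intro mult_pos_neg) auto
  finally show False by simp
qed

text \<open>Minimising the quadratic form along a line through a null vector.\<close>

lemma nonneg_herm_null:
  assumes "nonneg_herm H" "qform H v = 0"
  shows "H *v v = 0"
proof -
  let ?w = "H *v v"
  have H: "ctranspose H = H" using assms by (simp add: nonneg_herm_iff)
  define c where "c = Re (cdot ?w ?w)"
  have c: "cdot ?w ?w = complex_of_real c" by (simp add: c_def cdot_self)
  have ineq: "0 \<le> - 2 * r * c + r\<^sup>2 * Re (qform H ?w)" for r :: real
  proof -
    have 1: "cdot v (H *v ?w) = complex_of_real c"
      using c by (metis H cdot_mult_left)
    have "qform H (v - complex_of_real r *s ?w)
        = - 2 * complex_of_real r * complex_of_real c + (complex_of_real r)\<^sup>2 * qform H ?w"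
      using assms(2) by (simp add: qform_def cdot_simps matrix_vector_mult_diff_distrib
          matrix_smult_right c 1 power2_eq_square algebra_simps)
    then have "Re (qform H (v - complex_of_real r *s ?w)) = - 2 * r * c + r\<^sup>2 * Re (qform H ?w)"
      by (simp add: power2_eq_square)
    then show ?thesis using assms(1) by (metis nonneg_herm_iff)
  qed
  have "c \<ge> 0" by (simp add: c_def cdot_self sum_nonneg)
  then have "c = 0" using quadratic_nonneg_linear_zero[OF ineq] by blast
  then have "cdot ?w ?w = 0" using c by simp
  then show ?thesis by (simp add: cdot_self_eq_0)
qed

section \<open>The Moore-Penrose inverse of a Hermitian matrix\<close>

lemma mult_self_null:
  assumes "ctranspose A = A" "A *v (A *v v) = 0"
  shows "A *v v = 0"
  using assms cdot_mult_left[of A v "A *v v"] by (simp add: cdot_self_eq_0 cdot_simps)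

lemma matrix_eq_iff_vector: "A = B \<longleftrightarrow> (\<forall>v. A *v v = B *v (v :: complex^'n))"
  by (metis matrix_eq)

definition is_moore_penrose :: "complex^'n^'m \<Rightarrow> complex^'m^'n \<Rightarrow> bool" where
  "is_moore_penrose A X \<longleftrightarrow> A ** X ** A = A \<and> X ** A ** X = X \<and>
     ctranspose (A ** X) = A ** X \<and> ctranspose (X ** A) = X ** A"

text \<open>\<open>A ** X\<close> and \<open>A ** Y\<close> are Hermitian and each is fixed under
  left multiplication by the other, so taking adjoints identifies them. The same holds for
  \<open>X ** A\<close> and \<open>Y ** A\<close>, and X A X = X recovers X from these
  products.\<close>

lemma is_moore_penrose_unique:
  assumes "is_moore_penrose A X" "is_moore_penrose A Y"
  shows "X = Y"
proof -
  have X: "A ** X ** A = A" "X ** A ** X = X"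
      "ctranspose (A ** X) = A ** X" "ctranspose (X ** A) = X ** A"
   and Y: "A ** Y ** A = A" "Y ** A ** Y = Y"
      "ctranspose (A ** Y) = A ** Y" "ctranspose (Y ** A) = Y ** A"
    using assms by (auto simp: is_moore_penrose_def)
  have AX: "A ** X = A ** Y"
    by (metis X(1,3) Y(1,3) ctranspose_mult matrix_mul_assoc)
  have XA: "X ** A = Y ** A"
    by (metis X(1,4) Y(1,4) ctranspose_mult matrix_mul_assoc)
  show ?thesis by (metis AX XA X(2) Y(2) matrix_mul_assoc)
qed

lemma moore_penroseI: "is_moore_penrose A X \<Longrightarrow> moore_penrose A = X"
  unfolding moore_penrose_def
  by (rule the_equality) (use is_moore_penrose_unique in \<open>auto simp: is_moore_penrose_def\<close>)

text \<open>A Hermitian matrix is injective on its own range, hence by dimension maps the range onto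
  itself. So every column of A is the image under A twice of some vector, and these vectors are the
  columns of X.\<close>

lemma hermitian_range_square:
  assumes "ctranspose A = A"
  obtains X where "A ** A ** X = (A :: complex^'n^'n)"
proof -
  let ?R = "range ((*v) A)"
  have lin: "Vector_Spaces.linear (*s) (*s) ((*v) A)" by (rule matrix_vector_mul_linear_gen)
  have sub: "vec.subspace ?R"
    using lin vec.linear_subspace_image vec.subspace_UNIV by blast
  have "inj_on ((*v) A) ?R"
  proof (rule inj_onI)
    fix x y assume "x \<in> ?R" "y \<in> ?R" and eq: "A *v x = A *v y"
    then obtain a b where ab: "x = A *v a" "y = A *v b" by auto
    then have "A *v (A *v (a - b)) = 0" using eq by (simp add: matrix_vector_mult_diff_distrib)
    then have "A *v (a - b) = 0" using mult_self_null assms by blast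
    then show "x = y" using ab by (simp add: matrix_vector_mult_diff_distrib)
  qed
  then have "vec.dim ((*v) A ` ?R) = vec.dim ?R"
    using vec.dim_image_eq[OF lin, of ?R] vec.span_eq_iff[THEN iffD2, OF sub] by simp
  moreover have "vec.subspace ((*v) A ` ?R)"
    using lin vec.linear_subspace_image sub by blast
  ultimately have eq: "(*v) A ` ?R = ?R"
    by (intro vec.subspace_dim_equal) (auto simp: sub)
  have "\<forall>j. \<exists>x. A *v (A *v x) = A *v axis j 1"
    using eq by (smt (verit) image_iff rangeI)
  then obtain x where x: "\<And>j. A *v (A *v x j) = A *v axis j 1" by metis
  have "A ** A ** (\<chi> i j. x j $ i) = A"
  proof -
    have "(A ** A ** (\<chi> i j. x j $ i)) *v axis j 1 = A *v axis j 1" for j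
    proof -
      have "(\<chi> i j. x j $ i) *v axis j 1 = x j"
        by (simp add: vec_eq_iff matrix_axis)
      then show ?thesis using x[of j] by (simp add: matrix_vector_mul_assoc[symmetric])
    qed
    then show ?thesis by (metis matrix_axis vec_eq_iff)
  qed
  then show ?thesis using that by blast
qed

text \<open>With A A Z = A, the product \<open>A ** Z\<close> is a Hermitian projection that acts as
  identity on A from both sides. Range and corange projection therefore coincide, and the inverse is
  Hermitian and commutes with A.\<close>

lemma hermitian_moore_penrose:
  assumes "ctranspose A = (A :: complex^'n^'n)"
  defines "X \<equiv> moore_penrose A"
  shows "is_moore_penrose A X" "ctranspose X = X" "A ** X = X ** A"
proof -
  obtain Z where Z: "A ** A ** Z = A" using hermitian_range_square assms by blast
  have AZA: "A ** Z ** A = A"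
  proof -
    have "A *v ((A ** Z ** A) *v v - A *v v) = 0" for v
      using Z by (simp add: matrix_vector_mult_diff_distrib matrix_vector_mul_assoc matrix_mul_assoc)
    then have "A *v (A *v (Z *v (A *v v) - v)) = 0" for v
      by (simp add: matrix_vector_mult_diff_distrib matrix_vector_mul_assoc matrix_mul_assoc)
    then have "A *v (Z *v (A *v v) - v) = 0" for v
      using mult_self_null assms by blast
    then show ?thesis
      by (simp add: matrix_eq_iff_vector matrix_vector_mult_diff_distrib matrix_vector_mul_assoc
          matrix_mul_assoc)
  qed
  let ?Z = "ctranspose Z"
  have Z': "?Z ** A ** A = A"
    by (metis Z assms(1) ctranspose_mult matrix_mul_assoc)
  have AZA': "A ** ?Z ** A = A"
    by (metis AZA assms(1) ctranspose_mult matrix_mul_assoc)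
  have herm: "?Z ** A = A ** Z"
    by (metis Z Z' matrix_mul_assoc)
  \<comment> \<open>Z only satisfies A Z A = A. Placing A between the adjoint of Z and Z gives a
    Hermitian matrix that also satisfies Y A Y = Y.\<close>
  define Y where "Y = ?Z ** A ** Z"
  have AY: "A ** Y = A ** Z" by (metis Y_def AZA' matrix_mul_assoc)
  have YA: "Y ** A = A ** Z" by (metis Y_def AZA herm matrix_mul_assoc)
  have hY: "ctranspose Y = Y" by (simp add: Y_def ctranspose_mult assms(1) matrix_mul_assoc)
  have hAZ: "ctranspose (A ** Z) = A ** Z" by (simp add: ctranspose_mult assms(1) herm)
  have "Y ** A ** Y = Y"
    by (metis AY YA Y_def AZA' herm matrix_mul_assoc)
  then have mp: "is_moore_penrose A Y"
    unfolding is_moore_penrose_def using AY YA hAZ AZA by simp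
  then have "X = Y" unfolding X_def by (rule moore_penroseI)
  then show "is_moore_penrose A X" "ctranspose X = X" "A ** X = X ** A"
    using mp hY AY YA by auto
qed

lemma moore_penrose_inverse:
  assumes "A ** B = mat 1" "B ** A = mat 1"
  shows "moore_penrose A = B"
  by (rule moore_penroseI) (simp add: is_moore_penrose_def assms)

section \<open>Block Hankel matrices\<close>

lemma matrix_add_rdistrib: "(A + B) ** C = A ** C + B ** (C :: complex^'n^'k)"
  by (simp add: matrix_matrix_mult_def vec_eq_iff sum.distrib algebra_simps)

lemma matrix_sub_ldistrib: "C ** (A - B) = C ** A - C ** (B :: complex^'n^'k)"
  by (simp add: matrix_matrix_mult_def vec_eq_iff sum_subtractf algebra_simps)

lemma matrix_sub_rdistrib: "(A - B) ** C = A ** C - B ** (C :: complex^'n^'k)"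
  by (simp add: matrix_matrix_mult_def vec_eq_iff sum_subtractf algebra_simps)

lemma matrix_mult_sum_left: "sum f S ** (B :: complex^'n^'k) = (\<Sum>i\<in>S. f i ** B)"
  by (induction S rule: infinite_finite_induct) (simp_all add: matrix_add_rdistrib)

lemma matrix_mult_sum_right: "(B :: complex^'n^'k) ** sum f S = (\<Sum>i\<in>S. B ** f i)"
  by (induction S rule: infinite_finite_induct) (simp_all add: matrix_add_ldistrib)

lemma matrix_vector_sum_left: "sum f S *v (v :: complex^'n) = (\<Sum>i\<in>S. f i *v v)"
  by (induction S rule: infinite_finite_induct) (simp_all add: matrix_vector_mult_add_rdistrib)

lemma matrix_vector_sum_right: "(B :: complex^'n^'k) *v sum f S = (\<Sum>i\<in>S. B *v f i)"
  by (induction S rule: infinite_finite_induct) (simp_all add: matrix_vector_right_distrib)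

lemma matrix_mult_minus: "(- A) ** B = - (A ** B)" "A ** (- B) = - (A ** (B :: complex^'n^'k))"
  by (simp_all add: matrix_matrix_mult_def vec_eq_iff sum_negf)

lemma matrix_mult_scaleR: "(r *\<^sub>R A) ** B = r *\<^sub>R (A ** B)" "A ** (r *\<^sub>R B) = r *\<^sub>R (A ** (B :: complex^'n^'k))"
  by (simp_all add: matrix_matrix_mult_def vec_eq_iff scaleR_sum_right)

lemmas matrix_ring_simps = matrix_add_ldistrib matrix_add_rdistrib matrix_sub_ldistrib
  matrix_sub_rdistrib matrix_mult_minus matrix_mult_scaleR

section \<open>Positivity of block matrices\<close>

definition block_nonneg :: "nat \<Rightarrow> (nat \<Rightarrow> nat \<Rightarrow> complex^'q^'q) \<Rightarrow> bool" where
  "block_nonneg n M \<longleftrightarrow> (\<forall>j\<le>n. \<forall>k\<le>n. ctranspose (M k j) = M j k) \<and>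
     (\<forall>x. 0 \<le> Re (\<Sum>j\<le>n. \<Sum>k\<le>n. cdot (x j) (M j k *v x k)))"

lemma block_nonnegD:
  assumes "block_nonneg n M"
  shows "0 \<le> Re (\<Sum>j\<le>n. \<Sum>k\<le>n. cdot (x j) (M j k *v x k))"
  using assms unfolding block_nonneg_def by blast

text \<open>Splits an index into block number and position within the block, so that everything
  below computes with whole blocks as non-commuting coefficients.\<close>

lemma nonneg_herm_on_block:
  "nonneg_herm_on (block_index n) (\<lambda>p r. M (fst p) (fst r) $ snd p $ snd r) \<longleftrightarrow> block_nonneg n M"
proof -
  have sum_eq: "(\<Sum>p\<in>block_index n. \<Sum>r\<in>block_index n. cnj (y p) * M (fst p) (fst r) $ snd p $ snd r * y r)
     = (\<Sum>j\<le>n. \<Sum>k\<le>n. cdot (x j) (M j k *v x k))"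
    if "\<And>j a. y (j, a) = x j $ a" for y and x :: "nat \<Rightarrow> complex^'a"
  proof -
    have "(\<Sum>p\<in>block_index n. \<Sum>r\<in>block_index n. cnj (y p) * M (fst p) (fst r) $ snd p $ snd r * y r)
       = (\<Sum>j\<le>n. \<Sum>a\<in>UNIV. \<Sum>k\<le>n. \<Sum>b\<in>UNIV. cnj (x j $ a) * M j k $ a $ b * x k $ b)"
      by (simp add: block_index_def sum.cartesian_product' that)
    also have "\<dots> = (\<Sum>j\<le>n. \<Sum>k\<le>n. \<Sum>a\<in>UNIV. \<Sum>b\<in>UNIV. cnj (x j $ a) * M j k $ a $ b * x k $ b)"
      by (intro sum.cong refl sum.swap)
    also have "\<dots> = (\<Sum>j\<le>n. \<Sum>k\<le>n. cdot (x j) (M j k *v x k))"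
      by (simp add: cdot_def matrix_vector_mult_def sum_distrib_left mult.assoc)
    finally show ?thesis .
  qed
  have "(\<forall>y. 0 \<le> Re (\<Sum>p\<in>block_index n. \<Sum>r\<in>block_index n.
           cnj (y p) * M (fst p) (fst r) $ snd p $ snd r * y r)) \<longleftrightarrow>
        (\<forall>x. 0 \<le> Re (\<Sum>j\<le>n. \<Sum>k\<le>n. cdot (x j) (M j k *v x k)))" (is "?L \<longleftrightarrow> ?R")
  proof
    assume L: ?L
    show ?R
    proof
      fix x :: "nat \<Rightarrow> complex^'a"
      show "0 \<le> Re (\<Sum>j\<le>n. \<Sum>k\<le>n. cdot (x j) (M j k *v x k))"
        using L[rule_format, of "\<lambda>(j, a). x j $ a"] sum_eq[of "\<lambda>(j, a). x j $ a" x] by simp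
    qed
  next
    assume R: ?R
    show ?L
    proof
      fix y
      show "0 \<le> Re (\<Sum>p\<in>block_index n. \<Sum>r\<in>block_index n.
           cnj (y p) * M (fst p) (fst r) $ snd p $ snd r * y r)"
        using R[rule_format, of "\<lambda>j. \<chi> a. y (j, a)"] sum_eq[of y "\<lambda>j. \<chi> a. y (j, a)"] by simp
    qed
  qed
  moreover have "(\<forall>p\<in>block_index n. \<forall>r\<in>block_index n.
        cnj (M (fst r) (fst p) $ snd r $ snd p) = M (fst p) (fst r) $ snd p $ snd r) \<longleftrightarrow>
      (\<forall>j\<le>n. \<forall>k\<le>n. ctranspose (M k j) = M j k)"
    by (auto simp: block_index_def ctranspose_def vec_eq_iff)
  ultimately show ?thesis
    by (simp add: nonneg_herm_on_def block_nonneg_def)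
qed

lemma H_nonneg_iff: "H_nonneg n s \<longleftrightarrow> block_nonneg n (\<lambda>j k. s (j + k))"
proof -
  have "hankel_H s = (\<lambda>p r. s (fst p + fst r) $ snd p $ snd r)"
    by (simp add: hankel_H_def fun_eq_iff split_beta)
  then show ?thesis
    unfolding H_nonneg_def using nonneg_herm_on_block[of n "\<lambda>j k. s (j + k)"] by simp
qed

lemma HK_nonneg_iff: "HK_nonneg \<alpha> n s \<longleftrightarrow> block_nonneg n (\<lambda>j k. shift_seq \<alpha> s (j + k + 1))"
proof -
  have "(\<lambda>p r. - complex_of_real \<alpha> * hankel_H s p r + hankel_K s p r) =
    (\<lambda>p r. shift_seq \<alpha> s (fst p + fst r + 1) $ snd p $ snd r)"
    by (auto simp: hankel_H_def hankel_K_def shift_seq_def scaleR_conv_of_real[where 'a=complex] fun_eq_iff)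
  then show ?thesis
    unfolding HK_nonneg_def using nonneg_herm_on_block[of n "\<lambda>j k. shift_seq \<alpha> s (j + k + 1)"] by simp
qed

lemma block_nonneg_cong:
  "(\<And>j k. j \<le> n \<Longrightarrow> k \<le> n \<Longrightarrow> M j k = M' j k) \<Longrightarrow> block_nonneg n M \<longleftrightarrow> block_nonneg n M'"
  by (simp add: block_nonneg_def)

lemma block_nonneg_0: "block_nonneg 0 M \<longleftrightarrow> nonneg_herm (M 0 0)"
proof -
  have "(\<forall>x::nat \<Rightarrow> complex^'a. 0 \<le> Re (cdot (x 0) (M 0 0 *v x 0))) \<longleftrightarrow> (\<forall>v. 0 \<le> Re (qform (M 0 0) v))"
    unfolding qform_def by (rule iffI; (rule allI, drule_tac x="\<lambda>_. v" in spec)?) simp_all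
  then show ?thesis by (auto simp: block_nonneg_def nonneg_herm_iff)
qed

text \<open>Writing both sizes as floors merges the parity cases, and shows why one step of the
  transform exchanges the two conditions: the \<open>HK_nonneg\<close> size for m + 1 is the
  \<open>H_nonneg\<close> size for m.\<close>

lemma K_ge_iff:
  "s \<in> K_ge \<alpha> m \<longleftrightarrow> H_nonneg (m div 2) s \<and> (1 \<le> m \<longrightarrow> HK_nonneg \<alpha> ((m - 1) div 2) s)"
proof (cases "m = 0")
  case True
  then show ?thesis by (simp add: K_ge_def H_nonneg_iff block_nonneg_0)
next
  case False
  have "even m \<Longrightarrow> (m - 1) div 2 = m div 2 - 1" "odd m \<Longrightarrow> (m - 1) div 2 = m div 2"
    using False by (auto elim!: evenE oddE)
  with False show ?thesis by (auto simp: K_ge_def Let_def)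
qed

text \<open>Principal submatrices: a vector on the selected indices is padded with zeros.\<close>

lemma block_nonneg_restrict:
  assumes "block_nonneg n M" "inj_on f {..k}" "f ` {..k} \<subseteq> {..n}"
  shows "block_nonneg k (\<lambda>i j. M (f i) (f j))"
  unfolding block_nonneg_def
proof (intro conjI allI impI)
  fix i j assume "i \<le> k" "j \<le> k"
  then show "ctranspose (M (f j) (f i)) = M (f i) (f j)"
    using assms by (auto simp: block_nonneg_def image_subset_iff)
next
  fix x :: "nat \<Rightarrow> complex^'a"
  define y where "y i = (if i \<in> f ` {..k} then x (inv_into {..k} f i) else 0)" for i
  have y: "y (f i) = x i" if "i \<le> k" for i
    using that assms(2) by (simp add: y_def)
  have "(\<Sum>i\<le>n. \<Sum>j\<le>n. cdot (y i) (M i j *v y j)) =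
        (\<Sum>i\<in>f ` {..k}. \<Sum>j\<in>f ` {..k}. cdot (y i) (M i j *v y j))"
    using assms(3) by (intro sum.mono_neutral_cong_right)
      (auto simp: y_def cdot_simps intro!: sum.mono_neutral_cong_right sum.neutral)
  also have "\<dots> = (\<Sum>i\<le>k. \<Sum>j\<le>k. cdot (x i) (M (f i) (f j) *v x j))"
    by (simp add: sum.reindex[OF assms(2)] y)
  finally show "0 \<le> Re (\<Sum>i\<le>k. \<Sum>j\<le>k. cdot (x i) (M (f i) (f j) *v x j))"
    using block_nonnegD[OF assms(1), of y] by (simp only:)
qed

text \<open>\<open>C k a\<close> is the block in row a and column k of a block matrix C. The form at
  x is the form of M at the image \<open>y\<close> of x under C.\<close>

lemma block_nonneg_congruence:
  fixes M C :: "nat \<Rightarrow> nat \<Rightarrow> complex^'q^'q"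
  assumes "block_nonneg n M"
  shows "block_nonneg p (\<lambda>j k. \<Sum>a\<le>n. \<Sum>b\<le>n. ctranspose (C j a) ** M a b ** C k b)"
  unfolding block_nonneg_def
proof (intro conjI allI impI)
  fix j k
  have M: "ctranspose (M b a) = M a b" if "a \<le> n" "b \<le> n" for a b
    using assms that by (simp add: block_nonneg_def)
  have "ctranspose (\<Sum>a\<le>n. \<Sum>b\<le>n. ctranspose (C k a) ** M a b ** C j b)
      = (\<Sum>a\<le>n. \<Sum>b\<le>n. ctranspose (C j b) ** M b a ** C k a)"
    unfolding ctranspose_sum ctranspose_mult ctranspose_ctranspose matrix_mul_assoc
    by (intro sum.cong refl) (simp add: M)
  also have "\<dots> = (\<Sum>a\<le>n. \<Sum>b\<le>n. ctranspose (C j a) ** M a b ** C k b)"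
    by (rule sum.swap)
  finally show "ctranspose (\<Sum>a\<le>n. \<Sum>b\<le>n. ctranspose (C k a) ** M a b ** C j b)
     = (\<Sum>a\<le>n. \<Sum>b\<le>n. ctranspose (C j a) ** M a b ** C k b)" .
next
  fix x :: "nat \<Rightarrow> complex^'q"
  define y where "y a = (\<Sum>k\<le>p. C k a *v x k)" for a
  have "(\<Sum>j\<le>p. \<Sum>k\<le>p. cdot (x j) ((\<Sum>a\<le>n. \<Sum>b\<le>n. ctranspose (C j a) ** M a b ** C k b) *v x k))
      = (\<Sum>j\<le>p. \<Sum>k\<le>p. \<Sum>a\<le>n. \<Sum>b\<le>n. cdot (C j a *v x j) (M a b *v (C k b *v x k)))"
    by (simp only: matrix_vector_sum_left cdot_sum_right cdot_mult_left matrix_vector_mul_assoc matrix_mul_assoc)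
  also have "\<dots> = (\<Sum>j\<le>p. \<Sum>a\<le>n. \<Sum>k\<le>p. \<Sum>b\<le>n. cdot (C j a *v x j) (M a b *v (C k b *v x k)))"
    by (rule sum.cong[OF refl], rule sum.swap)
  also have "\<dots> = (\<Sum>a\<le>n. \<Sum>j\<le>p. \<Sum>b\<le>n. \<Sum>k\<le>p. cdot (C j a *v x j) (M a b *v (C k b *v x k)))"
    by (subst sum.swap, rule sum.cong[OF refl], rule sum.cong[OF refl], rule sum.swap)
  also have "\<dots> = (\<Sum>a\<le>n. \<Sum>b\<le>n. \<Sum>j\<le>p. \<Sum>k\<le>p. cdot (C j a *v x j) (M a b *v (C k b *v x k)))"
    by (rule sum.cong[OF refl], rule sum.swap)
  also have "\<dots> = (\<Sum>a\<le>n. \<Sum>b\<le>n. cdot (y a) (M a b *v y b))"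
    by (simp only: y_def matrix_vector_sum_right cdot_sum_left cdot_sum_right)
       (rule sum.cong[OF refl], rule sum.cong[OF refl], rule sum.swap)
  finally show "0 \<le> Re (\<Sum>j\<le>p. \<Sum>k\<le>p. cdot (x j)
       ((\<Sum>a\<le>n. \<Sum>b\<le>n. ctranspose (C j a) ** M a b ** C k b) *v x k))"
    using block_nonnegD[OF assms(1), of y] by (simp only:)
qed

text \<open>The coefficient of \<open>x\<^sup>j y\<^sup>k\<close> in \<open>l(x) \<cdot> (c(x) - c(y)) / (x - y) \<cdot> r(y)\<close>; multiplying by
  \<open>x - y\<close> gives the recursion \<open>hankel_sandwich_step\<close>.\<close>

definition hankel_sandwich ::
  "(nat \<Rightarrow> complex^'q^'q) \<Rightarrow> (nat \<Rightarrow> complex^'q^'q) \<Rightarrow> (nat \<Rightarrow> complex^'q^'q) \<Rightarrow> nat \<Rightarrow> nat \<Rightarrow> complex^'q^'q"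
  where "hankel_sandwich l c r j k = (\<Sum>a\<le>j. \<Sum>b\<le>k. l (j - a) ** c (a + b + 1) ** r (k - b))"

lemma hankel_sandwich_step:
  "hankel_sandwich l c r j (Suc k) - hankel_sandwich l c r (Suc j) k
   = (\<Sum>a\<le>Suc j. l (Suc j - a) ** c a) ** r (Suc k) - l (Suc j) ** (\<Sum>b\<le>Suc k. c b ** r (Suc k - b))"
proof -
  define e where "e a k = (\<Sum>b\<le>k. c (a + b + 1) ** r (k - b))" for a k
  have N: "hankel_sandwich l c r j k = (\<Sum>a\<le>j. l (j - a) ** e a k)" for j k
    by (simp add: hankel_sandwich_def e_def matrix_mult_sum_right matrix_mul_assoc)
  have e: "e a (Suc k) = c (Suc a) ** r (Suc k) + e (Suc a) k" for a
    unfolding e_def by (subst sum.atMost_Suc_shift) simp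
  have 1: "hankel_sandwich l c r (Suc j) k = l (Suc j) ** e 0 k + (\<Sum>a\<le>j. l (j - a) ** e (Suc a) k)"
    unfolding N by (subst sum.atMost_Suc_shift) simp
  have 2: "(\<Sum>a\<le>Suc j. l (Suc j - a) ** c a) = l (Suc j) ** c 0 + (\<Sum>a\<le>j. l (j - a) ** c (Suc a))"
    by (subst sum.atMost_Suc_shift) simp
  have 3: "(\<Sum>b\<le>Suc k. c b ** r (Suc k - b)) = c 0 ** r (Suc k) + e 0 k"
    unfolding e_def by (subst sum.atMost_Suc_shift) simp
  have 4: "hankel_sandwich l c r j (Suc k) =
    (\<Sum>a\<le>j. l (j - a) ** c (Suc a)) ** r (Suc k) + (\<Sum>a\<le>j. l (j - a) ** e (Suc a) k)"
    unfolding N e by (simp add: matrix_add_ldistrib sum.distrib matrix_mult_sum_left matrix_mul_assoc)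
  show ?thesis
    unfolding 1 2 3 4 by (simp add: matrix_ring_simps matrix_mul_assoc)
qed

text \<open>Multiplying coefficient sequences is multiplication by a triangular block Toeplitz
  matrix, so the sandwich is a congruence of the Hankel matrix of \<open>c\<close> as soon as the
  two outer sequences are adjoint to each other.\<close>

lemma block_nonneg_sandwich:
  assumes "block_nonneg n (\<lambda>j k. c (j + k + 1))" "\<And>j. l j = ctranspose (r j)"
  shows "block_nonneg n (hankel_sandwich l c r)"
proof -
  define C where "C j a = (if a \<le> j then r (j - a) else 0)" for j a :: nat
  have "hankel_sandwich l c r j k = (\<Sum>a\<le>n. \<Sum>b\<le>n. ctranspose (C j a) ** c (a + b + 1) ** C k b)"
    if "j \<le> n" "k \<le> n" for j k
  proof -
    have "(\<Sum>b\<le>n. ctranspose (C j a) ** c (a + b + 1) ** C k b) =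
          (\<Sum>b\<le>k. ctranspose (C j a) ** c (a + b + 1) ** r (k - b))" for a
      by (rule sum.mono_neutral_cong_right) (use that in \<open>simp_all add: C_def not_le\<close>)
    then have "(\<Sum>a\<le>n. \<Sum>b\<le>n. ctranspose (C j a) ** c (a + b + 1) ** C k b) =
       (\<Sum>a\<le>n. \<Sum>b\<le>k. ctranspose (C j a) ** c (a + b + 1) ** r (k - b))" by simp
    also have "\<dots> = (\<Sum>a\<le>j. \<Sum>b\<le>k. ctranspose (r (j - a)) ** c (a + b + 1) ** r (k - b))"
      by (rule sum.mono_neutral_cong_right) (use that in \<open>simp_all add: C_def ctranspose_linear not_le\<close>)
    finally show ?thesis by (simp add: hankel_sandwich_def assms(2))
  qed
  then have "block_nonneg n (hankel_sandwich l c r) \<longleftrightarrow>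
    block_nonneg n (\<lambda>j k. \<Sum>a\<le>n. \<Sum>b\<le>n. ctranspose (C j a) ** c (a + b + 1) ** C k b)"
    by (rule block_nonneg_cong)
  then show ?thesis by (rule iffD2) (rule block_nonneg_congruence[OF assms(1)])
qed

section \<open>The Schur transform of matrix sequences\<close>

abbreviation range_proj :: "complex^'n^'n \<Rightarrow> complex^'n^'n" where
  "range_proj A \<equiv> A ** moore_penrose A"

lemma range_proj:
  assumes "ctranspose A = (A :: complex^'n^'n)"
  shows "ctranspose (range_proj A) = range_proj A" "range_proj A ** range_proj A = range_proj A"
    "range_proj A ** A = A" "A ** range_proj A = A"
    "range_proj A ** moore_penrose A = moore_penrose A"
    "moore_penrose A ** range_proj A = moore_penrose A"
    "moore_penrose A ** A = range_proj A"
    "ctranspose (moore_penrose A) = moore_penrose A"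
  using hermitian_moore_penrose[OF assms] unfolding is_moore_penrose_def
  by (auto simp: matrix_mul_assoc) (metis matrix_mul_assoc)+

text \<open>Multiplying the recursion by \<open>u 0\<close> turns the Moore-Penrose inverse in front
  of the sum into the range projection. The range hypothesis is what makes this projection act as
  identity on the sum.\<close>

lemma recip_seq_right_inverse:
  fixes u :: "nat \<Rightarrow> complex^'q^'q"
  assumes "ctranspose (u 0) = u 0" "\<And>j. j \<le> k \<Longrightarrow> range_proj (u 0) ** u j = u j"
  shows "(\<Sum>b\<le>k. u b ** recip_seq u (k - b)) = (if k = 0 then range_proj (u 0) else 0)"
proof (cases k)
  case (Suc j)
  have "(\<Sum>b\<le>Suc j. u b ** recip_seq u (Suc j - b)) =
      u 0 ** recip_seq u (Suc j) + (\<Sum>b\<le>j. u (Suc b) ** recip_seq u (j - b))"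
    by (subst sum.atMost_Suc_shift) simp
  also have "(\<Sum>b\<le>j. u (Suc b) ** recip_seq u (j - b)) = (\<Sum>b\<le>j. u (Suc j - b) ** recip_seq u b)"
    by (rule sum.reindex_bij_witness[of _ "\<lambda>b. j - b" "\<lambda>b. j - b"]) (auto simp: Suc_diff_le)
  also have "u 0 ** recip_seq u (Suc j) = - (\<Sum>b\<le>j. u (Suc j - b) ** recip_seq u b)"
    using Suc by (simp add: matrix_mult_minus matrix_mul_assoc matrix_mult_sum_right assms(2))
  finally show ?thesis using Suc by simp
qed simp

lemma recip_seq_range:
  fixes u :: "nat \<Rightarrow> complex^'q^'q"
  assumes "ctranspose (u 0) = u 0"
  shows "range_proj (u 0) ** recip_seq u j = recip_seq u j"
  by (cases j) (simp_all add: matrix_mult_minus matrix_mul_assoc range_proj[OF assms])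

lemma shift_seq_0 [simp]: "shift_seq \<alpha> s 0 = s 0"
  by (simp add: shift_seq_def)

lemma shift_seq_Suc: "shift_seq \<alpha> s (Suc j) = s (Suc j) - \<alpha> *\<^sub>R s j"
  by (simp add: shift_seq_def)

lemma shift_seq_cong: "(\<And>i. i \<le> j \<Longrightarrow> s i = s' i) \<Longrightarrow> shift_seq \<alpha> s j = shift_seq \<alpha> s' j"
  by (simp add: shift_seq_def)

text \<open>Both sums are the coefficients of \<open>(1 - \<alpha> y) s(y) r(y)\<close>.\<close>

lemma shift_seq_convolution:
  fixes s r :: "nat \<Rightarrow> complex^'q^'q"
  shows "(\<Sum>b\<le>k. s b ** shift_seq \<alpha> r (k - b)) = (\<Sum>b\<le>k. shift_seq \<alpha> s b ** r (k - b))"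
proof (cases k)
  case (Suc j)
  have 1: "(\<Sum>b\<le>Suc j. s b ** shift_seq \<alpha> r (Suc j - b)) =
     (\<Sum>b\<le>Suc j. s b ** r (Suc j - b)) - \<alpha> *\<^sub>R (\<Sum>b\<le>j. s b ** r (j - b))"
  proof -
    have "(\<Sum>b\<le>j. s b ** shift_seq \<alpha> r (Suc j - b)) =
      (\<Sum>b\<le>j. s b ** r (Suc j - b) - \<alpha> *\<^sub>R (s b ** r (j - b)))"
      by (intro sum.cong refl)
         (simp add: Suc_diff_le shift_seq_Suc matrix_ring_simps)
    then show ?thesis by (simp add: sum_subtractf scaleR_sum_right)
  qed
  have 2: "(\<Sum>b\<le>Suc j. shift_seq \<alpha> s b ** r (Suc j - b)) =
     (\<Sum>b\<le>Suc j. s b ** r (Suc j - b)) - \<alpha> *\<^sub>R (\<Sum>b\<le>j. s b ** r (j - b))"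
    by (subst (1 2) sum.atMost_Suc_shift)
       (simp add: shift_seq_Suc matrix_ring_simps sum_subtractf scaleR_sum_right)
  show ?thesis unfolding Suc 1 2 ..
qed simp

text \<open>The conditions are imposed for all indices. For a finite sequence they are arranged by
  compressing to the range of \<open>s 0\<close> and continuing by zero.\<close>

locale projected_seq =
  fixes \<alpha> :: real and s :: "nat \<Rightarrow> complex^'q^'q"
  assumes herm: "\<And>j. ctranspose (s j) = s j"
    and proj: "\<And>j. range_proj (s 0) ** s j = s j"
begin

abbreviation "A \<equiv> s 0"
abbreviation "P \<equiv> range_proj A"
abbreviation "u \<equiv> shift_seq \<alpha> s"
abbreviation "t \<equiv> S_transform \<alpha> s"
text \<open>The right factor of the congruence. Taking the left factor \<open>l\<close> as its
  adjoint makes the product a congruence by construction, so that the symmetry of the reciprocal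
  sequence never has to be shown.\<close>

definition "r j = recip_seq u j ** A"
definition "l j = ctranspose (r j)"

lemma herm_u: "ctranspose (u j) = u j"
  by (cases j) (simp_all add: shift_seq_Suc ctranspose_linear herm)

lemma proj_u: "range_proj (u 0) ** u j = u j"
  by (cases j) (simp_all add: shift_seq_Suc matrix_ring_simps proj)

lemma u_r: "(\<Sum>b\<le>k. u b ** r (k - b)) = (if k = 0 then A else 0)"
proof -
  have "(\<Sum>b\<le>k. u b ** r (k - b)) = (\<Sum>b\<le>k. u b ** recip_seq u (k - b)) ** A"
    by (simp add: r_def matrix_mult_sum_left matrix_mul_assoc)
  then show ?thesis
    using recip_seq_right_inverse[of u k, OF herm_u proj_u] by (simp add: range_proj[OF herm])
qed

lemma l_u: "(\<Sum>a\<le>k. l (k - a) ** u a) = (if k = 0 then A else 0)"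
proof -
  have "(\<Sum>a\<le>k. l (k - a) ** u a) = ctranspose (\<Sum>b\<le>k. u b ** r (k - b))"
    by (simp add: l_def ctranspose_sum ctranspose_mult herm_u)
  then show ?thesis unfolding u_r by (simp add: herm ctranspose_linear)
qed

lemma r_0: "r 0 = P" by (simp add: r_def range_proj[OF herm])
lemma l_0: "l 0 = P" by (simp add: l_def r_0 range_proj[OF herm])

lemma t_eq: "t j = - (A ** r (Suc j))"
  by (simp add: S_transform_def r_def matrix_mul_assoc)

text \<open>By \<open>l_u\<close> and \<open>u_r\<close> both convolutions vanish at positive
  indices, so \<open>hankel_sandwich_step\<close> makes the blocks constant along antidiagonals. Row
  0 is read off from \<open>u_r\<close>.\<close>

lemma sandwich_u: "hankel_sandwich l u r j k = t (j + k)"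
proof (induction j arbitrary: k)
  case 0
  have "hankel_sandwich l u r 0 k = P ** (\<Sum>b\<le>k. u (Suc b) ** r (k - b))"
    by (simp add: hankel_sandwich_def l_0 matrix_mult_sum_right matrix_mul_assoc)
  also have "(\<Sum>b\<le>k. u (Suc b) ** r (k - b)) = - (A ** r (Suc k))"
    using u_r[of "Suc k"] by (subst (asm) sum.atMost_Suc_shift) (simp add: add_eq_0_iff)
  finally show ?case by (simp add: matrix_mult_minus matrix_mul_assoc range_proj[OF herm] t_eq)
next
  case (Suc j)
  have "hankel_sandwich l u r (Suc j) k = hankel_sandwich l u r j (Suc k)"
    using hankel_sandwich_step[of l u r j k] unfolding l_u u_r by simp
  then show ?case using Suc by simp
qed

lemma H_nonneg_transform: "HK_nonneg \<alpha> n s \<Longrightarrow> H_nonneg n t"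
  unfolding HK_nonneg_iff H_nonneg_iff sandwich_u[symmetric]
  by (rule block_nonneg_sandwich) (simp_all add: l_def)

text \<open>As u(x) = (1 - \<alpha> x) s(x), multiplying the series of \<open>r\<close>, which
  inverts u up to A, by 1 - \<alpha> x gives the series that inverts s up to A.\<close>

definition "r' = shift_seq \<alpha> r"
definition "l' j = ctranspose (r' j)"
text \<open>\<open>c\<close> is the coefficient sequence of \<open>x s(x)\<close>, so that the Hankel matrix of \<open>s\<close> has entries
  \<open>c (a + b + 1)\<close> as in \<open>hankel_sandwich\<close>.\<close>

definition "c i = (case i of 0 \<Rightarrow> 0 | Suc j \<Rightarrow> s j)"

lemma s_r': "(\<Sum>b\<le>k. s b ** r' (k - b)) = (if k = 0 then A else 0)"
  unfolding r'_def shift_seq_convolution by (rule u_r)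

lemma l'_s: "(\<Sum>a\<le>k. l' (k - a) ** s a) = (if k = 0 then A else 0)"
proof -
  have "(\<Sum>a\<le>k. l' (k - a) ** s a) = ctranspose (\<Sum>b\<le>k. s b ** r' (k - b))"
    by (simp add: l'_def ctranspose_sum ctranspose_mult herm)
  then show ?thesis unfolding s_r' by (simp add: herm ctranspose_linear)
qed

lemma c_r': "(\<Sum>b\<le>Suc k. c b ** r' (Suc k - b)) = (if k = 0 then A else 0)"
  by (subst sum.atMost_Suc_shift) (simp add: c_def s_r')

lemma l'_c: "(\<Sum>a\<le>Suc k. l' (Suc k - a) ** c a) = (if k = 0 then A else 0)"
  by (subst sum.atMost_Suc_shift) (simp add: c_def l'_s)

lemma r'_0: "r' 0 = P" by (simp add: r'_def r_0)
lemma l'_0: "l' 0 = P" by (simp add: l'_def r'_0 range_proj[OF herm])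

lemma A_r': "A ** r' (Suc k) = - (if k = 0 then t 0 + \<alpha> *\<^sub>R A else shift_seq \<alpha> t k)"
  by (cases k) (simp_all add: r'_def shift_seq_Suc matrix_ring_simps r_0 range_proj[OF herm] t_eq)

lemma sandwich_c_0: "hankel_sandwich l' c r' 0 k = (if k = 0 then A else 0)"
proof -
  have "hankel_sandwich l' c r' 0 k = P ** (\<Sum>b\<le>k. s b ** r' (k - b))"
    by (simp add: hankel_sandwich_def l'_0 c_def matrix_mult_sum_right matrix_mul_assoc)
  then show ?thesis by (simp add: s_r' range_proj[OF herm])
qed

text \<open>The factor x in the series of \<open>c\<close> moves the constant A of the convolutions
  to index 1. Hence row 0 is A, 0, 0, ..., a single step of the recursion produces row 1 from
  \<open>A ** r'\<close>, and from there on the blocks are constant along antidiagonals.\<close>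

lemma sandwich_c: "hankel_sandwich l' c r' (Suc j) (Suc k) = shift_seq \<alpha> t (j + k + 1)"
proof (induction j arbitrary: k)
  case 0
  have "hankel_sandwich l' c r' 0 (Suc (Suc k)) - hankel_sandwich l' c r' 1 (Suc k) = A ** r' (Suc (Suc k))"
    using hankel_sandwich_step[of l' c r' 0 "Suc k"] unfolding c_r' l'_c by simp
  then show ?case by (simp add: sandwich_c_0 A_r')
next
  case (Suc j)
  have "hankel_sandwich l' c r' (Suc j) (Suc (Suc k)) - hankel_sandwich l' c r' (Suc (Suc j)) (Suc k) = 0"
    using hankel_sandwich_step[of l' c r' "Suc j" "Suc k"] unfolding c_r' l'_c by simp
  then show ?case using Suc[of "Suc k"] by simp
qed

lemma HK_nonneg_transform:
  assumes "H_nonneg (Suc n) s" shows "HK_nonneg \<alpha> n t"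
proof -
  have "block_nonneg (Suc n) (hankel_sandwich l' c r')"
    by (rule block_nonneg_sandwich) (use assms in \<open>simp_all add: H_nonneg_iff c_def l'_def\<close>)
  \<comment> \<open>Dropping row and column 0 discards the summand A.\<close>
  then have "block_nonneg n (\<lambda>j k. hankel_sandwich l' c r' (Suc j) (Suc k))"
    by (rule block_nonneg_restrict) auto
  then show ?thesis unfolding HK_nonneg_iff sandwich_c .
qed

lemma K_ge_transform:
  assumes "s \<in> K_ge \<alpha> (Suc m)" shows "t \<in> K_ge \<alpha> m"
  unfolding K_ge_iff
proof (intro conjI impI)
  show "H_nonneg (m div 2) t" using assms by (intro H_nonneg_transform) (simp add: K_ge_iff)
next
  assume "1 \<le> m"
  then have "Suc ((m - 1) div 2) = Suc m div 2" by (cases m) auto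
  then show "HK_nonneg \<alpha> ((m - 1) div 2) t"
    using assms by (intro HK_nonneg_transform) (simp add: K_ge_iff)
qed

end

section \<open>Reduction of general sequences to projected ones\<close>

lemma K_ge_cong:
  assumes "\<And>j. j \<le> m \<Longrightarrow> s j = s' j" shows "s \<in> K_ge \<alpha> m \<longleftrightarrow> s' \<in> K_ge \<alpha> m"
proof -
  have "H_nonneg (m div 2) s \<longleftrightarrow> H_nonneg (m div 2) s'"
    unfolding H_nonneg_iff by (rule block_nonneg_cong) (rule assms, linarith)
  moreover have "HK_nonneg \<alpha> ((m - 1) div 2) s \<longleftrightarrow> HK_nonneg \<alpha> ((m - 1) div 2) s'" if "1 \<le> m"
    unfolding HK_nonneg_iff
    by (rule block_nonneg_cong, rule shift_seq_cong, rule assms) (use that in linarith)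
  ultimately show ?thesis by (auto simp: K_ge_iff)
qed

text \<open>Even coefficients are diagonal blocks of H. Odd ones are diagonal blocks of -\<alpha>H +
  K corrected by a multiple of the preceding even coefficient.\<close>

lemma K_ge_hermitian:
  assumes "s \<in> K_ge \<alpha> m" "j \<le> m" shows "ctranspose (s j) = s j"
  using assms(2)
proof (induction j rule: less_induct)
  case (less j)
  have H: "block_nonneg (m div 2) (\<lambda>j k. s (j + k))" using assms by (simp add: K_ge_iff H_nonneg_iff)
  show ?case
  proof (cases "even j")
    case True
    then have "j div 2 \<le> m div 2" "j div 2 + j div 2 = j" using less by auto
    then show ?thesis using H unfolding block_nonneg_def by metis
  next
    case False
    then obtain i where i: "j = 2 * i + 1" by (auto elim: oddE)
    then have "1 \<le> m" using less by simp
    then have "block_nonneg ((m - 1) div 2) (\<lambda>j k. shift_seq \<alpha> s (j + k + 1))"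
      using assms by (simp add: K_ge_iff HK_nonneg_iff)
    moreover have "i \<le> (m - 1) div 2" using i less by simp
    ultimately have "ctranspose (shift_seq \<alpha> s (i + i + 1)) = shift_seq \<alpha> s (i + i + 1)"
      unfolding block_nonneg_def by blast
    moreover have "ctranspose (s (i + i)) = s (i + i)" using less i by simp
    ultimately show ?thesis by (simp add: shift_seq_Suc ctranspose_linear i mult_2)
  qed
qed

lemma block_nonneg_compress:
  fixes R :: "complex^'q^'q"
  assumes "block_nonneg n M"
  shows "block_nonneg n (\<lambda>j k. ctranspose R ** M j k ** R)"
proof -
  define C where "C j a = (if a = j then R else 0)" for j a :: nat
  have "(\<Sum>a\<le>n. \<Sum>b\<le>n. ctranspose (C j a) ** M a b ** C k b) = ctranspose R ** M j k ** R"
    if "j \<le> n" "k \<le> n" for j k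
    using that by (simp add: C_def if_distrib[of ctranspose] if_distrib[of "\<lambda>x. _ ** x"]
        if_distrib[of "\<lambda>x. x ** _"] ctranspose_linear cong: if_cong)
  then show ?thesis
    using block_nonneg_congruence[OF assms, of n C] block_nonneg_cong by (metis (no_types, lifting))
qed

lemma K_ge_compress:
  fixes R :: "complex^'q^'q"
  assumes "s \<in> K_ge \<alpha> m"
  shows "(\<lambda>j. ctranspose R ** s j ** R) \<in> K_ge \<alpha> m"
proof -
  have "shift_seq \<alpha> (\<lambda>j. ctranspose R ** s j ** R) j = ctranspose R ** shift_seq \<alpha> s j ** R" for j
    by (cases j) (simp_all add: shift_seq_Suc matrix_ring_simps)
  then show ?thesis
    using assms block_nonneg_compress
    by (auto simp: K_ge_iff H_nonneg_iff HK_nonneg_iff)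
qed

text \<open>The recursion meets the shifted coefficients only between the Moore-Penrose inverse of
  \<open>s 0\<close> and earlier reciprocals, whose range lies in that of \<open>s 0\<close>. Both
  absorb the projection.\<close>

lemma S_transform_compress:
  assumes "ctranspose (s 0) = s 0" "\<And>i. i \<le> Suc j \<Longrightarrow> s' i = range_proj (s 0) ** s i ** range_proj (s 0)"
  shows "S_transform \<alpha> s' j = S_transform \<alpha> s j"
proof -
  let ?P = "range_proj (s 0)"
  note rp = range_proj[OF assms(1)]
  have u: "shift_seq \<alpha> s' i = ?P ** shift_seq \<alpha> s i ** ?P" if "i \<le> Suc j" for i
    using that assms(2) by (cases i) (simp_all add: shift_seq_Suc matrix_ring_simps)
  have s0: "s' 0 = s 0" by (simp add: assms(2) rp)
  have "recip_seq (shift_seq \<alpha> s') i = recip_seq (shift_seq \<alpha> s) i" if "i \<le> Suc j" for i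
    using that
  proof (induction i rule: less_induct)
    case (less i)
    show ?case
    proof (cases i)
      case 0
      then show ?thesis by (simp add: s0)
    next
      case (Suc k)
      have "moore_penrose (s 0) ** shift_seq \<alpha> s' (Suc k - l) ** recip_seq (shift_seq \<alpha> s') l
          = moore_penrose (s 0) ** shift_seq \<alpha> s (Suc k - l) ** recip_seq (shift_seq \<alpha> s) l"
        if "l \<le> k" for l
      proof -
        have "?P ** recip_seq (shift_seq \<alpha> s) l = recip_seq (shift_seq \<alpha> s) l"
          using recip_seq_range[of "shift_seq \<alpha> s"] assms(1) by simp
        moreover have "moore_penrose (s 0) ** ?P = moore_penrose (s 0)" by (rule rp)
        ultimately show ?thesis
          using less that Suc by (simp add: u) (metis matrix_mul_assoc)
      qed
      then show ?thesis using Suc by (simp add: s0 matrix_mult_sum_right matrix_mul_assoc)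
    qed
  qed
  then show ?thesis by (simp add: S_transform_def s0 del: recip_seq.simps)
qed

lemma S_transform_cong:
  assumes "\<And>i. i \<le> Suc j \<Longrightarrow> s' i = s i" shows "S_transform \<alpha> s' j = S_transform \<alpha> s j"
proof -
  have u: "shift_seq \<alpha> s' i = shift_seq \<alpha> s i" if "i \<le> Suc j" for i
    using that assms by (intro shift_seq_cong) auto
  have "recip_seq (shift_seq \<alpha> s') i = recip_seq (shift_seq \<alpha> s) i" if "i \<le> Suc j" for i
    using that
  proof (induction i rule: less_induct)
    case (less i)
    show ?case
    proof (cases i)
      case 0
      then show ?thesis using assms[of 0] by simp
    next
      case (Suc k)
      then show ?thesis using less u by (simp add: assms)
    qed
  qed
  then show ?thesis by (simp add: S_transform_def assms del: recip_seq.simps)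
qed

theorem S_transform_K_ge:
  assumes "s \<in> K_ge \<alpha> (Suc m)" shows "S_transform \<alpha> s \<in> K_ge \<alpha> m"
proof -
  define P where "P = range_proj (s 0)"
  have h: "ctranspose (s j) = s j" if "j \<le> Suc m" for j
    using K_ge_hermitian assms that by blast
  note rp = range_proj[OF h[of 0, simplified], folded P_def]
  \<comment> \<open>Continuation by zero makes the locale conditions hold at every index; the
    coefficients that matter stop at \<open>Suc m\<close>.\<close>
  define s' where "s' j = (if j \<le> Suc m then P ** s j ** P else 0)" for j
  have s'0: "s' 0 = s 0" by (simp add: s'_def rp)
  have "s' \<in> K_ge \<alpha> (Suc m)"
    using K_ge_compress[OF assms, of P] K_ge_cong[of "Suc m" s' "\<lambda>j. P ** s j ** P"]
    by (simp add: rp s'_def)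
  interpret projected_seq \<alpha> s'
  proof
    show "ctranspose (s' j) = s' j" for j
      by (simp add: s'_def ctranspose_mult rp h ctranspose_linear matrix_mul_assoc)
    show "range_proj (s' 0) ** s' j = s' j" for j
      unfolding s'0 P_def[symmetric] by (simp add: s'_def matrix_mul_assoc rp)
  qed
  have "S_transform \<alpha> s' \<in> K_ge \<alpha> m" using K_ge_transform \<open>s' \<in> _\<close> by blast
  moreover have "S_transform \<alpha> s' j = S_transform \<alpha> s j" if "j \<le> m" for j
    by (rule S_transform_compress) (use that h in \<open>auto simp: s'_def P_def\<close>)
  ultimately show ?thesis using K_ge_cong by blast
qed

text \<open>The transform of an extension extends the transform: coefficient \<open>Suc m\<close> of
  the former is the only one that sees the new matrix.\<close>

corollary S_transform_K_ge_ext: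
  assumes "s \<in> K_ge_ext \<alpha> (Suc m)" shows "S_transform \<alpha> s \<in> K_ge_ext \<alpha> m"
proof -
  obtain x where x: "s(Suc (Suc m) := x) \<in> K_ge \<alpha> (Suc (Suc m))"
    using assms by (auto simp: K_ge_ext_def)
  let ?s = "s(Suc (Suc m) := x)"
  have "S_transform \<alpha> ?s \<in> K_ge \<alpha> (Suc m)" using x by (rule S_transform_K_ge)
  moreover have "S_transform \<alpha> ?s j = S_transform \<alpha> s j" if "j \<le> m" for j
    by (rule S_transform_cong) (use that in auto)
  ultimately have "(S_transform \<alpha> s)(Suc m := S_transform \<alpha> ?s (Suc m)) \<in> K_ge \<alpha> (Suc m)"
    by (subst K_ge_cong[of _ _ "S_transform \<alpha> ?s"]) (auto simp: le_Suc_eq)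
  then show ?thesis unfolding K_ge_ext_def by blast
qed

lemma K_ge_ext_subset: "K_ge_ext \<alpha> m \<subseteq> K_ge \<alpha> m"
proof
  fix s :: "nat \<Rightarrow> complex^'a^'a" assume "s \<in> K_ge_ext \<alpha> m"
  then obtain x where x: "s(Suc m := x) \<in> K_ge \<alpha> (Suc m)" by (auto simp: K_ge_ext_def)
  have "block_nonneg (m div 2) (\<lambda>j k. (s(Suc m := x)) (j + k))"
    by (rule block_nonneg_restrict[of "Suc m div 2" _ id "m div 2", unfolded id_apply])
       (use x in \<open>auto simp: K_ge_iff H_nonneg_iff\<close>)
  moreover have "block_nonneg ((m - 1) div 2) (\<lambda>j k. shift_seq \<alpha> (s(Suc m := x)) (j + k + 1))"
    by (rule block_nonneg_restrict[of "m div 2" _ id "(m - 1) div 2", unfolded id_apply])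
       (use x in \<open>auto simp: K_ge_iff HK_nonneg_iff\<close>)
  ultimately have "s(Suc m := x) \<in> K_ge \<alpha> m"
    by (simp add: K_ge_iff H_nonneg_iff HK_nonneg_iff)
  then show "s \<in> K_ge \<alpha> m" by (subst K_ge_cong[of _ _ "s(Suc m := x)"]) auto
qed

section \<open>Null vectors and ranges of extendable sequences\<close>

lemma block_nonneg_null:
  fixes M :: "nat \<Rightarrow> nat \<Rightarrow> complex^'q^'q"
  assumes M: "block_nonneg n M" and ik: "i \<le> n" "k \<le> n" and 0: "M i i *v v = 0"
  shows "M k i *v v = 0"
proof (cases "k = i")
  case False
  define w where "w = M k i *v v"
  define c where "c = Re (cdot w w)"
  define d where "d = Re (qform (M k k) w)"
  have c: "cdot w w = complex_of_real c" by (simp add: c_def cdot_self)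
  have M': "M i k = ctranspose (M k i)" using M ik by (simp add: block_nonneg_def)
  have ineq: "0 \<le> - 2 * e * c + e\<^sup>2 * d" for e :: real
  proof -
    \<comment> \<open>The vector is v in block i and a small multiple of -w in block k. Since
      \<open>M i i\<close> kills v, no constant term is left, and the linear term in e is -2 times
      the squared length of w.\<close>
    define x where "x j = (if j = i then v else if j = k then - (complex_of_real e *s w) else 0)" for j
    have "(\<Sum>j\<le>n. \<Sum>l\<le>n. cdot (x j) (M j l *v x l)) = (\<Sum>j\<in>{i,k}. \<Sum>l\<in>{i,k}. cdot (x j) (M j l *v x l))"
    proof (rule sum.mono_neutral_cong_right)
      show "(\<Sum>l\<le>n. cdot (x j) (M j l *v x l)) = (\<Sum>l\<in>{i,k}. cdot (x j) (M j l *v x l))" for j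
        by (rule sum.mono_neutral_right) (use ik in \<open>auto simp: x_def cdot_simps\<close>)
    qed (use ik in \<open>auto simp: x_def cdot_simps\<close>)
    also have "\<dots> = cdot v (M i i *v v) - cdot v (M i k *v (complex_of_real e *s w))
       - cdot (complex_of_real e *s w) (M k i *v v) + cdot (complex_of_real e *s w) (M k k *v (complex_of_real e *s w))"
      using False by (simp add: x_def cdot_simps matrix_smult_right scaleR_mult_vector
          algebra_simps del: vector_smult_lneg)
         (simp add: matrix_vector_mult_diff_distrib[of _ 0, simplified] cdot_simps matrix_smult_right)
    also have "\<dots> = - 2 * complex_of_real e * complex_of_real c + (complex_of_real e)\<^sup>2 * qform (M k k) w"
    proof -
      have "cdot v (M i k *v w) = complex_of_real c"
        unfolding M' cdot_mult_left[symmetric] by (simp add: w_def[symmetric] c)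
      then show ?thesis
        by (simp add: 0 cdot_simps matrix_smult_right w_def[symmetric] c qform_def power2_eq_square)
    qed
    finally have "Re (\<Sum>j\<le>n. \<Sum>l\<le>n. cdot (x j) (M j l *v x l)) = - 2 * e * c + e\<^sup>2 * d"
      by (simp add: d_def power2_eq_square)
    moreover have "0 \<le> Re (\<Sum>j\<le>n. \<Sum>l\<le>n. cdot (x j) (M j l *v x l))"
      using block_nonnegD[OF M] .
    ultimately show ?thesis by simp
  qed
  have "c \<ge> 0" by (simp add: c_def cdot_self sum_nonneg)
  have "c = 0" using quadratic_nonneg_linear_zero[OF ineq \<open>c \<ge> 0\<close>] .
  then show ?thesis using c by (simp add: cdot_self_eq_0 w_def)
qed (use 0 in simp)

text \<open>Below n the coefficient \<open>c j\<close> sits in column 0. From n on it sits in row n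
  and column j - n, whose diagonal block has index 2(j - n) < j and is covered by induction. The
  coefficient of index 2n occurs only as the last diagonal block, hence the strict bound.\<close>

lemma hankel_null:
  fixes c :: "nat \<Rightarrow> complex^'q^'q"
  assumes H: "block_nonneg n (\<lambda>j k. c (j + k))" and 0: "c 0 *v v = 0" and "j < 2 * n"
  shows "c j *v v = 0"
  using \<open>j < 2 * n\<close>
proof (induction j rule: less_induct)
  case (less j)
  show ?case
  proof (cases "j < n")
    case True
    then show ?thesis using block_nonneg_null[OF H, of 0 j v] 0 by simp
  next
    case False
    have "c (j - n + (j - n)) *v v = 0" using less False by (intro less) auto
    then show ?thesis using block_nonneg_null[OF H, of "j - n" n v] less False by simp
  qed
qed

text \<open>Extendability enters here: the additional coefficient enlarges one of the two Hankel
  matrices, so that \<open>s m\<close> is no longer confined to a last diagonal block.\<close>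

lemma K_ge_ext_null:
  fixes s :: "nat \<Rightarrow> complex^'q^'q"
  assumes "s \<in> K_ge_ext \<alpha> m" "s 0 *v v = 0" "j \<le> m"
  shows "s j *v v = 0"
proof -
  obtain x where x: "s(Suc m := x) \<in> K_ge \<alpha> (Suc m)" using assms by (auto simp: K_ge_ext_def)
  define c where "c = s(Suc m := x)"
  have c0: "c 0 *v v = 0" using assms by (simp add: c_def)
  have H: "block_nonneg (Suc m div 2) (\<lambda>j k. c (j + k))"
   and K: "block_nonneg (m div 2) (\<lambda>j k. shift_seq \<alpha> c (j + k + 1))"
    using x by (auto simp: c_def K_ge_iff H_nonneg_iff HK_nonneg_iff)
  note Hn = hankel_null[OF H c0]
  have "c j *v v = 0"
  proof (cases "j < 2 * (Suc m div 2)")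
    case False
    \<comment> \<open>For even m the matrix H still ends at index m, so the last coefficient is
      reached through the enlarged matrix -\<alpha>H + K: the shifted coefficient \<open>s m\<close>
      - \<alpha> \<open>s (m - 1)\<close> kills v, and so does \<open>s (m - 1)\<close>.\<close>
    with \<open>j \<le> m\<close> have jm: "j = m" "even m" by presburger+
    show ?thesis
    proof (cases "m = 0")
      case m: False
      then obtain i where i: "m = Suc (Suc i)" using jm by (metis even_Suc not0_implies_Suc even_zero)
      have u: "shift_seq \<alpha> c 1 *v v = 0"
        using Hn[of 0] Hn[of 1] i
        by (simp add: shift_seq_Suc[of _ _ 0, simplified] matrix_vector_mult_diff_rdistrib scaleR_mult_vector)
      have "shift_seq \<alpha> c (i + 1 + 1) *v v = 0"
        using hankel_null[of "m div 2" "\<lambda>j. shift_seq \<alpha> c (j + 1)" v "i + 1"] K u i jm by (auto elim!: evenE)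
      then show ?thesis
        using Hn[of "Suc i"] i jm by (simp add: shift_seq_Suc matrix_vector_mult_diff_rdistrib scaleR_mult_vector)
    qed (use jm c0 in simp)
  qed (rule Hn)
  then show ?thesis using \<open>j \<le> m\<close> by (simp add: c_def)
qed

lemma K_ge_ext_range:
  assumes "s \<in> K_ge_ext \<alpha> m" "j \<le> m"
  shows "s j ** range_proj (s 0) = s j" "range_proj (s 0) ** s j = s j"
proof -
  have h: "ctranspose (s i) = s i" if "i \<le> m" for i
    using K_ge_hermitian K_ge_ext_subset assms(1) that by blast
  note rp = range_proj[OF h[of 0, simplified]]
  have "s j *v (w - range_proj (s 0) *v w) = 0" for w
    by (rule K_ge_ext_null[OF assms(1) _ assms(2)])
       (simp add: matrix_vector_mult_diff_distrib matrix_vector_mul_assoc rp)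
  then show 1: "s j ** range_proj (s 0) = s j"
    by (simp add: matrix_eq_iff_vector matrix_vector_mult_diff_distrib matrix_vector_mul_assoc)
  show "range_proj (s 0) ** s j = s j"
    using arg_cong[OF 1, of ctranspose] by (simp add: ctranspose_mult h assms rp)
qed

section \<open>Matrix measures and their scalar measures\<close>

lemma measure_of_real_properties:
  fixes g :: "'a set \<Rightarrow> real"
  assumes nonneg: "\<And>B. B \<in> sets M \<Longrightarrow> 0 \<le> g B"
    and sums: "\<And>A. range A \<subseteq> sets M \<Longrightarrow> disjoint_family A \<Longrightarrow> (\<lambda>n::nat. g (A n)) sums g (\<Union>n. A n)"
  defines "N \<equiv> measure_of (space M) (sets M) (\<lambda>B. ennreal (g B))"
  shows "sets N = sets M" "space N = space M" "finite_measure N"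
    "B \<in> sets M \<Longrightarrow> emeasure N B = ennreal (g B)" "B \<in> sets M \<Longrightarrow> measure N B = g B"
proof -
  show s: "sets N = sets M" "space N = space M"
    unfolding N_def by (simp_all add: sets.space_closed sets.sigma_sets_eq)
  have "(\<lambda>n::nat. g {}) sums g {}" using sums[of "\<lambda>_. {}"] by (simp add: disjoint_family_on_def)
  then have g0: "g {} = 0" using summable_const_iff sums_summable by blast
  have ca: "countably_additive (sets M) (\<lambda>B. ennreal (g B))"
  proof (rule countably_additiveI)
    fix A :: "nat \<Rightarrow> 'a set" assume A: "range A \<subseteq> sets M" "disjoint_family A" "\<Union> (range A) \<in> sets M"
    then have "(\<lambda>n. ennreal (g (A n))) sums ennreal (g (\<Union>n. A n))"
      using sums[of A] nonneg by (subst sums_ennreal) auto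
    then show "(\<Sum>i. ennreal (g (A i))) = ennreal (g (\<Union> (range A)))"
      by (simp add: sums_iff)
  qed
  show em: "emeasure N B = ennreal (g B)" if "B \<in> sets M" for B
    unfolding N_def
    by (rule emeasure_measure_of_sigma) (use ca that g0 in \<open>simp_all add: positive_def sets.sigma_algebra_axioms\<close>)
  show "finite_measure N" by (rule finite_measureI) (simp add: em s)
  show "measure N B = g B" if "B \<in> sets M" for B
    using em[OF that] nonneg[OF that] by (simp add: measure_def)
qed

lemma bounded_linear_qform: "bounded_linear (\<lambda>H. qform H v)"
proof -
  have "linear (\<lambda>H. qform H v)"
    by (rule linearI, simp add: qform_add)
       (simp add: qform_def scaleR_mult_vector cdot_simps scaleR_conv_of_real[where 'a=complex])
  then show ?thesis by (simp add: linear_conv_bounded_linear)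
qed

lemma trace_qform: "trace H = (\<Sum>i\<in>UNIV. qform H (axis i 1))"
  by (simp add: trace_def qform_def cdot_axis)

lemma bounded_linear_trace: "bounded_linear (\<lambda>H :: complex^'n^'n. trace H)"
  unfolding trace_qform by (intro bounded_linear_sum bounded_linear_qform)

lemma nonneg_herm_trace:
  assumes "nonneg_herm H"
  shows "0 \<le> Re (trace H)" "Re (trace H) = 0 \<Longrightarrow> H = 0"
proof -
  have nn: "0 \<le> Re (qform H v)" for v using assms by (simp add: nonneg_herm_iff)
  then show "0 \<le> Re (trace H)" by (simp add: trace_qform sum_nonneg)
  assume "Re (trace H) = 0"
  then have "Re (qform H (axis i 1)) = 0" for i
    using nn by (simp add: trace_qform sum_nonneg_eq_0_iff)
  then have "H *v axis i 1 = 0" for i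
    using nonneg_herm_null[OF assms] nonneg_hermD(3)[OF assms] by (metis of_real_0)
  then show "H = 0" by (metis matrix_axis vec_eq_iff zero_index)
qed

section \<open>Quadratic forms of a matrix measure as scalar measures\<close>

definition scalar_measure :: "'a measure \<Rightarrow> ('a set \<Rightarrow> complex^'q^'q) \<Rightarrow> complex^'q \<Rightarrow> 'a measure" where
  "scalar_measure M \<sigma> v = measure_of (space M) (sets M) (\<lambda>B. ennreal (Re (qform (\<sigma> B) v)))"

definition polarisation_vectors :: "(complex^'q) set" where
  "polarisation_vectors = (\<Union>i. \<Union>j. {axis i 1 + axis j 1, axis i 1 - axis j 1,
     axis i 1 + \<i> *s axis j 1, axis i 1 - \<i> *s axis j 1})"

lemma finite_polarisation_vectors: "finite polarisation_vectors"
  by (simp add: polarisation_vectors_def)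

lemma polarisation_vectorsI [simp]:
  "axis i 1 + axis j 1 \<in> polarisation_vectors" "axis i 1 - axis j 1 \<in> polarisation_vectors"
  "axis i 1 + \<i> *s axis j 1 \<in> polarisation_vectors" "axis i 1 - \<i> *s axis j 1 \<in> polarisation_vectors"
  by (auto simp: polarisation_vectors_def)

text \<open>The argument is an arbitrary family of values, not necessarily a quadratic form. That
  the form of \<open>polar Q\<close> returns \<open>Q\<close> is a separate fact, which has to be
  proved for families obtained as limits.\<close>

definition polar :: "(complex^'q \<Rightarrow> complex) \<Rightarrow> complex^'q^'q" where
  "polar Q = (\<chi> i j. (Q (axis i 1 + axis j 1) - Q (axis i 1 - axis j 1)
     - \<i> * Q (axis i 1 + \<i> *s axis j 1) + \<i> * Q (axis i 1 - \<i> *s axis j 1)) / 4)"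

lemma polar_qform: "polar (qform H) = H"
  by (simp add: polar_def vec_eq_iff polarisation_entry[symmetric])

lemma integral_polar:
  fixes f :: "complex^'q \<Rightarrow> 'b \<Rightarrow> complex"
  assumes "\<And>v. v \<in> polarisation_vectors \<Longrightarrow> integrable N (f v)"
  shows "integrable N (\<lambda>t. polar (\<lambda>v. f v t) $ i $ j)"
    "(LINT t|N. polar (\<lambda>v. f v t) $ i $ j) = polar (\<lambda>v. LINT t|N. f v t) $ i $ j"
  using assms unfolding polar_def by (auto intro!: Bochner_Integration.integrable_add
      Bochner_Integration.integrable_diff)

locale matrix_measure =
  fixes M :: "'a measure" and \<sigma> :: "'a set \<Rightarrow> complex^'q^'q"
  assumes nonneg_measure: "nonneg_herm_measure M \<sigma>"
begin

abbreviation "\<tau> \<equiv> trace_measure M \<sigma>"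
abbreviation "\<mu> \<equiv> scalar_measure M \<sigma>"

lemma nonneg: "B \<in> sets M \<Longrightarrow> nonneg_herm (\<sigma> B)"
  using nonneg_measure by (simp add: nonneg_herm_measure_def)

lemma sums: "range A \<subseteq> sets M \<Longrightarrow> disjoint_family A \<Longrightarrow> (\<lambda>n::nat. \<sigma> (A n)) sums \<sigma> (\<Union>n. A n)"
  using nonneg_measure by (simp add: nonneg_herm_measure_def)

lemma scalar_measure:
  shows "sets (\<mu> v) = sets M" "space (\<mu> v) = space M" "finite_measure (\<mu> v)"
    "B \<in> sets M \<Longrightarrow> emeasure (\<mu> v) B = ennreal (Re (qform (\<sigma> B) v))"
    "B \<in> sets M \<Longrightarrow> measure (\<mu> v) B = Re (qform (\<sigma> B) v)"
proof -
  have a: "0 \<le> Re (qform (\<sigma> B) v)" if "B \<in> sets M" for B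
    using nonneg[OF that] by (simp add: nonneg_herm_iff)
  have b: "(\<lambda>n. Re (qform (\<sigma> (A n)) v)) sums Re (qform (\<sigma> (\<Union>n. A n)) v)"
    if "range A \<subseteq> sets M" "disjoint_family A" for A :: "nat \<Rightarrow> 'a set"
    using bounded_linear.sums[OF bounded_linear_compose[OF bounded_linear_Re bounded_linear_qform[of v]] sums[OF that]]
    by simp
  note * = measure_of_real_properties[of M "\<lambda>B. Re (qform (\<sigma> B) v)", OF a b, folded scalar_measure_def]
  show "sets (\<mu> v) = sets M" "space (\<mu> v) = space M" "finite_measure (\<mu> v)"
    "B \<in> sets M \<Longrightarrow> emeasure (\<mu> v) B = ennreal (Re (qform (\<sigma> B) v))"
    "B \<in> sets M \<Longrightarrow> measure (\<mu> v) B = Re (qform (\<sigma> B) v)"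
    by (rule * | assumption)+
qed

lemma trace_measure:
  shows "sets \<tau> = sets M" "space \<tau> = space M" "finite_measure \<tau>"
    "B \<in> sets M \<Longrightarrow> emeasure \<tau> B = ennreal (Re (trace (\<sigma> B)))"
proof -
  have a: "0 \<le> Re (trace (\<sigma> B))" if "B \<in> sets M" for B
    using nonneg_herm_trace[OF nonneg[OF that]] by simp
  have b: "(\<lambda>n. Re (trace (\<sigma> (A n)))) sums Re (trace (\<sigma> (\<Union>n. A n)))"
    if "range A \<subseteq> sets M" "disjoint_family A" for A :: "nat \<Rightarrow> 'a set"
    using bounded_linear.sums[OF bounded_linear_compose[OF bounded_linear_Re bounded_linear_trace] sums[OF that]]
    by simp
  note * = measure_of_real_properties[of M "\<lambda>B. Re (trace (\<sigma> B))", OF a b, folded trace_measure_def]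
  show "sets \<tau> = sets M" "space \<tau> = space M" "finite_measure \<tau>"
    "B \<in> sets M \<Longrightarrow> emeasure \<tau> B = ennreal (Re (trace (\<sigma> B)))"
    by (rule * | assumption)+
qed

lemma measurable_iff:
  "f \<in> borel_measurable (\<mu> v) \<longleftrightarrow> f \<in> borel_measurable M"
  "f \<in> borel_measurable \<tau> \<longleftrightarrow> f \<in> borel_measurable M"
  by (auto cong: measurable_cong_sets simp: scalar_measure trace_measure)

definition rn_dens :: "complex^'q \<Rightarrow> 'a \<Rightarrow> real" where
  "rn_dens v = (SOME d. d \<in> borel_measurable M \<and> (\<forall>x. 0 \<le> d x) \<and> density \<tau> (\<lambda>x. ennreal (d x)) = \<mu> v)"

text \<open>A non-negative matrix of trace zero vanishes, so every scalar measure is absolutely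
  continuous with respect to the trace measure. A real-valued version of the derivative is chosen so
  that it can multiply complex integrands.\<close>

lemma rn_dens: "rn_dens v \<in> borel_measurable M" "0 \<le> rn_dens v x" "density \<tau> (\<lambda>x. ennreal (rn_dens v x)) = \<mu> v"
proof -
  interpret \<tau>: finite_measure \<tau> by (rule trace_measure)
  have ac: "absolutely_continuous \<tau> (\<mu> v)"
  proof (unfold absolutely_continuous_def, rule subsetI)
    fix B assume "B \<in> null_sets \<tau>"
    then have B: "B \<in> sets M" "emeasure \<tau> B = 0" by (auto simp: null_sets_def trace_measure)
    then have "Re (trace (\<sigma> B)) = 0"
      using nonneg_herm_trace(1)[OF nonneg[OF B(1)]] by (simp add: trace_measure ennreal_eq_0_iff)
    then have "\<sigma> B = 0" using nonneg_herm_trace(2)[OF nonneg[OF B(1)]] by simp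
    then show "B \<in> null_sets (\<mu> v)" using B by (simp add: null_sets_def scalar_measure)
  qed
  have sets: "sets (\<mu> v) = sets \<tau>" by (simp add: scalar_measure trace_measure)
  obtain d where d: "d \<in> borel_measurable \<tau>" "AE x in \<tau>. RN_deriv \<tau> (\<mu> v) x = ennreal (d x)" "\<And>x. 0 \<le> d x"
    using \<tau>.real_RN_deriv[OF scalar_measure(3) ac sets] by blast
  have "density \<tau> (\<lambda>x. ennreal (d x)) = density \<tau> (RN_deriv \<tau> (\<mu> v))"
    by (rule density_cong) (use d in \<open>auto elim: eventually_mono\<close>)
  also have "\<dots> = \<mu> v" by (rule \<tau>.density_RN_deriv[OF ac sets])
  finally have "\<exists>d. d \<in> borel_measurable M \<and> (\<forall>x. 0 \<le> d x) \<and> density \<tau> (\<lambda>x. ennreal (d x)) = \<mu> v"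
    using d by (auto simp: measurable_iff)
  from someI_ex[OF this] show "rn_dens v \<in> borel_measurable M" "0 \<le> rn_dens v x"
    "density \<tau> (\<lambda>x. ennreal (rn_dens v x)) = \<mu> v"
    by (auto simp: rn_dens_def)
qed

lemma integrable_scalar_iff:
  fixes f :: "'a \<Rightarrow> complex"
  assumes "f \<in> borel_measurable M"
  shows "integrable (\<mu> v) f \<longleftrightarrow> integrable \<tau> (\<lambda>x. f x * complex_of_real (rn_dens v x))"
  using assms rn_dens(1,2)[of v] unfolding rn_dens(3)[of v, symmetric]
  by (subst integrable_density) (auto simp: measurable_iff scaleR_conv_of_real mult.commute)

lemma integral_scalar:
  fixes f :: "'a \<Rightarrow> complex"
  assumes "f \<in> borel_measurable M"
  shows "integral\<^sup>L (\<mu> v) f = integral\<^sup>L \<tau> (\<lambda>x. f x * complex_of_real (rn_dens v x))"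
  using assms rn_dens(1,2)[of v] unfolding rn_dens(3)[of v, symmetric]
  by (subst integral_density) (auto simp: measurable_iff scaleR_conv_of_real mult.commute)

lemma integrable_dens: "integrable \<tau> (rn_dens v)"
proof -
  interpret finite_measure "\<mu> v" by (rule scalar_measure)
  have "integrable (\<mu> v) (\<lambda>_. 1 :: complex)" by simp
  then have "integrable \<tau> (\<lambda>x. complex_of_real (rn_dens v x))"
    by (subst (asm) integrable_scalar_iff) auto
  from integrable_Re[OF this] show ?thesis by simp
qed

lemma set_integral_dens:
  assumes "B \<in> sets M"
  shows "(LINT t:B|\<tau>. rn_dens v t) = Re (qform (\<sigma> B) v)"
proof -
  interpret finite_measure "\<mu> v" by (rule scalar_measure)
  have "(LINT t:B|\<tau>. rn_dens v t) = (LINT t|density \<tau> (\<lambda>x. ennreal (rn_dens v x)). indicator B t)"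
    using assms rn_dens(1,2)[of v] unfolding set_lebesgue_integral_def
    by (subst integral_density) (auto simp: measurable_iff trace_measure mult.commute)
  also have "\<dots> = measure (\<mu> v) B"
    unfolding rn_dens(3) using assms by (simp add: scalar_measure sets.Int_space_eq2)
  finally show ?thesis using assms by (simp add: scalar_measure)
qed

definition polar_density :: "'a \<Rightarrow> complex^'q^'q" where
  "polar_density t = polar (\<lambda>v. complex_of_real (rn_dens v t))"

lemma trace_density_polar: "trace_density M \<sigma> polar_density"
  unfolding trace_density_def
proof (intro allI conjI ballI)
  fix i j
  show "integrable \<tau> (\<lambda>t. polar_density t $ i $ j)"
    unfolding polar_density_def by (rule integral_polar) (simp add: integrable_dens)
  fix B assume B: "B \<in> sets M"
  have int: "integrable \<tau> (\<lambda>t. indicator B t *\<^sub>R complex_of_real (rn_dens v t))" for v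
    using B by (intro integrable_mult_indicator) (auto simp: trace_measure integrable_dens)
  have 1: "(LINT t|\<tau>. indicator B t *\<^sub>R complex_of_real (rn_dens v t)) = qform (\<sigma> B) v" for v
  proof -
    have "(LINT t|\<tau>. indicator B t *\<^sub>R complex_of_real (rn_dens v t))
        = (LINT t|\<tau>. complex_of_real (indicator B t *\<^sub>R rn_dens v t))"
      by (intro Bochner_Integration.integral_cong) (auto simp: indicator_def)
    also have "\<dots> = complex_of_real (LINT t:B|\<tau>. rn_dens v t)"
      unfolding set_lebesgue_integral_def by (rule integral_complex_of_real)
    finally show ?thesis
      using set_integral_dens[OF B] nonneg_hermD(3)[OF nonneg[OF B], of v] by metis
  qed
  have "(LINT t:B|\<tau>. polar_density t $ i $ j)
     = (LINT t|\<tau>. polar (\<lambda>v. indicator B t *\<^sub>R complex_of_real (rn_dens v t)) $ i $ j)"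
    unfolding set_lebesgue_integral_def polar_density_def polar_def
    by (intro Bochner_Integration.integral_cong) (auto simp: indicator_def)
  also have "\<dots> = polar (qform (\<sigma> B)) $ i $ j"
    by (subst integral_polar(2)) (simp_all only: int 1)
  finally show "\<sigma> B $ i $ j = (LINT t:B|\<tau>. polar_density t $ i $ j)"
    by (simp add: polar_qform)
qed

text \<open>\<open>has_matrix_integral\<close> provides some density only. Uniqueness of real
  densities, applied to real and imaginary part of its quadratic form, ties it to the fixed choice
  \<open>rn_dens\<close>.\<close>

lemma trace_density_dens:
  assumes "trace_density M \<sigma> D"
  shows "AE t in \<tau>. qform (D t) v = complex_of_real (rn_dens v t)"
proof -
  have D: "integrable \<tau> (\<lambda>t. D t $ i $ j)" for i j
    using assms by (simp add: trace_density_def)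
  have int: "integrable \<tau> (\<lambda>t. qform (D t) v)"
    unfolding qform_sum by (intro Bochner_Integration.integrable_sum integrable_mult_right D)
  have set: "(LINT t:B|\<tau>. qform (D t) v) = qform (\<sigma> B) v" if B: "B \<in> sets M" for B
  proof -
    have intB: "integrable \<tau> (\<lambda>t. indicator B t *\<^sub>R D t $ i $ j)" for i j
      using B D by (intro integrable_mult_indicator) (auto simp: trace_measure)
    have "(LINT t:B|\<tau>. qform (D t) v) =
      (LINT t|\<tau>. (\<Sum>i\<in>UNIV. \<Sum>j\<in>UNIV. cnj (v $ i) * v $ j * (indicator B t *\<^sub>R D t $ i $ j)))"
      unfolding set_lebesgue_integral_def qform_sum
      by (intro Bochner_Integration.integral_cong) (auto simp: indicator_def)
    also have "\<dots> = (\<Sum>i\<in>UNIV. \<Sum>j\<in>UNIV. cnj (v $ i) * v $ j * (LINT t|\<tau>. indicator B t *\<^sub>R D t $ i $ j))"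
      by (simp only: Bochner_Integration.integral_sum Bochner_Integration.integrable_sum
          integrable_mult_right intB integral_mult_right_zero)
    also have "\<dots> = qform (\<sigma> B) v"
      using assms B by (simp add: trace_density_def qform_sum set_lebesgue_integral_def)
    finally show ?thesis .
  qed
  have real: "(LINT t:B|\<tau>. Re (qform (D t) v)) = (LINT t:B|\<tau>. rn_dens v t)"
             "(LINT t:B|\<tau>. Im (qform (D t) v)) = (LINT t:B|\<tau>. 0)" if "B \<in> sets \<tau>" for B
  proof -
    have B: "B \<in> sets M" using that by (simp add: trace_measure)
    have i: "integrable \<tau> (\<lambda>t. indicator B t *\<^sub>R qform (D t) v)"
      using that int by (rule integrable_mult_indicator)
    show "(LINT t:B|\<tau>. Re (qform (D t) v)) = (LINT t:B|\<tau>. rn_dens v t)"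
      using set[OF B] integral_Re[OF i] set_integral_dens[OF B, of v]
      by (simp add: set_lebesgue_integral_def)
    have "Im (qform (\<sigma> B) v) = 0"
      using nonneg_hermD(3)[OF nonneg[OF B], of v] by (metis Im_complex_of_real)
    then show "(LINT t:B|\<tau>. Im (qform (D t) v)) = (LINT t:B|\<tau>. 0)"
      using set[OF B] integral_Im[OF i] by (simp add: set_lebesgue_integral_def)
  qed
  have "AE t in \<tau>. Re (qform (D t) v) = rn_dens v t"
    by (rule density_unique_real) (use int real in \<open>auto intro: integrable_dens integrable_Re\<close>)
  moreover have "AE t in \<tau>. Im (qform (D t) v) = 0"
    by (rule density_unique_real) (use int real in \<open>auto intro: integrable_Im\<close>)
  ultimately show ?thesis by eventually_elim (simp add: complex_eq_iff)
qed

lemma has_matrix_integralD: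
  assumes "has_matrix_integral M \<sigma> f J"
  shows "f \<in> borel_measurable M" "integrable (\<mu> v) f" "(LINT t|\<mu> v. f t) = qform J v"
proof -
  show f: "f \<in> borel_measurable M" using assms by (simp add: has_matrix_integral_def)
  obtain D :: "'a \<Rightarrow> complex^'q^'q" where D: "trace_density M \<sigma> D" "\<And>i j. integrable \<tau> (\<lambda>t. f t * D t $ i $ j)"
    "\<And>i j. J $ i $ j = (LINT t|\<tau>. f t * D t $ i $ j)"
    using assms by (auto simp: has_matrix_integral_def)
  have meas: "(\<lambda>t. D t $ i $ j) \<in> borel_measurable \<tau>" for i j
    using D(1) borel_measurable_integrable unfolding trace_density_def by blast
  have eq: "f t * qform (D t) v = (\<Sum>i\<in>UNIV. \<Sum>j\<in>UNIV. cnj (v $ i) * v $ j * (f t * D t $ i $ j))" for t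
    by (simp add: qform_sum sum_distrib_left algebra_simps)
  have ae: "AE t in \<tau>. f t * qform (D t) v = f t * complex_of_real (rn_dens v t)"
    using trace_density_dens[OF D(1), of v] by eventually_elim simp
  have i: "integrable \<tau> (\<lambda>t. f t * qform (D t) v)"
    unfolding eq by (intro Bochner_Integration.integrable_sum integrable_mult_right D)
  have m: "(\<lambda>t. f t * complex_of_real (rn_dens v t)) \<in> borel_measurable \<tau>"
    using f rn_dens(1)[of v] by (auto simp: measurable_iff)
  show "integrable (\<mu> v) f"
    unfolding integrable_scalar_iff[OF f] by (rule integrable_cong_AE_imp[OF i m ae])
  have "(LINT t|\<mu> v. f t) = (LINT t|\<tau>. f t * qform (D t) v)"
    unfolding integral_scalar[OF f]
    by (intro integral_cong_AE m borel_measurable_integrable[OF i]) (use ae in eventually_elim, auto)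
  also have "\<dots> = (\<Sum>i\<in>UNIV. \<Sum>j\<in>UNIV. cnj (v $ i) * v $ j * J $ i $ j)"
    unfolding eq D(3) using D(2) by (simp add: Bochner_Integration.integral_sum)
  finally show "(LINT t|\<mu> v. f t) = qform J v" by (simp add: qform_sum)
qed

text \<open>Polarisation vectors suffice because the density \<open>polar_density\<close> is
  assembled from exactly their scalar densities. The converse \<open>has_matrix_integralD\<close>
  then yields the integrals for all vectors.\<close>

lemma has_matrix_integralI:
  assumes f: "f \<in> borel_measurable M"
    and int: "\<And>v. v \<in> polarisation_vectors \<Longrightarrow> integrable (\<mu> v) f"
    and eq: "\<And>v. v \<in> polarisation_vectors \<Longrightarrow> (LINT t|\<mu> v. f t) = qform J v"
  shows "has_matrix_integral M \<sigma> f J"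
proof -
  have i: "integrable \<tau> (\<lambda>x. f x * complex_of_real (rn_dens v x))" if "v \<in> polarisation_vectors" for v
    using int[OF that] integrable_scalar_iff[OF f] by simp
  have fD: "f t * polar_density t $ i $ j = polar (\<lambda>v. f t * complex_of_real (rn_dens v t)) $ i $ j" for i j t
    by (simp add: polar_density_def polar_def algebra_simps)
  have "polar (\<lambda>v. LINT t|\<tau>. f t * complex_of_real (rn_dens v t)) = polar (qform J)"
    using eq unfolding integral_scalar[OF f] by (simp add: polar_def)
  then show ?thesis
    unfolding has_matrix_integral_def
    using f trace_density_polar i
    by (intro conjI exI[of _ polar_density] allI) (simp_all add: fD integral_polar polar_qform)
qed

end

section \<open>Moments and expansions at minus infinity\<close>

lemma geometric_remainder:
  fixes t x :: "'a::field"
  assumes "x \<noteq> 0" "t \<noteq> x"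
  shows "x ^ n * (1 / (t - x) + (\<Sum>j<n. t ^ j / x ^ Suc j)) = t ^ n / (t - x)"
proof (induction n)
  case (Suc n)
  have "x ^ Suc n * (1 / (t - x) + (\<Sum>j<Suc n. t ^ j / x ^ Suc j))
      = x * (x ^ n * (1 / (t - x) + (\<Sum>j<n. t ^ j / x ^ Suc j))) + t ^ n"
    using assms(1) by (simp add: algebra_simps)
  also have "\<dots> = t ^ Suc n / (t - x)"
    using assms by (simp only: Suc) (simp add: divide_simps, simp add: algebra_simps)
  finally show ?case .
qed simp

locale half_line_measure = finite_measure N for N :: "real measure" +
  fixes \<alpha> :: real
  assumes sets_N: "sets N = sets (restrict_space borel {\<alpha>..})"
begin

lemma space_N: "space N = {\<alpha>..}"
  using sets_eq_imp_space_eq[OF sets_N] by (simp add: space_restrict_space)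

lemma measurable_N: "f \<in> borel_measurable borel \<Longrightarrow> f \<in> borel_measurable N"
  unfolding measurable_cong_sets[OF sets_N refl] by (rule measurable_restrict_space1)

text \<open>Beyond this index t + k \<ge> 1 and \<bar>t\<bar> \<le> t + k for every t \<ge>
  \<alpha>. The factor 2 is for negative t, where the second bound means k \<ge> -2t.\<close>

definition "K0 = nat \<lceil>2 * \<bar>\<alpha>\<bar>\<rceil> + 1"

lemma K0: "real (k + K0) \<ge> 2 * \<bar>\<alpha>\<bar> + 1"
  unfolding K0_def by linarith

lemma shifted_pos:
  assumes "t \<ge> \<alpha>"
  shows "t + real (k + K0) \<ge> 1" "\<bar>t\<bar> \<le> t + real (k + K0)"
  using K0[of k] assms by linarith+

lemma integrable_power_lower:
  assumes "integrable N (\<lambda>t. t ^ n)" "j \<le> n"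
  shows "integrable N (\<lambda>t. t ^ j :: real)"
proof (rule Bochner_Integration.integrable_bound)
  show "integrable N (\<lambda>t. 1 + \<bar>t ^ n\<bar>)" using assms(1) by simp
  show "(\<lambda>t. t ^ j) \<in> borel_measurable N" by (intro measurable_N) simp
  have "\<bar>t\<bar> ^ j \<le> 1 + \<bar>t\<bar> ^ n" for t :: real
  proof (cases "\<bar>t\<bar> \<le> 1")
    case True
    then have "\<bar>t\<bar> ^ j \<le> 1" by (simp add: power_le_one)
    then show ?thesis by (simp add: add_increasing2)
  next
    case False
    then have "\<bar>t\<bar> ^ j \<le> \<bar>t\<bar> ^ n" by (intro power_increasing) (use assms in auto)
    then show ?thesis by simp
  qed
  then show "AE t in N. norm (t ^ j) \<le> norm (1 + \<bar>t ^ n\<bar>)" by (simp add: power_abs)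
qed

lemma integrable_cauchy:
  "integrable N (\<lambda>t. 1 / (t + real (k + K0)))"
proof (rule Bochner_Integration.integrable_bound)
  show "integrable N (\<lambda>t. 1 :: real)" by simp
  show "(\<lambda>t. 1 / (t + real (k + K0))) \<in> borel_measurable N"
    by (intro measurable_N) simp
  show "AE t in N. norm (1 / (t + real (k + K0))) \<le> norm (1 :: real)"
  proof (rule AE_I2)
    fix t assume "t \<in> space N"
    then show "norm (1 / (t + real (k + K0))) \<le> norm (1 :: real)"
      using shifted_pos(1)[of t k] by (simp add: space_N field_simps)
  qed
qed

lemma integral_geometric_remainder:
  assumes "\<And>j. j < n \<Longrightarrow> integrable N (\<lambda>t. t ^ j)"
  defines "x k \<equiv> - real (k + K0)"
  shows "x k ^ n * ((LINT t|N. 1 / (t - x k)) + (\<Sum>j<n. (LINT t|N. t ^ j) / x k ^ Suc j))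
    = (LINT t|N. t ^ n / (t - x k))"
proof -
  have int: "integrable N (\<lambda>t. 1 / (t - x k))" using integrable_cauchy[of k] by (simp only: x_def diff_minus_eq_add)
  have "(LINT t|N. t ^ n / (t - x k)) = (LINT t|N. x k ^ n * (1 / (t - x k) + (\<Sum>j<n. t ^ j / x k ^ Suc j)))"
  proof (rule Bochner_Integration.integral_cong)
    fix t assume "t \<in> space N"
    then have "t \<noteq> x k" using shifted_pos(1)[of t k] by (auto simp: space_N x_def)
    moreover have "x k \<noteq> 0" using K0[of k] abs_ge_zero[of \<alpha>] unfolding x_def by linarith
    ultimately show "t ^ n / (t - x k) = x k ^ n * (1 / (t - x k) + (\<Sum>j<n. t ^ j / x k ^ Suc j))"
      by (subst geometric_remainder) auto
  qed simp
  also have "\<dots> = x k ^ n * (LINT t|N. 1 / (t - x k) + (\<Sum>j<n. t ^ j / x k ^ Suc j))"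
    by (rule integral_mult_right_zero)
  also have "(LINT t|N. 1 / (t - x k) + (\<Sum>j<n. t ^ j / x k ^ Suc j))
     = (LINT t|N. 1 / (t - x k)) + (LINT t|N. (\<Sum>j<n. t ^ j / x k ^ Suc j))"
    by (intro Bochner_Integration.integral_add int Bochner_Integration.integrable_sum
        integrable_divide_zero) (use assms in auto)
  also have "(LINT t|N. (\<Sum>j<n. t ^ j / x k ^ Suc j)) = (\<Sum>j<n. (LINT t|N. t ^ j) / x k ^ Suc j)"
    by (subst Bochner_Integration.integral_sum) (use assms in auto)
  finally show ?thesis by simp
qed

text \<open>After multiplication the truncation error is the integral of t^(n+1)/(t - x). By
  \<bar>t\<bar> \<le> t - x it is dominated by \<bar>t\<bar>^n, and its integrand tends to 0
  pointwise.\<close>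

lemma moment_expansion:
  assumes int: "integrable N (\<lambda>t. t ^ n)"
  defines "x \<equiv> \<lambda>k. - real k"
  shows "(\<lambda>k. x k ^ Suc n * ((LINT t|N. 1 / (t - x k)) + (\<Sum>j\<le>n. (LINT t|N. t ^ j) / x k ^ Suc j)))
     \<longlonglongrightarrow> 0"
proof (rule LIMSEQ_offset[of _ K0])
  have eq: "x (k + K0) ^ Suc n * ((LINT t|N. 1 / (t - x (k + K0))) + (\<Sum>j\<le>n. (LINT t|N. t ^ j) / x (k + K0) ^ Suc j))
     = (LINT t|N. t ^ Suc n / (t - x (k + K0)))" for k
    using integral_geometric_remainder[of "Suc n" k] integrable_power_lower[OF int]
    by (simp only: x_def lessThan_Suc_atMost less_Suc_eq_le)
  have "(\<lambda>k. LINT t|N. t ^ Suc n / (t - x (k + K0))) \<longlonglongrightarrow> (LINT t|N. 0)"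
  proof (rule integral_dominated_convergence[where w = "\<lambda>t. \<bar>t ^ n\<bar>"])
    show "AE t in N. (\<lambda>k. t ^ Suc n / (t - x (k + K0))) \<longlonglongrightarrow> 0"
    proof (rule AE_I2)
      fix t :: real
      have "(\<lambda>k. t ^ Suc n / (t - x k)) \<longlonglongrightarrow> 0"
        unfolding x_def by real_asymp
      then show "(\<lambda>k. t ^ Suc n / (t - x (k + K0))) \<longlonglongrightarrow> 0" by (rule LIMSEQ_ignore_initial_segment)
    qed
    show "AE t in N. norm (t ^ Suc n / (t - x (k + K0))) \<le> \<bar>t ^ n\<bar>" for k
    proof (rule AE_I2)
      fix t assume "t \<in> space N"
      then have t: "t + real (k + K0) \<ge> 1" "\<bar>t\<bar> \<le> t + real (k + K0)" using shifted_pos[of t k] by (auto simp: space_N)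
      have a: "t - x (k + K0) = t + real (k + K0)" by (simp add: x_def)
      have "norm (t ^ Suc n / (t - x (k + K0))) = \<bar>t ^ n\<bar> * (\<bar>t\<bar> / (t + real (k + K0)))"
        unfolding a using t(1) by (simp add: abs_mult)
      also have "\<dots> \<le> \<bar>t ^ n\<bar> * 1" using t by (intro mult_left_mono) auto
      finally show "norm (t ^ Suc n / (t - x (k + K0))) \<le> \<bar>t ^ n\<bar>" by simp
    qed
  qed (use int in \<open>auto intro!: measurable_N\<close>)
  then show "(\<lambda>k. x (k + K0) ^ Suc n * ((LINT t|N. 1 / (t - x (k + K0))) + (\<Sum>j\<le>n. (LINT t|N. t ^ j) / x (k + K0) ^ Suc j)))
     \<longlonglongrightarrow> 0"
    unfolding eq by simp
qed

lemma moment_from_limit: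
  assumes int: "\<And>j. j < n \<Longrightarrow> integrable N (\<lambda>t. t ^ j)"
    and lim: "(\<lambda>k. LINT t|N. real (k + K0) * t ^ n / (t + real (k + K0))) \<longlonglongrightarrow> c"
  shows "integrable N (\<lambda>t. t ^ n) \<and> (LINT t|N. t ^ n) = c"
proof -
  define f where "f k t = real (k + K0) * t ^ n / (t + real (k + K0))" for k t
  have bound: "\<bar>f k t\<bar> \<le> real (k + K0) * (1 + \<bar>t ^ (n - 1)\<bar>)" if "t \<ge> \<alpha>" for k t
  proof -
    have "\<bar>t ^ n\<bar> \<le> (t + real (k + K0)) * (1 + \<bar>t ^ (n - 1)\<bar>)"
    proof (cases n)
      case 0 then show ?thesis using shifted_pos[OF that, of k] by simp
    next
      case (Suc p)
      have "\<bar>t\<bar> * \<bar>t ^ p\<bar> \<le> (t + real (k + K0)) * (1 + \<bar>t ^ p\<bar>)"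
        using shifted_pos[OF that, of k] by (intro mult_mono) auto
      then show ?thesis using Suc by (simp add: abs_mult)
    qed
    then have "\<bar>t ^ n\<bar> / (t + real (k + K0)) \<le> 1 + \<bar>t ^ (n - 1)\<bar>"
      using shifted_pos[OF that, of k] by (simp add: field_simps)
    then have "real (k + K0) * (\<bar>t ^ n\<bar> / (t + real (k + K0))) \<le> real (k + K0) * (1 + \<bar>t ^ (n - 1)\<bar>)"
      by (intro mult_left_mono) auto
    moreover have "\<bar>f k t\<bar> = real (k + K0) * (\<bar>t ^ n\<bar> / (t + real (k + K0)))"
      using shifted_pos[OF that, of k] by (simp add: f_def abs_mult abs_divide)
    ultimately show ?thesis by simp
  qed
  have fmeas: "f k \<in> borel_measurable borel" for k unfolding f_def by measurable
  have "integrable N (\<lambda>t. t ^ (n - 1))" using int[of "n - 1"] by (cases n) auto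
  then have dom: "integrable N (\<lambda>t. real (k + K0) * (1 + \<bar>t ^ (n - 1)\<bar>))" for k by simp
  have intf: "integrable N (f k)" for k
    by (rule Bochner_Integration.integrable_bound[OF dom[of k]])
       (use bound[of _ k] in \<open>auto intro!: AE_I2 measurable_N fmeas simp: space_N order_trans[OF _ abs_ge_self]\<close>)
  have flim: "(\<lambda>k. f k t) \<longlonglongrightarrow> t ^ n" for t
  proof -
    have "(\<lambda>k. real k * t ^ n / (t + real k)) \<longlonglongrightarrow> t ^ n" by real_asymp
    then show ?thesis unfolding f_def by (rule LIMSEQ_ignore_initial_segment)
  qed
  let ?n = "indicator {..<0} :: real \<Rightarrow> real" and ?p = "indicator {0..} :: real \<Rightarrow> real"
  have intn: "integrable N (\<lambda>t. ?n t * f k t)" and intp: "integrable N (\<lambda>t. ?p t * f k t)" for k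
    by (rule Bochner_Integration.integrable_bound[OF intf[of k]];
        auto intro!: measurable_N borel_measurable_times fmeas simp: indicator_def)+
  have nlim: "(\<lambda>k. LINT t|N. ?n t * f k t) \<longlonglongrightarrow> (LINT t|N. ?n t * t ^ n)"
  \<comment> \<open>For \<alpha> \<le> t < 0 the choice of \<open>K0\<close> keeps k/(t + k) at most
    2, while \<bar>t\<bar> \<le> \<bar>\<alpha>\<bar>.\<close>
  proof (rule integral_dominated_convergence[where w = "\<lambda>_. 2 * \<bar>\<alpha>\<bar> ^ n"])
    show "AE t in N. (\<lambda>k. ?n t * f k t) \<longlonglongrightarrow> ?n t * t ^ n"
      by (intro AE_I2 tendsto_intros flim)
    show "AE t in N. norm (?n t * f k t) \<le> 2 * \<bar>\<alpha>\<bar> ^ n" for k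
    proof (rule AE_I2)
      fix t assume "t \<in> space N"
      then have t: "t \<ge> \<alpha>" by (simp add: space_N)
      show "norm (?n t * f k t) \<le> 2 * \<bar>\<alpha>\<bar> ^ n"
      proof (cases "t < 0")
        case True
        have "\<bar>t\<bar> \<le> \<bar>\<alpha>\<bar>" using True t by simp
        then have 1: "\<bar>t ^ n\<bar> \<le> \<bar>\<alpha>\<bar> ^ n" by (simp add: power_abs power_mono)
        have "2 * \<bar>\<alpha>\<bar> + 1 \<le> real (k + K0)" by (rule K0)
        then have "real (k + K0) \<le> 2 * (t + real (k + K0))"
        proof -
          have "r \<le> 2 * (t + r)" if "2 * a + 1 \<le> r" "- \<alpha> \<le> a" for a r
            using that t by simp
          then show ?thesis using K0[of k] abs_ge_minus_self[of \<alpha>] by blast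
        qed
        then have 2: "real (k + K0) / (t + real (k + K0)) \<le> 2"
          using shifted_pos(1)[OF t, of k] by (simp add: field_simps)
        have "norm (?n t * f k t) = \<bar>t ^ n\<bar> * (real (k + K0) / (t + real (k + K0)))"
          using True shifted_pos(1)[OF t, of k] by (simp add: f_def abs_mult)
        also have "\<dots> \<le> \<bar>\<alpha>\<bar> ^ n * 2"
          using 1 2 shifted_pos(1)[OF t, of k] by (intro mult_mono) auto
        finally show ?thesis by simp
      qed simp
    qed
  qed (auto intro!: measurable_N borel_measurable_times fmeas)
  have eqf: "?n t * f k t + ?p t * f k t = f k t" for t k by (auto simp: indicator_def)
  have split: "(LINT t|N. ?p t * f k t) = (LINT t|N. f k t) - (LINT t|N. ?n t * f k t)" for k
    using Bochner_Integration.integral_add[OF intn[of k] intp[of k]] unfolding eqf by simp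
  have plim: "(\<lambda>k. LINT t|N. ?p t * f k t) \<longlonglongrightarrow> c - (LINT t|N. ?n t * t ^ n)"
    unfolding split using nlim by (intro tendsto_diff) (use lim in \<open>simp_all only: f_def[abs_def]\<close>)
  have mono: "mono (\<lambda>k. ?p t * f k t)" if "t \<ge> \<alpha>" for t
  proof (rule monoI)
    fix i j :: nat assume "i \<le> j"
    show "?p t * f i t \<le> ?p t * f j t"
    proof (cases "t \<ge> 0")
      case True
      have "real (i + K0) / (t + real (i + K0)) \<le> real (j + K0) / (t + real (j + K0))"
        using \<open>i \<le> j\<close> True shifted_pos(1)[OF that, of i] shifted_pos(1)[OF that, of j]
        by (simp add: divide_simps) (simp add: algebra_simps mult_left_mono)
      then have "t ^ n * (real (i + K0) / (t + real (i + K0))) \<le> t ^ n * (real (j + K0) / (t + real (j + K0)))"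
        using True by (intro mult_left_mono) auto
      then show ?thesis using True by (simp add: f_def mult.commute)
    qed simp
  qed
  have monoAE: "AE t in N. mono (\<lambda>k. ?p t * f k t)" using mono by (auto simp: space_N)
  have limAE: "AE t in N. (\<lambda>k. ?p t * f k t) \<longlonglongrightarrow> ?p t * t ^ n"
    by (intro AE_I2 tendsto_intros flim)
  have "(\<lambda>t. ?p t * t ^ n) \<in> borel_measurable N" by (intro measurable_N) measurable
  note P = integrable_monotone_convergence[OF intp monoAE limAE plim this]
    integral_monotone_convergence[OF intp monoAE limAE plim this]
  have Q: "integrable N (\<lambda>t. ?n t * t ^ n)"
  proof (rule Bochner_Integration.integrable_bound[of _ "\<lambda>_. \<bar>\<alpha>\<bar> ^ n"])
    show "AE t in N. norm (?n t * t ^ n) \<le> norm (\<bar>\<alpha>\<bar> ^ n)"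
      by (intro AE_I2) (auto simp: indicator_def space_N power_abs intro!: power_mono)
  qed (auto intro!: measurable_N)
  have eq: "?p t * t ^ n + ?n t * t ^ n = t ^ n" for t by (auto simp: indicator_def)
  show ?thesis
    using Bochner_Integration.integrable_add[OF P(1) Q] Bochner_Integration.integral_add[OF P(1) Q] P(2)
    unfolding eq by simp
qed

text \<open>Dividing an expansion of order n by x leaves one of order n - 1, so by induction the
  lower moments exist and match. What remains of the expansion is then precisely the limit in
  \<open>moment_from_limit\<close>.\<close>

lemma moments_from_expansion:
  fixes c :: "nat \<Rightarrow> real"
  defines "x \<equiv> \<lambda>k. - real k"
  assumes "(\<lambda>k. x k ^ Suc n * ((LINT t|N. 1 / (t - x k)) + (\<Sum>j\<le>n. c j / x k ^ Suc j))) \<longlonglongrightarrow> 0"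
    and "j \<le> n"
  shows "integrable N (\<lambda>t. t ^ j) \<and> (LINT t|N. t ^ j) = c j"
  using assms(2,3)
proof (induction n arbitrary: j rule: less_induct)
  case (less n)
  let ?S = "\<lambda>k. LINT t|N. 1 / (t - x k)"
  have IH: "integrable N (\<lambda>t. t ^ i) \<and> (LINT t|N. t ^ i) = c i" if i: "i < n" for i
  proof -
    obtain p where n: "n = Suc p" using i gr0_implies_Suc[of n] by auto
    have "(\<lambda>k. 1 / x k * (x k ^ Suc n * (?S k + (\<Sum>j\<le>n. c j / x k ^ Suc j))) - c n / x k) \<longlonglongrightarrow> 0 * 0 - 0"
      by (intro tendsto_intros less(2)) (unfold x_def, real_asymp+)
    moreover have "\<forall>\<^sub>F k in sequentially. 1 / x k * (x k ^ Suc n * (?S k + (\<Sum>j\<le>n. c j / x k ^ Suc j))) - c n / x k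
        = x k ^ Suc p * (?S k + (\<Sum>j\<le>p. c j / x k ^ Suc j))"
      using eventually_gt_at_top[of 0] by eventually_elim (simp add: n x_def field_simps)
    ultimately have "(\<lambda>k. x k ^ Suc p * (?S k + (\<Sum>j\<le>p. c j / x k ^ Suc j))) \<longlonglongrightarrow> 0"
      by (simp add: tendsto_cong)
    then show ?thesis using less(1)[of p i] i n by simp
  qed
  have "(\<lambda>k. x (k + K0) ^ Suc n * (?S (k + K0) + (\<Sum>j\<le>n. c j / x (k + K0) ^ Suc j))) \<longlonglongrightarrow> 0"
    using less(2) by (rule LIMSEQ_ignore_initial_segment)
  moreover have "x (k + K0) ^ Suc n * (?S (k + K0) + (\<Sum>j\<le>n. c j / x (k + K0) ^ Suc j))
     = c n - (LINT t|N. real (k + K0) * t ^ n / (t + real (k + K0)))" for k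
  proof -
    let ?x = "x (k + K0)"
    have "?x \<noteq> 0" using K0[of k] abs_ge_zero[of \<alpha>] unfolding x_def by linarith
    have "?x ^ Suc n * (?S (k + K0) + (\<Sum>j\<le>n. c j / ?x ^ Suc j))
       = ?x * (?x ^ n * (?S (k + K0) + (\<Sum>j<n. (LINT t|N. t ^ j) / ?x ^ Suc j))) + c n"
      using IH \<open>?x \<noteq> 0\<close> by (simp add: lessThan_Suc_atMost[symmetric] algebra_simps)
    also have "?x ^ n * (?S (k + K0) + (\<Sum>j<n. (LINT t|N. t ^ j) / ?x ^ Suc j)) = (LINT t|N. t ^ n / (t - ?x))"
      unfolding x_def by (rule integral_geometric_remainder) (use IH in blast)
    also have "?x * (LINT t|N. t ^ n / (t - ?x)) = (LINT t|N. ?x * (t ^ n / (t - ?x)))"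
      by (rule integral_mult_right_zero[symmetric])
    also have "\<dots> = - (LINT t|N. real (k + K0) * t ^ n / (t + real (k + K0)))"
      unfolding x_def diff_minus_eq_add
      by (simp only: Bochner_Integration.integral_minus[symmetric] mult_minus_left times_divide_eq_right
          minus_divide_left)
    finally show ?thesis by simp
  qed
  ultimately have "(\<lambda>k. c n - (LINT t|N. real (k + K0) * t ^ n / (t + real (k + K0)))) \<longlonglongrightarrow> 0" by simp
  from tendsto_diff[OF tendsto_const[of "c n"] this]
  have "(\<lambda>k. LINT t|N. real (k + K0) * t ^ n / (t + real (k + K0))) \<longlonglongrightarrow> c n" by simp
  from moment_from_limit[OF _ this] IH less(3) show ?case
    by (cases "j = n") auto
qed

end

section \<open>The Cauchy formula for the upper half-plane\<close>

text \<open>The real segment is the base of a rectangle in the closed upper half-plane, and the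
  decay of h makes the other three sides negligible. The pole is inside exactly when Im w > 0; the
  case Im w < 0 is stated along with it because the conjugate point is needed later.\<close>

lemma half_plane_cauchy:
  fixes h :: "complex \<Rightarrow> complex"
  assumes e: "e > 0" and holo: "h holomorphic_on {z. Im z > - e}"
    and decay: "\<And>z. Im z \<ge> 0 \<Longrightarrow> cmod z \<ge> R0 \<Longrightarrow> cmod (h z) \<le> C / cmod z"
    and C: "C \<ge> 0" and w: "Im w \<noteq> 0"
  shows "((\<lambda>R. integral {-R..R} (\<lambda>x. h (of_real x) / (of_real x - w)))
    \<longlongrightarrow> (if Im w > 0 then 2 * pi * \<i> * h w else 0)) at_top"
proof -
  define F where "F z = h z / (z - w)" for z
  define L where "L = (if Im w > 0 then 2 * pi * \<i> * h w else 0)"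
  have cont: "continuous_on ({z. Im z > - e} - {w}) F"
    unfolding F_def by (intro continuous_intros holomorphic_on_imp_continuous_on[OF holomorphic_on_subset[OF holo]]) auto
  have bound: "cmod (integral {-R..R} (\<lambda>x. F (of_real x)) - L) \<le> 8 * C / R"
    if R: "R > 0" "R \<ge> R0" "R > 2 * cmod w" for R :: real
  proof -
    define a1 a2 a3 a4 where "a1 = Complex (-R) 0" and "a2 = Complex R 0" and "a3 = Complex R R"
      and "a4 = Complex (-R) R"
    have rect: "rectpath a1 a3 = linepath a1 a2 +++ linepath a2 a3 +++ linepath a3 a4 +++ linepath a4 a1"
      by (simp add: rectpath_def Let_def a1_def a2_def a3_def a4_def)
    have wR: "\<bar>Re w\<bar> < R" "\<bar>Im w\<bar> < R"
      using R abs_Re_le_cmod[of w] abs_Im_le_cmod[of w] by linarith+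
    have seg: "closed_segment a1 a2 = {z. Im z = 0 \<and> Re z \<in> {-R..R}}"
       "closed_segment a2 a3 = {z. Re z = R \<and> Im z \<in> {0..R}}"
       "closed_segment a3 a4 = {z. Im z = R \<and> Re z \<in> {-R..R}}"
       "closed_segment a4 a1 = {z. Re z = -R \<and> Im z \<in> {0..R}}"
      using R by (simp_all add: closed_segment_same_Re closed_segment_same_Im a1_def a2_def a3_def a4_def
          closed_segment_eq_real_ivl)
    have sub: "closed_segment a1 a2 \<union> closed_segment a2 a3 \<union> closed_segment a3 a4 \<union> closed_segment a4 a1
        \<subseteq> {z. Im z \<ge> 0} - {w}"
      unfolding seg using wR w R by auto
    have ci: "F contour_integrable_on linepath a b" if "closed_segment a b \<subseteq> {z. Im z \<ge> 0} - {w}" for a b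
      using that e by (intro contour_integrable_continuous_linepath continuous_on_subset[OF cont]) auto
    note cis = ci[of a1 a2] ci[of a2 a3] ci[of a3 a4] ci[of a4 a1]
    have "(F has_contour_integral L) (rectpath a1 a3)"
    proof (cases "Im w > 0")
      case True
      have "w \<in> box a1 a3" using wR True by (auto simp: in_box_complex_iff a1_def a3_def)
      then have wn: "winding_number (rectpath a1 a3) w = 1" by (rule winding_number_rectpath)
      have op: "open {z. Im z > - e}" by (rule open_halfspace_Im_gt)
      have "((\<lambda>z. h z / (z - w)) has_contour_integral (2 * pi * \<i> * winding_number (rectpath a1 a3) w * h w)) (rectpath a1 a3)"
      proof (rule Cauchy_integral_formula_convex_simple[OF _ holo])
        show "convex {z. Im z > - e}" by (rule convex_halfspace_Im_gt)
        show "w \<in> interior {z. Im z > - e}" using True e by (simp add: interior_open[OF op])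
        show "path_image (rectpath a1 a3) \<subseteq> {z. Im z > - e} - {w}"
          using sub e unfolding rect by (auto simp: path_image_join)
      qed simp_all
      then show ?thesis using True by (simp add: F_def[abs_def] L_def wn)
    next
      case False
      then have "Im w < 0" using w by simp
      have "(F has_contour_integral 0) (rectpath a1 a3)"
      proof (rule Cauchy_theorem_convex_simple)
        \<comment> \<open>This half-plane contains the rectangle and leaves out the pole below the
          axis.\<close>
        show "F holomorphic_on {z. Im z > max (-e) (Im w)}" unfolding F_def
          by (intro holomorphic_intros holomorphic_on_subset[OF holo]) auto
        show "convex {z. Im z > max (-e) (Im w)}" by (rule convex_halfspace_Im_gt)
        show "path_image (rectpath a1 a3) \<subseteq> {z. Im z > max (-e) (Im w)}"
          using sub e \<open>Im w < 0\<close> unfolding rect by (auto simp: path_image_join subset_iff)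
      qed simp_all
      then show ?thesis using False by (simp add: L_def)
    qed
    then have "contour_integral (rectpath a1 a3) F = L" by (rule contour_integral_unique)
    moreover have "contour_integral (rectpath a1 a3) F = contour_integral (linepath a1 a2) F
       + (contour_integral (linepath a2 a3) F + (contour_integral (linepath a3 a4) F + contour_integral (linepath a4 a1) F))"
      unfolding rect using cis sub by (simp add: contour_integrable_joinI)
    moreover have "contour_integral (linepath a1 a2) F = integral {-R..R} (\<lambda>x. F (of_real x))"
      by (subst contour_integral_linepath_Reals_eq) (use R in \<open>auto simp: a1_def a2_def complex_is_Real_iff\<close>)
    ultimately have eq: "integral {-R..R} (\<lambda>x. F (of_real x)) - L = - (contour_integral (linepath a2 a3) F
        + (contour_integral (linepath a3 a4) F + contour_integral (linepath a4 a1) F))"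
      by (simp add: algebra_simps)
    \<comment> \<open>From R > 2 \<bar>w\<bar> the distance to the pole is at least R/2. The three
      sides have total length 4R, which accounts for the constant 8 in \<open>bound\<close>.\<close>
    have B: "cmod (F z) \<le> 2 * C / R\<^sup>2" if "Im z \<ge> 0" "cmod z \<ge> R" for z
    proof -
      have "cmod (h z) \<le> C / cmod z" using that R by (intro decay) auto
      also have "\<dots> \<le> C / R" using that R C by (intro divide_left_mono mult_pos_pos) auto
      finally have 1: "cmod (h z) \<le> C / R" .
      have "R / 2 \<le> cmod (z - w)" using norm_triangle_ineq2[of z w] that R by linarith
      then have "cmod (h z) / cmod (z - w) \<le> (C / R) / (R / 2)"
        using 1 R C by (intro frac_le) auto
      then show ?thesis by (simp add: F_def norm_divide power2_eq_square mult.commute)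
    qed
    have side: "cmod (contour_integral (linepath a b) F) \<le> 2 * C / R\<^sup>2 * cmod (b - a)"
      if "closed_segment a b \<subseteq> {z. Im z \<ge> 0} - {w}" "\<And>z. z \<in> closed_segment a b \<Longrightarrow> cmod z \<ge> R" for a b
      by (rule contour_integral_bound_linepath) (use ci[of a b] that C B in auto)
    have far: "cmod z \<ge> R" if "z \<in> closed_segment a2 a3 \<union> closed_segment a3 a4 \<union> closed_segment a4 a1" for z
      using that R abs_Re_le_cmod[of z] abs_Im_le_cmod[of z] unfolding seg by auto
    have "cmod (a3 - a2) = R" "cmod (a4 - a3) = 2 * R" "cmod (a1 - a4) = R"
      using R by (simp_all add: a1_def a2_def a3_def a4_def cmod_def real_sqrt_mult)
    then have "cmod (contour_integral (linepath a2 a3) F) \<le> 2 * C / R\<^sup>2 * R"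
      "cmod (contour_integral (linepath a3 a4) F) \<le> 2 * C / R\<^sup>2 * (2 * R)"
      "cmod (contour_integral (linepath a4 a1) F) \<le> 2 * C / R\<^sup>2 * R"
      using side[of a2 a3] side[of a3 a4] side[of a4 a1] far sub by auto
    then have "cmod (integral {-R..R} (\<lambda>x. F (of_real x)) - L)
        \<le> 2 * C / R\<^sup>2 * R + (2 * C / R\<^sup>2 * (2 * R) + 2 * C / R\<^sup>2 * R)"
      unfolding eq norm_minus_cancel by (intro order_trans[OF norm_triangle_ineq] add_mono) auto
    also have "\<dots> = 8 * C / R" using R by (simp add: power2_eq_square field_simps)
    finally show ?thesis .
  qed
  have "((\<lambda>R. integral {-R..R} (\<lambda>x. F (of_real x)) - L) \<longlongrightarrow> 0) at_top"
  proof (rule Lim_null_comparison)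
    show "\<forall>\<^sub>F R in at_top. cmod (integral {-R..R} (\<lambda>x. F (of_real x)) - L) \<le> 8 * C / R"
      using eventually_gt_at_top[of 0] eventually_ge_at_top[of R0] eventually_gt_at_top[of "2 * cmod w"]
      by eventually_elim (rule bound)
    show "((\<lambda>R. 8 * C / R) \<longlongrightarrow> 0) at_top" by real_asymp
  qed
  then show ?thesis unfolding F_def L_def by (rule LIM_zero_cancel)
qed

lemma interval_indicator_tendsto:
  fixes f :: "real \<Rightarrow> 'a::real_normed_vector"
  shows "(\<lambda>n::nat. indicator {- real n..real n} x *\<^sub>R f x) \<longlonglongrightarrow> f x"
proof (rule tendsto_eventually)
  have "\<forall>\<^sub>F n::nat in sequentially. \<bar>x\<bar> \<le> real n"
    using eventually_ge_at_top[of "nat \<lceil>\<bar>x\<bar>\<rceil>"] by eventually_elim linarith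
  then show "\<forall>\<^sub>F n::nat in sequentially. indicator {- real n..real n} x *\<^sub>R f x = f x"
    by eventually_elim (auto simp: indicator_def)
qed

text \<open>\<open>S\<close> will be the total mass of the boundary density \<open>p\<close>; the
  sign comes from 1/(t - z) behaving like -1/z at infinity.\<close>

locale half_plane_function =
  fixes h :: "complex \<Rightarrow> complex" and e S :: real
  assumes e: "e > 0" and holo: "h holomorphic_on {z. Im z > - e}"
    and nonneg: "\<And>x. Im (h (complex_of_real x)) \<ge> 0"
    and decay: "\<And>\<delta>. \<delta> > 0 \<Longrightarrow> \<exists>R. \<forall>z. Im z \<ge> 0 \<longrightarrow> cmod z \<ge> R \<longrightarrow> cmod (z * h z + of_real S) \<le> \<delta>"
begin

definition "p x = Im (h (complex_of_real x)) / pi"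

lemma continuous_on_real: "continuous_on A (\<lambda>x. h (complex_of_real x))"
  by (rule continuous_on_compose2[OF holomorphic_on_imp_continuous_on[OF holo]])
     (auto intro!: continuous_intros simp: e)

lemma continuous_p: "continuous_on A p"
  unfolding p_def by (intro continuous_intros continuous_on_real) auto

lemma measurable_p [measurable]: "p \<in> borel_measurable borel"
  by (rule borel_measurable_continuous_onI[OF continuous_p])

lemma p_nonneg: "p x \<ge> 0" by (simp add: p_def nonneg)

text \<open>Subtract from Cauchy's formula at w the conjugate of the vanishing integral at the
  conjugate of w: both then have the denominator x - w, and the numerators combine to h minus its
  conjugate, which is 2i Im h. Symmetric intervals are used because p is not yet known to be
  integrable.\<close>

lemma limit:
  assumes w: "Im w > 0"
  shows "(\<lambda>n::nat. LINT x:{- real n..real n}|lborel. of_real (p x) / (of_real x - w)) \<longlonglongrightarrow> h w"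
proof -
  obtain R where R: "\<And>z. Im z \<ge> 0 \<Longrightarrow> cmod z \<ge> R \<Longrightarrow> cmod (z * h z + of_real S) \<le> 1"
    using decay[of 1] by auto
  define C where "C = 1 + \<bar>S\<bar>"
  have bd: "cmod (h z) \<le> C / cmod z" if "Im z \<ge> 0" "cmod z \<ge> max R 1" for z
  proof -
    have "cmod (z * h z) \<le> C"
      using norm_triangle_ineq4[of "z * h z + of_real S" "of_real S"] R[of z] that by (simp add: C_def)
    moreover have "cmod z > 0" using that by linarith
    ultimately show ?thesis by (simp add: norm_mult field_simps)
  qed
  have C: "C \<ge> 0" by (simp add: C_def)
  have lim: "(\<lambda>n::nat. integral {- real n..real n} (\<lambda>x. h (of_real x) / (of_real x - v)))
      \<longlonglongrightarrow> (if Im v > 0 then 2 * pi * \<i> * h v else 0)" if "Im v \<noteq> 0" for v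
    using filterlim_compose[OF half_plane_cauchy[OF e holo bd C that] filterlim_real_sequentially] .
  have l1: "(\<lambda>n::nat. integral {- real n..real n} (\<lambda>x. h (of_real x) / (of_real x - w))) \<longlonglongrightarrow> 2 * pi * \<i> * h w"
    using lim[of w] w by simp
  have l2: "(\<lambda>n::nat. integral {- real n..real n} (\<lambda>x. h (of_real x) / (of_real x - cnj w))) \<longlonglongrightarrow> 0"
    using lim[of "cnj w"] w by simp
  have ne: "complex_of_real x \<noteq> w" "complex_of_real x \<noteq> cnj w" for x
    using w by (auto simp: complex_eq_iff)
  have int: "(\<lambda>x. h (of_real x) / (of_real x - w)) integrable_on {- real n..real n}"
      "(\<lambda>x. h (of_real x) / (of_real x - cnj w)) integrable_on {- real n..real n}" for n
    by (intro integrable_continuous_interval continuous_intros continuous_on_real; simp add: ne)+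
  have eq: "(LINT x:{- real n..real n}|lborel. of_real (p x) / (of_real x - w))
     = (integral {- real n..real n} (\<lambda>x. h (of_real x) / (of_real x - w))
       - cnj (integral {- real n..real n} (\<lambda>x. h (of_real x) / (of_real x - cnj w)))) / (2 * pi * \<i>)" for n
  proof -
    have "set_integrable lborel {- real n..real n} (\<lambda>x. of_real (p x) / (of_real x - w))"
      unfolding set_integrable_def
      by (intro borel_integrable_compact continuous_intros continuous_p) (auto simp: ne)
    then have "(LINT x:{- real n..real n}|lborel. of_real (p x) / (of_real x - w))
       = integral {- real n..real n} (\<lambda>x. of_real (p x) / (of_real x - w))"
      by (rule set_borel_integral_eq_integral)
    also have "\<dots> = integral {- real n..real n} (\<lambda>x. (h (of_real x) / (of_real x - w)
        - cnj (h (of_real x) / (of_real x - cnj w))) * (1 / (2 * pi * \<i>)))"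
    proof (rule Henstock_Kurzweil_Integration.integral_cong)
      fix x
      have "h (of_real x) - cnj (h (of_real x)) = 2 * \<i> * pi * of_real (p x)"
        by (simp add: p_def complex_eq_iff)
      then have "(h (of_real x) / (of_real x - w) - cnj (h (of_real x) / (of_real x - cnj w)))
          = 2 * \<i> * pi * of_real (p x) / (of_real x - w)"
        by (simp add: diff_divide_distrib[symmetric])
      then show "of_real (p x) / (of_real x - w) = (h (of_real x) / (of_real x - w)
        - cnj (h (of_real x) / (of_real x - cnj w))) * (1 / (2 * pi * \<i>))" by simp
    qed
    also have "\<dots> = (integral {- real n..real n} (\<lambda>x. h (of_real x) / (of_real x - w)
        - cnj (h (of_real x) / (of_real x - cnj w)))) * (1 / (2 * pi * \<i>))"
      by simp
    also have "\<dots> = (integral {- real n..real n} (\<lambda>x. h (of_real x) / (of_real x - w))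
       - integral {- real n..real n} (\<lambda>x. cnj (h (of_real x) / (of_real x - cnj w)))) * (1 / (2 * pi * \<i>))"
      by (subst Henstock_Kurzweil_Integration.integral_diff) (auto intro!: int integrable_on_cnj_iff[THEN iffD2] simp del: complex_cnj_divide)
    finally show ?thesis by (simp add: integral_cnj del: complex_cnj_divide)
  qed
  have "(\<lambda>n::nat. (integral {- real n..real n} (\<lambda>x. h (of_real x) / (of_real x - w))
       - cnj (integral {- real n..real n} (\<lambda>x. h (of_real x) / (of_real x - cnj w)))) / (2 * pi * \<i>))
      \<longlonglongrightarrow> (2 * pi * \<i> * h w - cnj 0) / (2 * pi * \<i>)"
    by (intro tendsto_intros l1 l2) auto
  then show ?thesis unfolding eq by simp
qed

text \<open>At w = iy the imaginary part of the kernel is positive, so the intervals can be removed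
  by monotone convergence. This is the first integrability statement about \<open>p\<close>.\<close>

lemma poisson:
  assumes y: "y > 0"
  shows "integrable lborel (\<lambda>x. p x * (y / (x\<^sup>2 + y\<^sup>2)))"
    "(LINT x|lborel. p x * (y / (x\<^sup>2 + y\<^sup>2))) = Im (h (\<i> * of_real y))"
proof -
  let ?I = "\<lambda>n::nat. {- real n..real n}"
  let ?w = "\<i> * complex_of_real y"
  have Im_eq: "Im (of_real (p x) / (of_real x - ?w)) = p x * (y / (x\<^sup>2 + y\<^sup>2))" for x
    by (simp add: Im_divide power2_eq_square)
  have ne: "complex_of_real x - ?w \<noteq> 0" for x
  proof
    assume "complex_of_real x - ?w = 0"
    then have "Im (complex_of_real x - ?w) = 0" by (simp only: zero_complex.simps)
    then show False using y by simp
  qed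
  then have ne': "complex_of_real x \<noteq> ?w" for x by simp
  have int: "integrable lborel (\<lambda>x. indicator (?I n) x *\<^sub>R (of_real (p x) / (of_real x - ?w)))" for n
    by (intro borel_integrable_compact continuous_intros continuous_p) (auto simp: ne')
  have "(\<lambda>n. LINT x|lborel. Im (indicator (?I n) x *\<^sub>R (of_real (p x) / (of_real x - ?w)))) \<longlonglongrightarrow> Im (h ?w)"
    using tendsto_Im[OF limit[of ?w]] y unfolding set_lebesgue_integral_def integral_Im[OF int] by simp
  then have lim: "(\<lambda>n. LINT x|lborel. indicator (?I n) x * (p x * (y / (x\<^sup>2 + y\<^sup>2)))) \<longlonglongrightarrow> Im (h ?w)"
    by (simp only: scaleR_complex.simps Im_eq real_scaleR_def)
  have int': "integrable lborel (\<lambda>x. indicator (?I n) x * (p x * (y / (x\<^sup>2 + y\<^sup>2))))" for n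
    using integrable_Im[OF int[of n]] by (simp only: scaleR_complex.simps Im_eq real_scaleR_def)
  have nn: "p x * (y / (x\<^sup>2 + y\<^sup>2)) \<ge> 0" for x using y p_nonneg by simp
  have mono: "AE x in lborel. mono (\<lambda>n. indicator (?I n) x * (p x * (y / (x\<^sup>2 + y\<^sup>2))))"
    using nn by (intro AE_I2 monoI mult_right_mono) (auto simp: indicator_def)
  have lim': "AE x in lborel. (\<lambda>n. indicator (?I n) x * (p x * (y / (x\<^sup>2 + y\<^sup>2)))) \<longlonglongrightarrow> p x * (y / (x\<^sup>2 + y\<^sup>2))"
    using interval_indicator_tendsto[of _ "\<lambda>x. p x * (y / (x\<^sup>2 + y\<^sup>2))"] by (intro AE_I2) simp
  have meas: "(\<lambda>x. p x * (y / (x\<^sup>2 + y\<^sup>2))) \<in> borel_measurable lborel" by measurable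
  show "integrable lborel (\<lambda>x. p x * (y / (x\<^sup>2 + y\<^sup>2)))"
    "(LINT x|lborel. p x * (y / (x\<^sup>2 + y\<^sup>2))) = Im (h (\<i> * of_real y))"
    by (rule integrable_monotone_convergence[OF int' mono lim' lim meas]
             integral_monotone_convergence[OF int' mono lim' lim meas])+
qed

lemma imaginary_axis:
  "((\<lambda>y. y * Im (h (\<i> * of_real y))) \<longlongrightarrow> S) at_top"
proof (rule tendstoI)
  fix \<delta> :: real assume "\<delta> > 0"
  then obtain R where R: "\<And>z. Im z \<ge> 0 \<Longrightarrow> cmod z \<ge> R \<Longrightarrow> cmod (z * h z + of_real S) \<le> \<delta> / 2"
    using decay[of "\<delta> / 2"] by auto
  show "\<forall>\<^sub>F y in at_top. dist (y * Im (h (\<i> * of_real y))) S < \<delta>"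
    using eventually_ge_at_top[of R] eventually_ge_at_top[of 0]
  proof eventually_elim
    case (elim y)
    then have "cmod (\<i> * of_real y * h (\<i> * of_real y) + of_real S) \<le> \<delta> / 2"
      by (intro R) (auto simp: norm_mult)
    moreover have "Re (\<i> * of_real y * h (\<i> * of_real y) + of_real S) = S - y * Im (h (\<i> * of_real y))" by simp
    ultimately have "\<bar>S - y * Im (h (\<i> * of_real y))\<bar> \<le> \<delta> / 2"
      using abs_Re_le_cmod order_trans by metis
    then have "\<bar>y * Im (h (\<i> * of_real y)) - S\<bar> \<le> \<delta> / 2" by (simp add: abs_minus_commute)
    then show ?case using \<open>\<delta> > 0\<close> by (simp add: dist_real_def)
  qed
qed

text \<open>The weights y^2/(x^2 + y^2) increase to 1 as y grows, and the weighted integrals are y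
  Im h(iy), which tend to S.\<close>

lemma total_mass: "integrable lborel p" "(LINT x|lborel. p x) = S"
proof -
  \<comment> \<open>Heights y = k + 1 keep y positive also for k = 0.\<close>
  define f where "f k x = p x * ((real k + 1)\<^sup>2 / (x\<^sup>2 + (real k + 1)\<^sup>2))" for k x
  have f: "f k = (\<lambda>x. (real k + 1) * (p x * ((real k + 1) / (x\<^sup>2 + (real k + 1)\<^sup>2))))" for k
    by (simp add: f_def power2_eq_square fun_eq_iff)
  have int: "integrable lborel (f k)" for k
    unfolding f by (intro integrable_mult_right poisson) auto
  have val: "integral\<^sup>L lborel (f k) = (real k + 1) * Im (h (\<i> * of_real (real k + 1)))" for k
    unfolding f by (subst integral_mult_right_zero, subst poisson(2)) auto
  have "filterlim (\<lambda>k. real k + 1) at_top sequentially" by real_asymp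
  from filterlim_compose[OF imaginary_axis this]
  have lim: "(\<lambda>k. integral\<^sup>L lborel (f k)) \<longlonglongrightarrow> S" unfolding val .
  have mono: "AE x in lborel. mono (\<lambda>k. f k x)"
  proof (intro AE_I2 monoI)
    fix x and i j :: nat assume "i \<le> j"
    define a b where "a = (real i + 1)\<^sup>2" and "b = (real j + 1)\<^sup>2"
    have ab: "0 < a" "a \<le> b" using \<open>i \<le> j\<close> by (auto simp: a_def b_def intro!: power_mono)
    have "x\<^sup>2 * a \<le> x\<^sup>2 * b" using ab by (intro mult_left_mono) auto
    moreover have "x\<^sup>2 + a > 0" "x\<^sup>2 + b > 0" using ab by (auto intro: add_nonneg_pos)
    ultimately have "a / (x\<^sup>2 + a) \<le> b / (x\<^sup>2 + b)"
      by (simp add: divide_simps) (simp add: algebra_simps)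
    then show "f i x \<le> f j x" unfolding f_def a_def b_def by (intro mult_left_mono p_nonneg) auto
  qed
  have lim': "AE x in lborel. (\<lambda>k. f k x) \<longlonglongrightarrow> p x"
  proof (rule AE_I2)
    fix x
    have "(\<lambda>k. (real k + 1)\<^sup>2 / (x\<^sup>2 + (real k + 1)\<^sup>2)) \<longlonglongrightarrow> 1" by real_asymp
    from tendsto_mult_left[OF this, of "p x"] show "(\<lambda>k. f k x) \<longlonglongrightarrow> p x" by (simp add: f_def)
  qed
  have meas: "p \<in> borel_measurable lborel" by measurable
  show "integrable lborel p" "(LINT x|lborel. p x) = S"
    by (rule integrable_monotone_convergence[OF int mono lim' lim meas]
             integral_monotone_convergence[OF int mono lim' lim meas])+
qed

lemma representation:
  assumes w: "Im w > 0"
  shows "(LINT x|lborel. of_real (p x) / (of_real x - w)) = h w"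
proof -
  let ?I = "\<lambda>n::nat. {- real n..real n}"
  have "(\<lambda>n. LINT x|lborel. indicator (?I n) x *\<^sub>R (of_real (p x) / (of_real x - w)))
    \<longlonglongrightarrow> (LINT x|lborel. of_real (p x) / (of_real x - w))"
  proof (rule integral_dominated_convergence[where w = "\<lambda>x. p x / Im w"])
    show "integrable lborel (\<lambda>x. p x / Im w)" using total_mass by simp
    show "AE x in lborel. (\<lambda>n. indicator (?I n) x *\<^sub>R (of_real (p x) / (of_real x - w)))
        \<longlonglongrightarrow> of_real (p x) / (of_real x - w)"
      by (intro AE_I2 interval_indicator_tendsto)
    show "AE x in lborel. norm (indicator (?I n) x *\<^sub>R (of_real (p x) / (of_real x - w))) \<le> p x / Im w" for n
    proof (rule AE_I2)
      fix x
      have "Im w \<le> cmod (of_real x - w)" using abs_Im_le_cmod[of "of_real x - w"] w by simp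
      then have "p x / cmod (of_real x - w) \<le> p x / Im w" using w p_nonneg by (intro divide_left_mono mult_pos_pos) auto
      then show "norm (indicator (?I n) x *\<^sub>R (of_real (p x) / (of_real x - w))) \<le> p x / Im w"
        using p_nonneg[of x] w by (auto simp: indicator_def norm_divide)
    qed
  qed measurable
  moreover have "(\<lambda>n. LINT x|lborel. indicator (?I n) x *\<^sub>R (of_real (p x) / (of_real x - w))) \<longlonglongrightarrow> h w"
    using limit[OF w] unfolding set_lebesgue_integral_def .
  ultimately show ?thesis by (rule LIMSEQ_unique)
qed

end

section \<open>Boundary measures\<close>

definition boundary_density :: "(complex \<Rightarrow> complex) \<Rightarrow> real \<Rightarrow> real \<Rightarrow> real" where
  "boundary_density g \<epsilon> x = Im (g (complex_of_real x + \<i> * of_real \<epsilon>)) / pi"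

definition eps :: "nat \<Rightarrow> real" where "eps n = 1 / (real n + 1)"

lemma eps: "0 < eps n" "eps n \<le> 1" "eps \<longlonglongrightarrow> 0"
proof -
  show "0 < eps n" "eps n \<le> 1" by (auto simp: eps_def)
  show "eps \<longlonglongrightarrow> 0" unfolding eps_def[abs_def] by real_asymp
qed

definition boundary_limit :: "(complex \<Rightarrow> complex) \<Rightarrow> (nat \<Rightarrow> nat) \<Rightarrow> real measure \<Rightarrow> bool" where
  "boundary_limit g r M \<longleftrightarrow> finite_measure M \<and> sets M = sets borel \<and>
     (\<forall>f :: real \<Rightarrow> complex. continuous_on UNIV f \<longrightarrow> bounded (range f) \<longrightarrow>
       (\<lambda>n. LINT x|lborel. of_real (boundary_density g (eps (r n)) x) * f x) \<longlonglongrightarrow> (LINT x|M. f x))"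

lemma boundary_limit_subseq:
  assumes "boundary_limit g r M" "strict_mono r'" shows "boundary_limit g (r \<circ> r') M"
  unfolding boundary_limit_def
proof (intro conjI allI impI)
  show "finite_measure M" "sets M = sets borel" using assms by (auto simp: boundary_limit_def)
  fix f :: "real \<Rightarrow> complex" assume "continuous_on UNIV f" "bounded (range f)"
  then have "(\<lambda>n. LINT x|lborel. of_real (boundary_density g (eps (r n)) x) * f x) \<longlonglongrightarrow> (LINT x|M. f x)"
    using assms by (simp add: boundary_limit_def)
  from LIMSEQ_subseq_LIMSEQ[OF this assms(2)]
  show "(\<lambda>n. LINT x|lborel. of_real (boundary_density g (eps ((r \<circ> r') n)) x) * f x) \<longlonglongrightarrow> (LINT x|M. f x)"
    by (simp add: o_def)
qed

locale upper_half_function =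
  fixes g :: "complex \<Rightarrow> complex" and S :: real
  assumes holo: "g holomorphic_on {z. Im z > 0}"
    and Im_nonneg: "\<And>z. Im z > 0 \<Longrightarrow> Im (g z) \<ge> 0"
    and decay: "\<And>\<epsilon> \<delta>. \<epsilon> > 0 \<Longrightarrow> \<delta> > 0 \<Longrightarrow>
      \<exists>R. \<forall>z. Im z \<ge> \<epsilon> \<longrightarrow> cmod z \<ge> R \<longrightarrow> cmod (z * g z + of_real S) \<le> \<delta>"
begin

abbreviation "dens \<equiv> boundary_density g"

text \<open>g need not have boundary values on the real line; lifting it by \<epsilon> gives a
  function holomorphic across the line. With y = z + i\<epsilon> the decay changes only by the term
  \<epsilon> g(y).\<close>

lemma shifted:
  assumes \<epsilon>: "\<epsilon> > 0"
  shows "half_plane_function (\<lambda>z. g (z + \<i> * of_real \<epsilon>)) \<epsilon> S"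
proof
  show "\<epsilon> > 0" by fact
  show "(\<lambda>z. g (z + \<i> * of_real \<epsilon>)) holomorphic_on {z. Im z > - \<epsilon>}"
    by (rule holomorphic_on_compose_gen[OF _ holo, unfolded o_def]) (auto intro!: holomorphic_intros)
  show "0 \<le> Im (g (of_real x + \<i> * of_real \<epsilon>))" for x
    by (rule Im_nonneg) (simp add: \<epsilon>)
  fix \<delta> :: real assume \<delta>: "\<delta> > 0"
  obtain R where R: "\<And>z. Im z \<ge> \<epsilon> \<Longrightarrow> cmod z \<ge> R \<Longrightarrow> cmod (z * g z + of_real S) \<le> min (\<delta> / 2) 1"
    using decay[OF \<epsilon>, of "min (\<delta> / 2) 1"] \<delta> by auto
  \<comment> \<open>Chosen so that \<bar>y\<bar> \<ge> K and \<bar>y g(y)\<bar> \<le> 1 +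
    \<bar>S\<bar> imply \<epsilon> \<bar>g(y)\<bar> \<le> \<delta>/2. The minimum with 1 above
    provides the bound on y g(y).\<close>
  define K where "K = 2 * \<epsilon> * (1 + \<bar>S\<bar>) / \<delta>"
  have K: "K > 0" using \<epsilon> \<delta> by (simp add: K_def)
  show "\<exists>R. \<forall>z. Im z \<ge> 0 \<longrightarrow> cmod z \<ge> R \<longrightarrow> cmod (z * g (z + \<i> * of_real \<epsilon>) + of_real S) \<le> \<delta>"
  proof (intro exI allI impI)
    fix z assume z: "Im z \<ge> 0" "cmod z \<ge> max R K + \<epsilon>"
    define y where "y = z + \<i> * of_real \<epsilon>"
    have "cmod y \<ge> cmod z - \<epsilon>"
      using norm_triangle_ineq2[of z "- (\<i> * of_real \<epsilon>)"] \<epsilon> by (simp add: y_def norm_mult)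
    then have y: "cmod y \<ge> R" "cmod y \<ge> K" "Im y \<ge> \<epsilon>" using z by (auto simp: y_def)
    have 1: "cmod (y * g y + of_real S) \<le> \<delta> / 2" "cmod (y * g y + of_real S) \<le> 1" using R[OF y(3,1)] by auto
    have "cmod (y * g y) \<le> 1 + \<bar>S\<bar>"
      using norm_triangle_ineq4[of "y * g y + of_real S" "of_real S"] 1(2) by simp
    then have "K * cmod (g y) \<le> 1 + \<bar>S\<bar>"
      using mult_right_mono[OF y(2), of "cmod (g y)"] by (simp add: norm_mult)
    then have "(1 + \<bar>S\<bar>) * (2 * \<epsilon> * cmod (g y) / \<delta>) \<le> (1 + \<bar>S\<bar>) * 1"
      by (simp add: K_def algebra_simps)
    then have "2 * \<epsilon> * cmod (g y) / \<delta> \<le> 1" by (subst (asm) mult_le_cancel_left_pos) auto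
    then have "\<epsilon> * cmod (g y) \<le> \<delta> / 2" using \<delta> by (simp add: field_simps)
    moreover have eq: "z * g y + of_real S = (y * g y + of_real S) - \<i> * of_real \<epsilon> * g y"
      by (simp add: y_def algebra_simps)
    moreover have "cmod (\<i> * of_real \<epsilon> * g y) = \<epsilon> * cmod (g y)" using \<epsilon> by (simp add: norm_mult)
    ultimately have "cmod (z * g y + of_real S) \<le> \<delta> / 2 + \<delta> / 2"
      using 1(1) norm_triangle_ineq4[of "y * g y + of_real S" "\<i> * of_real \<epsilon> * g y"]
      unfolding eq by linarith
    then show "cmod (z * g (z + \<i> * of_real \<epsilon>) + of_real S) \<le> \<delta>" by (simp add: y_def)
  qed
qed

lemma dens_eq: "\<epsilon> > 0 \<Longrightarrow> dens \<epsilon> = half_plane_function.p (\<lambda>z. g (z + \<i> * of_real \<epsilon>))"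
  using half_plane_function.p_def[OF shifted] by (simp add: boundary_density_def fun_eq_iff)

lemma dens:
  assumes "\<epsilon> > 0"
  shows "dens \<epsilon> x \<ge> 0" "dens \<epsilon> \<in> borel_measurable borel" "integrable lborel (dens \<epsilon>)"
    "(LINT x|lborel. dens \<epsilon> x) = S"
    "y > 0 \<Longrightarrow> integrable lborel (\<lambda>x. dens \<epsilon> x * (y / (x\<^sup>2 + y\<^sup>2)))"
    "y > 0 \<Longrightarrow> (LINT x|lborel. dens \<epsilon> x * (y / (x\<^sup>2 + y\<^sup>2))) = Im (g (\<i> * of_real (y + \<epsilon>)))"
    "Im w > 0 \<Longrightarrow> (LINT x|lborel. of_real (dens \<epsilon> x) / (of_real x - w)) = g (w + \<i> * of_real \<epsilon>)"
proof -
  interpret half_plane_function "\<lambda>z. g (z + \<i> * of_real \<epsilon>)" \<epsilon> S by (rule shifted) fact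
  show "dens \<epsilon> x \<ge> 0" "dens \<epsilon> \<in> borel_measurable borel" "integrable lborel (dens \<epsilon>)"
    "(LINT x|lborel. dens \<epsilon> x) = S"
    using p_nonneg measurable_p total_mass by (simp_all add: dens_eq assms)
  show "y > 0 \<Longrightarrow> integrable lborel (\<lambda>x. dens \<epsilon> x * (y / (x\<^sup>2 + y\<^sup>2)))"
    "y > 0 \<Longrightarrow> (LINT x|lborel. dens \<epsilon> x * (y / (x\<^sup>2 + y\<^sup>2))) = Im (g (\<i> * of_real (y + \<epsilon>)))"
    using poisson[of y] by (simp_all add: dens_eq assms distrib_left)
  show "Im w > 0 \<Longrightarrow> (LINT x|lborel. of_real (dens \<epsilon> x) / (of_real x - w)) = g (w + \<i> * of_real \<epsilon>)"
    using representation[of w] by (simp add: dens_eq assms)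
qed

lemma S_nonneg: "S \<ge> 0"
  using dens(1,4)[of 1] Bochner_Integration.integral_nonneg[of lborel "dens 1"] by simp

text \<open>The decay controls Y Im g(iY) at Y = k + \<epsilon>. Replacing the factor Y by k costs
  \<epsilon> Im g(iY), and this must be small uniformly in \<epsilon> \<le> 1.\<close>

lemma uniform_tail:
  assumes \<delta>: "\<delta> > 0"
  obtains k where "k > 0" "\<And>\<epsilon>. 0 < \<epsilon> \<Longrightarrow> \<epsilon> \<le> 1 \<Longrightarrow> k * Im (g (\<i> * of_real (k + \<epsilon>))) \<ge> S - \<delta>"
proof -
  obtain R where R: "\<And>z. Im z \<ge> 1 \<Longrightarrow> cmod z \<ge> R \<Longrightarrow> cmod (z * g z + of_real S) \<le> \<delta> / 2"
    using decay[of 1 "\<delta> / 2"] \<delta> by auto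
  \<comment> \<open>The last entry makes Im g(iY) at most \<delta>/2, since k Im g(iY) \<le> Y Im
    g(iY) \<le> S + \<delta>/2.\<close>
  define k where "k = max (max R 1) (2 * (S + \<delta> / 2) / \<delta>)"
  have k: "k \<ge> R" "k \<ge> 1" "k \<ge> 2 * (S + \<delta> / 2) / \<delta>" by (auto simp: k_def)
  show ?thesis
  proof
    show "k > 0" using k by simp
    fix \<epsilon> :: real assume \<epsilon>: "0 < \<epsilon>" "\<epsilon> \<le> 1"
    define Y where "Y = k + \<epsilon>"
    define I where "I = Im (g (\<i> * of_real Y))"
    have Y: "Y \<ge> 1" "Y \<ge> R" "Y \<ge> k" using k \<epsilon> by (auto simp: Y_def)
    then have "cmod (\<i> * of_real Y * g (\<i> * of_real Y) + of_real S) \<le> \<delta> / 2"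
      by (intro R) (auto simp: norm_mult)
    moreover have "Re (\<i> * of_real Y * g (\<i> * of_real Y) + of_real S) = S - Y * I" by (simp add: I_def)
    ultimately have YI: "\<bar>S - Y * I\<bar> \<le> \<delta> / 2" using abs_Re_le_cmod order_trans by metis
    have I: "I \<ge> 0" unfolding I_def by (rule Im_nonneg) (use Y in simp)
    have "k * I \<le> S + \<delta> / 2" using YI mult_right_mono[OF Y(3) I] by linarith
    then have "2 * (S + \<delta> / 2) / \<delta> * I \<le> S + \<delta> / 2"
      using mult_right_mono[OF k(3) I] by linarith
    moreover have "S + \<delta> / 2 > 0" using S_nonneg \<delta> by simp
    ultimately have "(S + \<delta> / 2) * (2 * I / \<delta>) \<le> (S + \<delta> / 2) * 1" by (simp add: mult_ac)
    then have "2 * I / \<delta> \<le> 1" using \<open>S + \<delta> / 2 > 0\<close> by (subst (asm) mult_le_cancel_left_pos) auto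
    then have "I \<le> \<delta> / 2" using \<delta> by (simp add: field_simps)
    then have "\<epsilon> * I \<le> \<delta> / 2" using mult_right_mono[OF \<epsilon>(2) I] by simp
    moreover have "k * I = Y * I - \<epsilon> * I" by (simp add: Y_def algebra_simps)
    ultimately show "k * Im (g (\<i> * of_real (k + \<epsilon>))) \<ge> S - \<delta>"
      using YI unfolding Y_def[symmetric] I_def[symmetric] by linarith
  qed
qed

text \<open>Tightness follows from \<open>1\<^sub>(\<^sub>-\<^sub>k\<^sub>,\<^sub>k\<^sub>](x) \<ge> 2k\<^sup>2/(x\<^sup>2 + k\<^sup>2) - 1\<close>, whose integral is a Poisson integral.\<close>

lemma tail_bound:
  assumes \<epsilon>: "\<epsilon> > 0" and k: "k > 0"
  shows "2 * (k * Im (g (\<i> * of_real (k + \<epsilon>)))) - S \<le> (LINT x|lborel. dens \<epsilon> x * indicator {-k<..k} x)"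
proof -
  have "2 * (k * Im (g (\<i> * of_real (k + \<epsilon>)))) - S =
     (LINT x|lborel. 2 * (k * (dens \<epsilon> x * (k / (x\<^sup>2 + k\<^sup>2)))) - dens \<epsilon> x)"
    by (subst Bochner_Integration.integral_diff)
       (simp_all only: integral_mult_right_zero dens[OF \<epsilon>] k integrable_mult_right)
  also have "\<dots> \<le> (LINT x|lborel. dens \<epsilon> x * indicator {-k<..k} x)"
  proof (rule integral_mono)
    show "integrable lborel (\<lambda>x. 2 * (k * (dens \<epsilon> x * (k / (x\<^sup>2 + k\<^sup>2)))) - dens \<epsilon> x)"
      by (intro Bochner_Integration.integrable_diff integrable_mult_right dens \<epsilon> k)
    show "integrable lborel (\<lambda>x. dens \<epsilon> x * indicator {-k<..k} x)"
      by (intro integrable_real_mult_indicator dens \<epsilon>) auto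
    fix x
    have q: "x\<^sup>2 + k\<^sup>2 > 0" using k by (simp add: add_nonneg_pos)
    have "2 * k\<^sup>2 / (x\<^sup>2 + k\<^sup>2) - 1 \<le> indicator {-k<..k} x"
    proof (cases "x \<in> {-k<..k}")
      case True
      have "2 * k\<^sup>2 \<le> 2 * (x\<^sup>2 + k\<^sup>2)" by simp
      then show ?thesis using True q by (simp add: field_simps)
    next
      case False
      then have "\<bar>k\<bar> \<le> \<bar>x\<bar>" using k by auto
      then have "k\<^sup>2 \<le> x\<^sup>2" by (simp add: abs_le_square_iff)
      then show ?thesis using False q by (simp add: field_simps)
    qed
    then have "dens \<epsilon> x * (2 * k\<^sup>2 / (x\<^sup>2 + k\<^sup>2) - 1) \<le> dens \<epsilon> x * indicator {-k<..k} x"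
      by (rule mult_left_mono) (rule dens(1)[OF \<epsilon>])
    then show "2 * (k * (dens \<epsilon> x * (k / (x\<^sup>2 + k\<^sup>2)))) - dens \<epsilon> x \<le> dens \<epsilon> x * indicator {-k<..k} x"
      by (simp add: power2_eq_square algebra_simps)
  qed
  finally show ?thesis .
qed

text \<open>Helly's theorem concerns probability distributions, so the densities are divided by
  their common mass S. For S = 0 they vanish almost everywhere and the zero measure is the limit.
  Starting from a given subsequence allows the selection to be repeated for finitely many
  functions.\<close>

lemma convergent_subsequence:
  assumes "strict_mono (s :: nat \<Rightarrow> nat)"
  obtains r :: "nat \<Rightarrow> nat" and M where "strict_mono r" "boundary_limit g (s \<circ> r) M"
proof (cases "S = 0")
  case True
  have zero: "(LINT x|lborel. of_real (dens (eps n) x) * f x) = 0" for f :: "real \<Rightarrow> complex" and n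
  proof -
    have "AE x in lborel. dens (eps n) x = 0"
    proof (subst integral_nonneg_eq_0_iff_AE[symmetric])
      show "integrable lborel (dens (eps n))" by (rule dens(3)[OF eps(1)])
      show "AE x in lborel. 0 \<le> dens (eps n) x" by (intro AE_I2 dens(1) eps)
      show "integral\<^sup>L lborel (dens (eps n)) = 0" unfolding True[symmetric] by (rule dens(4)[OF eps(1)])
    qed
    then have "AE x in lborel. of_real (dens (eps n) x) * f x = 0" by eventually_elim simp
    then show ?thesis by (rule integral_eq_zero_AE)
  qed
  show ?thesis
    by (rule that[of id "null_measure borel"])
       (auto simp: strict_mono_def zero boundary_limit_def intro!: finite_measureI)
next
  case False
  then have S: "S > 0" using S_nonneg by simp
  define \<mu> where "\<mu> n = density lborel (\<lambda>x. ennreal (dens (eps n) x / S))" for n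
  have dm: "dens (eps n) \<in> borel_measurable borel" for n by (rule dens) (rule eps)
  have nn: "0 \<le> dens (eps n) x / S" for n x using S dens(1)[OF eps(1)] by simp
  have int\<mu>: "(LINT x|\<mu> n. f x) = (LINT x|lborel. of_real (dens (eps n) x) * f x) / of_real S"
    if "f \<in> borel_measurable borel" for f :: "real \<Rightarrow> complex" and n
    unfolding \<mu>_def using that dm[of n] nn
    by (subst integral_density) (auto simp: scaleR_conv_of_real)
  have int\<mu>': "(LINT x|\<mu> n. f x) = (LINT x|lborel. dens (eps n) x * f x) / S"
    if "f \<in> borel_measurable borel" for f :: "real \<Rightarrow> real" and n
    unfolding \<mu>_def using that dm[of n] nn
    by (subst integral_density) auto
  have rd: "real_distribution (\<mu> n)" for n
  proof -
    have "emeasure (\<mu> n) UNIV = (\<integral>\<^sup>+ x. ennreal (dens (eps n) x / S) \<partial>lborel)"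
      using dm[of n] by (simp add: \<mu>_def emeasure_density)
    also have "\<dots> = ennreal (LINT x|lborel. dens (eps n) x / S)"
      by (rule nn_integral_eq_integral) (use dens(3)[OF eps(1)] nn in auto)
    also have "\<dots> = 1" using dens(4)[OF eps(1)] S by simp
    finally have "prob_space (\<mu> n)" by (intro prob_spaceI) (simp add: \<mu>_def)
    then show ?thesis by (auto simp: real_distribution_def real_distribution_axioms_def \<mu>_def)
  qed
  have "tight \<mu>"
    unfolding tight_def
  proof (intro conjI allI impI rd)
    fix \<eta> :: real assume \<eta>: "\<eta> > 0"
    \<comment> \<open>With the loss S \<eta>/4, \<open>tail_bound\<close> leaves mass 2 (S - S
      \<eta>/4) - S = S (1 - \<eta>/2), which is more than S (1 - \<eta>).\<close>
    obtain k where k: "k > 0" "\<And>\<epsilon>. 0 < \<epsilon> \<Longrightarrow> \<epsilon> \<le> 1 \<Longrightarrow> k * Im (g (\<i> * of_real (k + \<epsilon>))) \<ge> S - S * \<eta> / 4"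
      using uniform_tail[of "S * \<eta> / 4"] S \<eta> by auto
    have "measure (\<mu> n) {-k<..k} > 1 - \<eta>" for n
    proof -
      interpret real_distribution "\<mu> n" by (rule rd)
      have "S - S * \<eta> / 2 \<le> 2 * (k * Im (g (\<i> * of_real (k + eps n)))) - S"
        using k(2)[OF eps(1,2)[of n]] by linarith
      also have "\<dots> \<le> (LINT x|lborel. dens (eps n) x * indicator {-k<..k} x)"
        by (rule tail_bound[OF eps(1) k(1)])
      also have "\<dots> = S * (LINT x|\<mu> n. indicator {-k<..k} x)"
        using S by (subst int\<mu>') auto
      also have "(LINT x|\<mu> n. indicator {-k<..k} x) = measure (\<mu> n) {-k<..k}" by simp
      finally have "S * (1 - \<eta> / 2) \<le> S * measure (\<mu> n) {-k<..k}" by (simp add: algebra_simps)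
      then have "1 - \<eta> / 2 \<le> measure (\<mu> n) {-k<..k}" using S by simp
      then show ?thesis using \<eta> by linarith
    qed
    then show "\<exists>a b. a < b \<and> (\<forall>n. measure (\<mu> n) {a<..b} > 1 - \<eta>)"
      using k(1) by (intro exI[of _ "-k"] exI[of _ k]) auto
  qed
  then obtain r M where rM: "strict_mono r" "real_distribution M" "weak_conv_m (\<mu> \<circ> s \<circ> r) M"
    using tight_imp_convergent_subsubsequence assms by blast
  interpret M: real_distribution M by fact
  define N where "N = density M (\<lambda>_. ennreal S)"
  show ?thesis
  proof (rule that[OF rM(1)], unfold boundary_limit_def, intro conjI allI impI)
    show "sets N = sets borel" by (simp add: N_def)
    show "finite_measure N"
      by (rule finite_measureI) (simp add: N_def emeasure_density ennreal_mult_eq_top_iff M.emeasure_finite)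
    fix f :: "real \<Rightarrow> complex" assume f: "continuous_on UNIV f" "bounded (range f)"
    then have fm: "f \<in> borel_measurable borel" by (intro borel_measurable_continuous_onI)
    obtain B where B: "\<And>x. norm (f x) \<le> B" using f(2) by (auto simp: bounded_iff)
    have "\<And>x. isCont f x" using f(1) by (simp add: continuous_on_eq_continuous_at)
    have "(\<lambda>n. LINT x|(\<mu> \<circ> s \<circ> r) n. f x) \<longlonglongrightarrow> (LINT x|M. f x)"
      by (rule weak_conv_imp_integral_bdd_continuous_conv[OF _ rM(2,3) _ B])
         (use rd \<open>\<And>x. isCont f x\<close> in auto)
    then have "(\<lambda>n. (LINT x|(\<mu> \<circ> s \<circ> r) n. f x) * of_real S) \<longlonglongrightarrow> (LINT x|M. f x) * of_real S"
      by (intro tendsto_intros)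
    moreover have "(LINT x|(\<mu> \<circ> s \<circ> r) n. f x) * of_real S = (LINT x|lborel. of_real (dens (eps (s (r n))) x) * f x)" for n
      using S by (simp add: int\<mu>[OF fm])
    moreover have "(LINT x|N. f x) = (LINT x|M. f x) * of_real S"
      unfolding N_def using S fm by (subst integral_density) (auto simp: scaleR_conv_of_real mult.commute)
    ultimately show "(\<lambda>n. LINT x|lborel. of_real (dens (eps ((s \<circ> r) n)) x) * f x) \<longlonglongrightarrow> (LINT x|N. f x)"
      by simp
  qed
qed

end

lemma joint_convergent_subsequence:
  assumes "finite V" "\<And>v. v \<in> V \<Longrightarrow> upper_half_function (g v) (S v)"
  shows "\<exists>r M. strict_mono r \<and> (\<forall>v\<in>V. boundary_limit (g v) r (M v))"
  using assms
proof (induction V rule: finite_induct)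
  case empty
  show ?case by (intro exI[of _ id]) (simp add: strict_mono_def)
next
  case (insert w V)
  have "\<exists>r M. strict_mono r \<and> (\<forall>v\<in>V. boundary_limit (g v) r (M v))"
    by (rule insert.IH) (rule insert.prems, simp)
  then obtain r M where r: "strict_mono r" and M: "\<forall>v\<in>V. boundary_limit (g v) r (M v)"
    by (elim exE conjE)
  interpret upper_half_function "g w" "S w" using insert by simp
  obtain r' N where N: "strict_mono r'" "boundary_limit (g w) (r \<circ> r') N"
    using convergent_subsequence[OF r] by blast
  show ?case
  proof (intro exI conjI ballI)
    show "strict_mono (r \<circ> r')" using r N(1) by (rule strict_mono_o)
    show "boundary_limit (g v) (r \<circ> r') ((M(w := N)) v)" if "v \<in> insert w V" for v
    proof (cases "v = w")
      case False
      then have "boundary_limit (g v) r (M v)" using M that by simp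
      then show ?thesis using False boundary_limit_subseq[OF _ N(1)] by simp
    qed (use N in simp)
  qed
qed

section \<open>Integral representation of matrix Stieltjes functions\<close>

lemma finite_borel_inner_compact:
  fixes M :: "real measure"
  assumes "finite_measure M" "sets M = sets borel" "B \<in> sets borel" "\<delta> > 0"
  obtains K where "compact K" "K \<subseteq> B" "measure M B - measure M K \<le> \<delta>"
proof -
  interpret finite_measure M by fact
  show ?thesis
  proof (cases "measure M B \<le> \<delta>")
    case True
    then show ?thesis by (intro that[of "{}"]) auto
  next
    case False
    have "ennreal (measure M B - \<delta>) < emeasure M B"
      unfolding emeasure_eq_measure using False assms(4) by (intro ennreal_lessI) auto
    also have "\<dots> = (SUP K\<in>{K. K \<subseteq> B \<and> compact K}. emeasure M K)"
      by (rule inner_regular) (use assms in auto)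
    finally obtain K where K: "K \<subseteq> B" "compact K" "ennreal (measure M B - \<delta>) < emeasure M K"
      by (auto simp: less_SUP_iff)
    then have "measure M B - \<delta> < measure M K"
      using False by (simp add: emeasure_eq_measure ennreal_less_iff)
    then show ?thesis using K that by auto
  qed
qed

text \<open>The same functions serve all measures of the family: this carries positivity of the matrix
  \<open>polar\<close> builds from the family over from integrals of continuous functions to Borel sets.\<close>

lemma borel_set_continuous_approx:
  fixes M :: "'v \<Rightarrow> real measure"
  assumes "finite V" "\<And>v. v \<in> V \<Longrightarrow> finite_measure (M v)" "\<And>v. v \<in> V \<Longrightarrow> sets (M v) = sets borel"
    and B: "B \<in> sets borel"
  obtains f :: "nat \<Rightarrow> real \<Rightarrow> real" where "\<And>n. continuous_on UNIV (f n)" "\<And>n x. 0 \<le> f n x" "\<And>n x. f n x \<le> 1"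
    "\<And>v. v \<in> V \<Longrightarrow> (\<lambda>n. LINT x|M v. f n x) \<longlonglongrightarrow> measure (M v) B"
proof -
  have "\<exists>f :: real \<Rightarrow> real. continuous_on UNIV f \<and> (\<forall>x. 0 \<le> f x \<and> f x \<le> 1) \<and>
    (\<forall>v\<in>V. \<bar>(LINT x|M v. f x) - measure (M v) B\<bar> \<le> eps n)" for n
  proof -
    have "\<exists>K. compact K \<and> K \<subseteq> B' \<and> measure (M v) B' - measure (M v) K \<le> eps n / 2"
      if "v \<in> V" "B' \<in> sets borel" for v B'
      using finite_borel_inner_compact[OF assms(2,3)[OF that(1)] that(2), of "eps n / 2"] eps(1)[of n] by auto
    then obtain K where K: "\<And>v B'. v \<in> V \<Longrightarrow> B' \<in> sets borel \<Longrightarrow> compact (K v B') \<and> K v B' \<subseteq> B'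
        \<and> measure (M v) B' - measure (M v) (K v B') \<le> eps n / 2"
      by metis
    \<comment> \<open>Finite unions serve all measures at once. A function equal to 1 on
      \<open>K1\<close> and to 0 on \<open>K2\<close> differs from the indicator of B only on B
      minus \<open>K1\<close> and on the complement of B minus \<open>K2\<close>.\<close>
    define K1 K2 where "K1 = (\<Union>v\<in>V. K v B)" and "K2 = (\<Union>v\<in>V. K v (- B))"
    have B': "- B \<in> sets borel" using B by auto
    have cK: "compact K1" "compact K2" "K1 \<subseteq> B" "K2 \<subseteq> - B"
      unfolding K1_def K2_def using assms(1) K[OF _ B] K[OF _ B']
      by (blast intro: compact_UN)+
    obtain f :: "real \<Rightarrow> real" where f: "continuous_on UNIV f" "\<And>x. f x \<in> closed_segment 0 1"
       "\<And>x. x \<in> K2 \<Longrightarrow> f x = 0" "\<And>x. x \<in> K1 \<Longrightarrow> f x = 1"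
      using Urysohn[of K2 K1 "0::real" 1] cK by (metis compact_imp_closed disjoint_iff_not_equal subsetD ComplD)
    have f01: "0 \<le> f x \<and> f x \<le> 1" for x using f(2)[of x] by (simp add: closed_segment_eq_real_ivl)
    have "\<bar>(LINT x|M v. f x) - measure (M v) B\<bar> \<le> eps n" if v: "v \<in> V" for v
    proof -
      interpret finite_measure "M v" using assms(2) v .
      note sM [simp] = assms(3)[OF v]
      have sp: "space (M v) = UNIV" using sets_eq_imp_space_eq[OF sM] by simp
      have Ks: "K1 \<in> sets borel" "K2 \<in> sets borel" using cK by (simp_all add: borel_compact)
      have fm: "f \<in> borel_measurable (M v)"
        using f(1) by (simp add: measurable_cong_sets[OF sM refl] borel_measurable_continuous_onI)
      have fi: "integrable (M v) f"
        by (rule integrable_const_bound[of _ 1]) (use f01 fm in auto)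
      have ind: "integrable (M v) (indicator A :: real \<Rightarrow> real)" if "A \<in> sets borel" for A
        using that by (intro integrable_real_indicator) (auto simp: less_top[symmetric])
      have "(LINT x|M v. f x) - measure (M v) B = (LINT x|M v. f x - indicator B x)"
        using fi ind[OF B] B by (subst Bochner_Integration.integral_diff) (auto simp: sp)
      also have "\<bar>\<dots>\<bar> \<le> (LINT x|M v. \<bar>f x - indicator B x\<bar>)"
        using integral_norm_bound[of "M v" "\<lambda>x. f x - indicator B x"] by simp
      also have "\<dots> \<le> (LINT x|M v. (indicator B x - indicator K1 x) + (indicator (- B) x - indicator K2 x))"
      proof (rule integral_mono)
        show "integrable (M v) (\<lambda>x. \<bar>f x - indicator B x\<bar>)"
          by (intro integrable_abs Bochner_Integration.integrable_diff fi ind B)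
        show "integrable (M v) (\<lambda>x. (indicator B x - indicator K1 x) + (indicator (- B) x - indicator K2 x) :: real)"
          by (intro Bochner_Integration.integrable_add Bochner_Integration.integrable_diff ind B B' Ks)
        show "\<bar>f x - indicator B x\<bar> \<le> (indicator B x - indicator K1 x) + (indicator (- B) x - indicator K2 x)" for x
          using f01[of x] f(3,4)[of x] cK(3,4) by (auto simp: indicator_def)
      qed
      also have "\<dots> = (measure (M v) B - measure (M v) K1) + (measure (M v) (- B) - measure (M v) K2)"
        using ind[OF B] ind[OF B'] ind[OF Ks(1)] ind[OF Ks(2)] B B' Ks
        by (simp add: sp)
      also have "\<dots> \<le> eps n / 2 + eps n / 2"
      proof (rule add_mono)
        have "measure (M v) (K v B) \<le> measure (M v) K1" "measure (M v) (K v (- B)) \<le> measure (M v) K2"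
          using v Ks by (auto simp: K1_def K2_def intro!: finite_measure_mono)
        then show "measure (M v) B - measure (M v) K1 \<le> eps n / 2"
          "measure (M v) (- B) - measure (M v) K2 \<le> eps n / 2"
          using K[OF v B] K[OF v B'] by linarith+
      qed
      finally show ?thesis by simp
    qed
    then show ?thesis using f(1) f01 by blast
  qed
  then obtain f where f: "\<And>n. continuous_on UNIV (f n)" "\<And>n x. 0 \<le> f n x \<and> f n x \<le> (1::real)"
    "\<And>n v. v \<in> V \<Longrightarrow> \<bar>(LINT x|M v. f n x) - measure (M v) B\<bar> \<le> eps n"
    by metis
  have "(\<lambda>n. LINT x|M v. f n x) \<longlonglongrightarrow> measure (M v) B" if "v \<in> V" for v
  proof (rule LIM_zero_cancel, rule Lim_null_comparison[OF _ eps(3)])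
    show "\<forall>\<^sub>F n in sequentially. norm ((LINT x|M v. f n x) - measure (M v) B) \<le> eps n"
      using f(3)[OF that] by simp
  qed
  then show ?thesis using that[of f] f by blast
qed

lemma tendsto_qform:
  assumes "\<And>i j. ((\<lambda>n. X n $ i $ j) \<longlongrightarrow> Y $ i $ j) F"
  shows "((\<lambda>n. qform (X n) v) \<longlongrightarrow> qform Y v) F"
  unfolding qform_sum by (intro tendsto_intros assms)

lemma nonneg_herm_limit:
  assumes "\<And>i j. (\<lambda>n. X n $ i $ j) \<longlonglongrightarrow> Y $ i $ j" "\<And>n. nonneg_herm (X n)"
  shows "nonneg_herm Y"
proof (rule nonneg_hermI)
  fix v
  note lim = tendsto_qform[OF assms(1), of v]
  have "(\<lambda>n. Im (qform (X n) v)) \<longlonglongrightarrow> Im (qform Y v)" using lim by (rule tendsto_Im)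
  moreover have "Im (qform (X n) v) = 0" for n
    using nonneg_hermD(3)[OF assms(2)] by (metis Im_complex_of_real)
  ultimately have "Im (qform Y v) = 0" using LIMSEQ_unique[OF _ tendsto_const] by simp
  then show "qform Y v \<in> \<real>" by (simp add: complex_is_Real_iff)
  show "0 \<le> Re (qform Y v)"
    by (rule LIMSEQ_le_const[OF tendsto_Re[OF lim]]) (use nonneg_hermD(2)[OF assms(2)] in auto)
qed

lemma tendsto_polar:
  assumes "\<And>v. v \<in> polarisation_vectors \<Longrightarrow> ((\<lambda>n. Q n v) \<longlongrightarrow> Q' v) F"
  shows "((\<lambda>n. polar (Q n) $ i $ j) \<longlongrightarrow> polar Q' $ i $ j) F"
  using assms unfolding polar_def by (auto intro!: tendsto_intros)

text \<open>Will be instantiated with the inverse transform and S = A. The real part of the form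
  appears because \<open>S\<close> is not assumed Hermitian.\<close>

locale stieltjes_matrix_function =
  fixes \<alpha> :: real and G :: "complex \<Rightarrow> complex^'q^'q" and S :: "complex^'q^'q"
  assumes holo: "\<And>i j. (\<lambda>z. G z $ i $ j) holomorphic_on cut_plane \<alpha>"
    and Im_nonneg: "\<And>z v. Im z > 0 \<Longrightarrow> Im (qform (G z) v) \<ge> 0"
    and herm: "\<And>z. z \<in> cut_plane \<alpha> \<Longrightarrow> G (cnj z) = ctranspose (G z)"
    and decay: "\<And>\<epsilon> \<delta> v. \<epsilon> > 0 \<Longrightarrow> \<delta> > 0 \<Longrightarrow> \<exists>R. \<forall>z. Im z \<ge> \<epsilon> \<longrightarrow> cmod z \<ge> R \<longrightarrow>
      cmod (z * qform (G z) v + of_real (Re (qform S v))) \<le> \<delta>"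
begin

abbreviation g :: "complex^'q \<Rightarrow> complex \<Rightarrow> complex" where "g v z \<equiv> qform (G z) v"

lemma upper_half_subset: "{z. Im z > 0} \<subseteq> cut_plane \<alpha>"
  by (auto simp: cut_plane_def)

lemma holo_qform: "g v holomorphic_on cut_plane \<alpha>"
  unfolding qform_sum by (intro holomorphic_intros holo)

lemma upper: "upper_half_function (g v) (Re (qform S v))"
  by standard (use holomorphic_on_subset[OF holo_qform upper_half_subset] Im_nonneg decay in auto)

lemma real_on_axis: "x < \<alpha> \<Longrightarrow> Im (g v (of_real x)) = 0"
proof -
  assume "x < \<alpha>"
  then have "complex_of_real x \<in> cut_plane \<alpha>" by (auto simp: cut_plane_def)
  then have "ctranspose (G (of_real x)) = G (of_real x)" using herm by fastforce
  then have "g v (of_real x) \<in> \<real>" using hermitian_iff_real by blast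
  then show ?thesis by (simp add: complex_is_Real_iff)
qed

end

section \<open>The weak limit as a matrix measure on the half-line\<close>

locale stieltjes_limit = stieltjes_matrix_function \<alpha> G S
  for \<alpha> :: real and G :: "complex \<Rightarrow> complex^'q^'q" and S :: "complex^'q^'q" +
  fixes r :: "nat \<Rightarrow> nat" and M :: "complex^'q \<Rightarrow> real measure"
  assumes r: "strict_mono r"
    and lim: "\<And>v. v \<in> polarisation_vectors \<Longrightarrow> boundary_limit (g v) r (M v)"
begin

lemma M:
  assumes "v \<in> polarisation_vectors"
  shows "finite_measure (M v)" "sets (M v) = sets borel" "space (M v) = UNIV"
    "continuous_on UNIV f \<Longrightarrow> bounded (range f) \<Longrightarrow>
       (\<lambda>n. LINT x|lborel. of_real (boundary_density (g v) (eps (r n)) x) * f x) \<longlonglongrightarrow> (LINT x|M v. (f x :: complex))"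
  using lim[OF assms] sets_eq_imp_space_eq[of "M v" borel] by (auto simp: boundary_limit_def)

definition "\<sigma> B = polar (\<lambda>v. complex_of_real (measure (M v) B))"

definition "\<Lambda> f = polar (\<lambda>v. LINT x|M v. complex_of_real (f x))"

lemma eps_r: "(\<lambda>n. eps (r n)) \<longlonglongrightarrow> 0"
  using LIMSEQ_subseq_LIMSEQ[OF eps(3) r] by (simp add: o_def)

text \<open>Before the limit, the polarised integrals are the entries of one integral of the
  non-negative matrices \<open>P n t\<close>. This matrix is non-negative and its form gives the
  scalar integrals for every vector; both facts pass to entrywise limits.\<close>

lemma \<Lambda>_properties:
  assumes f: "continuous_on UNIV f" "\<And>x. 0 \<le> f x" "\<And>x. f x \<le> 1"
  shows "nonneg_herm (\<Lambda> f)" "v \<in> polarisation_vectors \<Longrightarrow> qform (\<Lambda> f) v = (LINT x|M v. of_real (f x))"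
proof -
  define P where "P n t = cscale (1 / of_real pi) (im_part (G (of_real t + \<i> * of_real (eps (r n)))))" for n and t :: real
  have qP: "qform (P n t) v = of_real (boundary_density (g v) (eps (r n)) t)" for n t v
    by (simp add: P_def qform_cscale qform_im_part boundary_density_def)
  define H where "H n = polar (\<lambda>v. LINT t|lborel. qform (P n t) v * of_real (f t))" for n
  have fm: "f \<in> borel_measurable borel" using f(1) by (rule borel_measurable_continuous_onI)
  have bdd: "bounded (range (\<lambda>x. complex_of_real (f x)))"
    by (rule boundedI[of _ 1]) (use f in auto)
  have int: "integrable lborel (\<lambda>t. qform (P n t) v * of_real (f t))" for n v
  proof (rule Bochner_Integration.integrable_bound)
    interpret upper_half_function "g v" "Re (qform S v)" by (rule upper)
    show "integrable lborel (dens (eps (r n)))" by (rule dens(3)[OF eps(1)])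
    show "(\<lambda>t. qform (P n t) v * of_real (f t)) \<in> borel_measurable lborel"
      unfolding qP using dens(2)[OF eps(1)] fm by measurable
    show "AE t in lborel. norm (qform (P n t) v * of_real (f t)) \<le> norm (dens (eps (r n)) t)"
      using f by (intro AE_I2) (auto simp: qP norm_mult intro!: mult_left_le)
  qed
  have H_entry: "H n $ i $ j = (LINT t|lborel. P n t $ i $ j * of_real (f t))"
    and H_int: "integrable lborel (\<lambda>t. P n t $ i $ j * of_real (f t))" for n i j
  proof -
    have eq: "polar (\<lambda>v. qform (P n t) v * of_real (f t)) $ i $ j = P n t $ i $ j * of_real (f t)" for t
      by (simp add: polar_def polarisation_entry[of "P n t" i j] algebra_simps)
    show "H n $ i $ j = (LINT t|lborel. P n t $ i $ j * of_real (f t))"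
      "integrable lborel (\<lambda>t. P n t $ i $ j * of_real (f t))"
      using integral_polar[of lborel "\<lambda>v t. qform (P n t) v * of_real (f t)" i j, OF int]
      unfolding eq H_def by auto
  qed
  have qH: "qform (H n) v = (LINT t|lborel. qform (P n t) v * of_real (f t))" for n v
  proof -
    have "(LINT t|lborel. qform (P n t) v * of_real (f t))
      = (LINT t|lborel. (\<Sum>i\<in>UNIV. \<Sum>j\<in>UNIV. cnj (v $ i) * v $ j * (P n t $ i $ j * of_real (f t))))"
      by (simp add: qform_sum sum_distrib_right mult.assoc)
    also have "\<dots> = (\<Sum>i\<in>UNIV. \<Sum>j\<in>UNIV. cnj (v $ i) * v $ j * (LINT t|lborel. P n t $ i $ j * of_real (f t)))"
      by (simp only: Bochner_Integration.integral_sum Bochner_Integration.integrable_sum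
          integrable_mult_right H_int integral_mult_right_zero)
    finally show ?thesis by (simp add: qform_sum H_entry)
  qed
  have H_lim: "(\<lambda>n. H n $ i $ j) \<longlonglongrightarrow> \<Lambda> f $ i $ j" for i j
    unfolding H_def \<Lambda>_def qP
    by (rule tendsto_polar) (rule M(4), auto intro!: continuous_intros f(1) bdd)
  have H_nn: "nonneg_herm (H n)" for n
  proof (rule nonneg_hermI)
    fix v
    interpret upper_half_function "g v" "Re (qform S v)" by (rule upper)
    have "qform (H n) v = of_real (LINT t|lborel. dens (eps (r n)) t * f t)"
      unfolding qH qP by (simp flip: of_real_mult)
    moreover have "(LINT t|lborel. dens (eps (r n)) t * f t) \<ge> 0"
      by (intro Bochner_Integration.integral_nonneg mult_nonneg_nonneg dens(1) eps f)
    ultimately show "qform (H n) v \<in> \<real>" "0 \<le> Re (qform (H n) v)" by auto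
  qed
  show "nonneg_herm (\<Lambda> f)" by (rule nonneg_herm_limit[OF H_lim H_nn])
  assume v: "v \<in> polarisation_vectors"
  have "(\<lambda>n. qform (H n) v) \<longlonglongrightarrow> (LINT x|M v. of_real (f x))"
    unfolding qH qP by (rule M(4)[OF v]) (auto intro!: continuous_intros f(1) bdd)
  then show "qform (\<Lambda> f) v = (LINT x|M v. of_real (f x))"
    using tendsto_qform[OF H_lim] by (rule LIMSEQ_unique[rotated])
qed

lemma \<sigma>_properties:
  assumes "B \<in> sets borel"
  shows "nonneg_herm (\<sigma> B)" "v \<in> polarisation_vectors \<Longrightarrow> qform (\<sigma> B) v = of_real (measure (M v) B)"
proof -
  obtain f :: "nat \<Rightarrow> real \<Rightarrow> real" where f: "\<And>n. continuous_on UNIV (f n)" "\<And>n x. 0 \<le> f n x" "\<And>n x. f n x \<le> 1"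
    "\<And>v. v \<in> polarisation_vectors \<Longrightarrow> (\<lambda>n. LINT x|M v. f n x) \<longlonglongrightarrow> measure (M v) B"
    using borel_set_continuous_approx[of polarisation_vectors M B, OF finite_polarisation_vectors M(1) M(2) assms]
    by blast
  have lim1: "(\<lambda>n. LINT x|M v. complex_of_real (f n x)) \<longlonglongrightarrow> of_real (measure (M v) B)"
    if "v \<in> polarisation_vectors" for v
    using f(4)[OF that] by (simp add: tendsto_of_real)
  have lim2: "(\<lambda>n. \<Lambda> (f n) $ i $ j) \<longlonglongrightarrow> \<sigma> B $ i $ j" for i j
    unfolding \<Lambda>_def \<sigma>_def by (rule tendsto_polar) (rule lim1)
  show "nonneg_herm (\<sigma> B)"
    by (rule nonneg_herm_limit[OF lim2]) (rule \<Lambda>_properties, rule f, rule f, rule f)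
  assume v: "v \<in> polarisation_vectors"
  have "(\<lambda>n. qform (\<Lambda> (f n)) v) \<longlonglongrightarrow> of_real (measure (M v) B)"
    using lim1[OF v] \<Lambda>_properties(2)[OF f(1-3) v] by simp
  then show "qform (\<sigma> B) v = of_real (measure (M v) B)"
    using tendsto_qform[OF lim2] by (rule LIMSEQ_unique[rotated])
qed

text \<open>Left of \<alpha> the function continues to the real axis with Hermitian values, so the
  boundary densities tend to 0 there, and boundedly so on compact sets. The limit measure therefore
  integrates a tent over the interval to 0.\<close>

lemma null_interval:
  assumes v: "v \<in> polarisation_vectors" and ab: "a < b" "b < \<alpha>"
  shows "{a<..<b} \<in> null_sets (M v)"
proof -
  interpret finite_measure "M v" by (rule M[OF v])
  interpret upper_half_function "g v" "Re (qform S v)" by (rule upper)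
  define f where "f x = max 0 (min (x - a) (b - x))" for x :: real
  have fc: "continuous_on UNIV f" unfolding f_def by (intro continuous_intros)
  have f0: "0 \<le> f x" "f x \<le> b - a" "x \<notin> {a..b} \<Longrightarrow> f x = 0" for x using ab by (auto simp: f_def)
  have bdd: "bounded (range (\<lambda>x. complex_of_real (f x)))"
    by (rule boundedI[of _ "b - a"]) (use f0 in auto)
  \<comment> \<open>All points x + i eps with x in the interval lie in this compact rectangle, as
    \<open>eps\<close> stays between 0 and 1. Its continuity bound for \<open>g v\<close> gives the
    dominating function.\<close>
  define C where "C = (\<lambda>(x, y). complex_of_real x + \<i> * of_real y) ` ({a..b} \<times> {0..1})"
  have "compact C" unfolding C_def
    by (intro compact_continuous_image) (auto intro!: continuous_intros compact_Times simp: case_prod_beta)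
  have C: "complex_of_real x + \<i> * of_real y \<in> C" if "x \<in> {a..b}" "y \<in> {0..1}" for x y
    using that by (auto simp: C_def)
  have "C \<subseteq> cut_plane \<alpha>" using ab by (auto simp: C_def cut_plane_def complex_eq_iff)
  then have cont: "continuous_on C (g v)"
    using holomorphic_on_imp_continuous_on[OF holo_qform] continuous_on_subset by blast
  then have "bounded (g v ` C)" using \<open>compact C\<close> by (intro compact_imp_bounded compact_continuous_image)
  then obtain B where B: "\<And>z. z \<in> C \<Longrightarrow> cmod (g v z) \<le> B" by (auto simp: bounded_iff)
  have fm: "f \<in> borel_measurable borel" using fc by (rule borel_measurable_continuous_onI)
  have "(\<lambda>n. LINT x|lborel. dens (eps (r n)) x * f x) \<longlonglongrightarrow> (LINT x|(lborel :: real measure). 0)"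
  proof (rule integral_dominated_convergence[where w = "\<lambda>x. indicator {a..b} x * (B / pi * (b - a))"])
    show "(\<lambda>x. dens (eps (r n)) x * f x) \<in> borel_measurable lborel" for n
      using dens(2)[OF eps(1)] fm by measurable
    show "integrable lborel (\<lambda>x. indicator {a..b} x * (B / pi * (b - a)))"
      using borel_integrable_compact[of "{a..b}" "\<lambda>_. B / pi * (b - a)"] by simp
    show "AE x in lborel. (\<lambda>n. dens (eps (r n)) x * f x) \<longlonglongrightarrow> 0"
    proof (rule AE_I2)
      fix x
      show "(\<lambda>n. dens (eps (r n)) x * f x) \<longlonglongrightarrow> 0"
      proof (cases "x \<in> {a..b}")
        case True
        have "(\<lambda>n. complex_of_real x + \<i> * of_real (eps (r n))) \<longlonglongrightarrow> of_real x + \<i> * of_real 0"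
          by (intro tendsto_intros eps_r)
        then have "(\<lambda>n. g v (complex_of_real x + \<i> * of_real (eps (r n)))) \<longlonglongrightarrow> g v (of_real x)"
        proof (intro continuous_on_tendsto_compose[OF cont])
          show "complex_of_real x \<in> C" using C[OF True, of 0] by simp
          show "\<forall>\<^sub>F n in sequentially. complex_of_real x + \<i> * of_real (eps (r n)) \<in> C"
            by (intro always_eventually allI C True) (use eps less_imp_le in auto)
        qed simp
        from tendsto_divide[OF tendsto_Im[OF this] tendsto_const[of pi]]
        have "(\<lambda>n. dens (eps (r n)) x) \<longlonglongrightarrow> Im (g v (of_real x)) / pi"
          by (simp add: boundary_density_def)
        moreover have "Im (g v (of_real x)) = 0" using real_on_axis True ab by simp
        ultimately show ?thesis using tendsto_mult_right[of "\<lambda>n. dens (eps (r n)) x" 0 _ "f x"] by simp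
      qed (simp add: f0)
    qed
    show "AE x in lborel. norm (dens (eps (r n)) x * f x) \<le> indicator {a..b} x * (B / pi * (b - a))" for n
    proof (rule AE_I2)
      fix x
      show "norm (dens (eps (r n)) x * f x) \<le> indicator {a..b} x * (B / pi * (b - a))"
      proof (cases "x \<in> {a..b}")
        case True
        have "cmod (g v (of_real x + \<i> * of_real (eps (r n)))) \<le> B" by (intro B C True) (use eps less_imp_le in auto)
        then have "\<bar>dens (eps (r n)) x\<bar> \<le> B / pi"
          using abs_Im_le_cmod[of "g v (of_real x + \<i> * of_real (eps (r n)))"]
          by (simp add: boundary_density_def abs_divide divide_right_mono)
        then have "\<bar>dens (eps (r n)) x\<bar> * \<bar>f x\<bar> \<le> B / pi * (b - a)"
          using f0(1,2)[of x] by (intro mult_mono) (auto intro: order_trans[OF abs_ge_zero])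
        then show ?thesis using True by (simp add: abs_mult)
      qed (simp add: f0)
    qed
  qed auto
  then have "(\<lambda>n. complex_of_real (LINT x|lborel. dens (eps (r n)) x * f x)) \<longlonglongrightarrow> of_real 0"
    by (intro tendsto_of_real) simp
  then have "(\<lambda>n. LINT x|lborel. of_real (dens (eps (r n)) x) * complex_of_real (f x)) \<longlonglongrightarrow> 0"
    by (simp flip: of_real_mult)
  moreover have "(\<lambda>n. LINT x|lborel. of_real (dens (eps (r n)) x) * complex_of_real (f x)) \<longlonglongrightarrow> (LINT x|M v. complex_of_real (f x))"
    by (rule M(4)[OF v _ bdd]) (intro continuous_intros fc)
  ultimately have "(LINT x|M v. complex_of_real (f x)) = 0" by (rule LIMSEQ_unique[rotated])
  then have int0: "(LINT x|M v. f x) = 0" by simp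
  have fm': "f \<in> borel_measurable (M v)" using fm by (simp add: measurable_cong_sets[OF M(2)[OF v] refl])
  have "integrable (M v) f"
    by (rule integrable_const_bound[of _ "b - a"]) (use f0 fm' in auto)
  then have "AE x in M v. f x = 0" using int0 f0(1) by (subst (asm) integral_nonneg_eq_0_iff_AE) auto
  then have "AE x in M v. x \<notin> {a<..<b}" by eventually_elim (auto simp: f_def)
  then show ?thesis using AE_iff_null_sets[of "{a<..<b}" "M v"] by (simp add: M[OF v])
qed

lemma AE_half_line:
  assumes v: "v \<in> polarisation_vectors"
  shows "AE x in M v. x \<ge> \<alpha>"
proof -
  \<comment> \<open>\<open>null_interval\<close> needs bounded intervals ending strictly below
    \<alpha>; these exhaust the open half-line.\<close>
  have "(\<Union>n. {\<alpha> - real n - 2<..<\<alpha> - 1 / (real n + 1)}) \<in> null_sets (M v)"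
  proof (intro null_sets_UN null_interval v)
    fix n :: nat
    have "1 / (real n + 1) \<le> 1" "0 < 1 / (real n + 1)" by simp_all
    then show "\<alpha> - real n - 2 < \<alpha> - 1 / (real n + 1)" "\<alpha> - 1 / (real n + 1) < \<alpha>" by linarith+
  qed
  moreover have "{..<\<alpha>} \<subseteq> (\<Union>n. {\<alpha> - real n - 2<..<\<alpha> - 1 / (real n + 1)})"
  proof
    fix x assume "x \<in> {..<\<alpha>}"
    then have d: "\<alpha> - x > 0" by simp
    define n where "n = nat \<lceil>max (\<alpha> - x) (1 / (\<alpha> - x))\<rceil>"
    have "\<alpha> - x \<le> real n" "1 / (\<alpha> - x) \<le> real n" unfolding n_def by linarith+
    moreover from this(2) have "1 < (\<alpha> - x) * (real n + 1)" using d by (simp add: field_simps)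
    then have "1 / (real n + 1) < \<alpha> - x" by (simp add: field_simps)
    ultimately have "x \<in> {\<alpha> - real n - 2<..<\<alpha> - 1 / (real n + 1)}" using d by simp
    then show "x \<in> (\<Union>n. {\<alpha> - real n - 2<..<\<alpha> - 1 / (real n + 1)})" by blast
  qed
  ultimately have "{..<\<alpha>} \<in> null_sets (M v)"
    by (elim null_sets_subset) (simp add: M[OF v])
  then have "AE x in M v. x \<notin> {..<\<alpha>}" by (subst AE_iff_null_sets[symmetric]) (simp_all add: M[OF v])
  then show ?thesis by eventually_elim simp
qed

lemma sets_half_line: "B \<in> sets (half_line \<alpha>) \<longleftrightarrow> B \<in> sets borel \<and> B \<subseteq> {\<alpha>..}"
  by (subst sets_restrict_space_iff) auto

sublocale matrix_measure "half_line \<alpha>" \<sigma>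
proof (unfold_locales, unfold nonneg_herm_measure_def, intro conjI ballI allI impI)
  show "nonneg_herm (\<sigma> B)" if "B \<in> sets (half_line \<alpha>)" for B
    using that \<sigma>_properties(1) by (simp add: sets_half_line)
  fix A :: "nat \<Rightarrow> real set" assume A: "range A \<subseteq> sets (half_line \<alpha>)" "disjoint_family A"
  have "(\<lambda>n. measure (M v) (A n)) sums measure (M v) (\<Union>n. A n)" if v: "v \<in> polarisation_vectors" for v
    by (rule finite_measure.finite_measure_UNION[OF M(1)[OF v]])
       (use A M(2)[OF v] in \<open>auto simp: sets_half_line image_subset_iff\<close>)
  then have s: "(\<lambda>n. complex_of_real (measure (M v) (A n))) sums of_real (measure (M v) (\<Union>n. A n))"
    if "v \<in> polarisation_vectors" for v using that by (simp add: sums_of_real)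
  have "(\<lambda>n. \<sigma> (A n) $ i $ j) sums \<sigma> (\<Union>n. A n) $ i $ j" for i j
    unfolding \<sigma>_def polar_def vec_lambda_beta
    by (intro sums_divide sums_add sums_diff sums_mult s polarisation_vectorsI)
  then show "(\<lambda>n. \<sigma> (A n)) sums \<sigma> (\<Union>n. A n)"
    unfolding sums_def by (intro vec_tendstoI) simp
qed

lemma scalar_measure_eq:
  assumes v: "v \<in> polarisation_vectors"
  shows "scalar_measure (half_line \<alpha>) \<sigma> v = restrict_space (M v) {\<alpha>..}"
proof (rule measure_eqI)
  interpret Mv: finite_measure "M v" by (rule M[OF v])
  show "sets (scalar_measure (half_line \<alpha>) \<sigma> v) = sets (restrict_space (M v) {\<alpha>..})"
    by (simp add: scalar_measure(1) sets_restrict_space M(2)[OF v])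
  fix B assume "B \<in> sets (scalar_measure (half_line \<alpha>) \<sigma> v)"
  then have B: "B \<in> sets (half_line \<alpha>)" "B \<in> sets borel" "B \<subseteq> {\<alpha>..}"
    by (simp_all add: scalar_measure(1) sets_half_line)
  show "emeasure (scalar_measure (half_line \<alpha>) \<sigma> v) B = emeasure (restrict_space (M v) {\<alpha>..}) B"
    using B by (subst emeasure_restrict_space)
      (auto simp: scalar_measure(4) \<sigma>_properties(2)[OF _ v] M[OF v] Mv.emeasure_eq_measure)
qed

lemma integral_scalar_measure:
  fixes f :: "real \<Rightarrow> complex"
  assumes v: "v \<in> polarisation_vectors" and f: "f \<in> borel_measurable borel"
  shows "(LINT t|scalar_measure (half_line \<alpha>) \<sigma> v. f t) = (LINT t|M v. f t)"
proof -
  have f': "f \<in> borel_measurable (M v)" using f by (simp add: measurable_cong_sets[OF M(2)[OF v] refl])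
  have "(LINT t|scalar_measure (half_line \<alpha>) \<sigma> v. f t) = (LINT t|M v. indicator {\<alpha>..} t *\<^sub>R f t)"
    unfolding scalar_measure_eq[OF v] by (rule integral_restrict_space) (simp add: M[OF v])
  also have "\<dots> = (LINT t|M v. f t)"
    by (rule integral_cong_AE) (use f' AE_half_line[OF v] M(2)[OF v] in \<open>auto elim!: eventually_mono\<close>)
  finally show ?thesis .
qed

section \<open>Cauchy integrals of the limit measure\<close>

lemma cauchy_kernel_bound:
  assumes "z \<in> cut_plane \<alpha>"
  obtains d where "d > 0" "\<And>t. t \<ge> \<alpha> \<Longrightarrow> d \<le> cmod (of_real t - z)"
proof (cases "Im z = 0")
  case True
  then have z: "z = of_real (Re z)" by (simp add: complex_eq_iff)
  then have "Re z < \<alpha>" using assms by (metis ComplD atLeast_iff cut_plane_def imageI not_le)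
  moreover have "\<alpha> - Re z \<le> cmod (of_real t - z)" if "t \<ge> \<alpha>" for t
    using complex_Re_le_cmod[of "of_real t - z"] that by simp
  ultimately show ?thesis using that[of "\<alpha> - Re z"] by auto
next
  case False
  have "\<bar>Im z\<bar> \<le> cmod (of_real t - z)" for t
    using abs_Im_le_cmod[of "of_real t - z"] by simp
  then show ?thesis using that[of "\<bar>Im z\<bar>"] False by auto
qed

lemma integrable_cauchy_kernel:
  assumes z: "z \<in> cut_plane \<alpha>"
  shows "integrable (scalar_measure (half_line \<alpha>) \<sigma> v) (\<lambda>t. 1 / (of_real t - z))"
proof -
  interpret mv: finite_measure "scalar_measure (half_line \<alpha>) \<sigma> v" by (rule scalar_measure)
  obtain d where d: "d > 0" "\<And>t. t \<ge> \<alpha> \<Longrightarrow> d \<le> cmod (of_real t - z)" using cauchy_kernel_bound[OF z] by blast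
  show ?thesis
  proof (rule mv.integrable_const_bound)
    show "AE t in scalar_measure (half_line \<alpha>) \<sigma> v. norm (1 / (of_real t - z)) \<le> 1 / d"
    proof (rule AE_I2)
      fix t assume "t \<in> space (scalar_measure (half_line \<alpha>) \<sigma> v)"
      then have "t \<ge> \<alpha>" by (simp add: scalar_measure(2) space_restrict_space)
      from d(2)[OF this] d(1) show "norm (1 / (of_real t - z)) \<le> 1 / d"
        by (simp add: norm_divide frac_le)
    qed
    show "(\<lambda>t. 1 / (of_real t - z)) \<in> borel_measurable (scalar_measure (half_line \<alpha>) \<sigma> v)"
      by (simp add: measurable_iff measurable_restrict_space1)
  qed
qed

text \<open>For non-real z the kernel is a bounded continuous test function, and its integral
  against the density at height \<epsilon> is g(z + i\<epsilon>).\<close>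

lemma integral_cauchy_kernel_upper:
  assumes v: "v \<in> polarisation_vectors" and z: "Im z > 0"
  shows "(LINT t|scalar_measure (half_line \<alpha>) \<sigma> v. 1 / (of_real t - z)) = g v z"
proof -
  interpret upper_half_function "g v" "Re (qform S v)" by (rule upper)
  have ne: "complex_of_real t \<noteq> z" for t using z by auto
  have bd: "cmod (1 / (of_real t - z)) \<le> 1 / Im z" for t
    using abs_Im_le_cmod[of "of_real t - z"] z by (simp add: norm_divide frac_le)
  have "(\<lambda>n. LINT x|lborel. of_real (dens (eps (r n)) x) * (1 / (of_real x - z))) \<longlonglongrightarrow> (LINT t|M v. 1 / (of_real t - z))"
    by (rule M(4)[OF v]) (use ne bd in \<open>auto intro!: continuous_intros boundedI\<close>)
  moreover have "(LINT x|lborel. of_real (dens (eps (r n)) x) * (1 / (of_real x - z))) = g v (z + \<i> * of_real (eps (r n)))" for n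
    using dens(7)[OF eps(1) z] by simp
  moreover have "(\<lambda>n. g v (z + \<i> * of_real (eps (r n)))) \<longlonglongrightarrow> g v z"
  proof (rule continuous_on_tendsto_compose[OF holomorphic_on_imp_continuous_on[OF holo]])
    have "(\<lambda>n. z + \<i> * of_real (eps (r n))) \<longlonglongrightarrow> z + \<i> * of_real 0" by (intro tendsto_intros eps_r)
    then show "(\<lambda>n. z + \<i> * of_real (eps (r n))) \<longlonglongrightarrow> z" by simp
    show "\<forall>\<^sub>F n in sequentially. z + \<i> * of_real (eps (r n)) \<in> {z. 0 < Im z}"
      using z eps(1) by (auto simp: add_pos_pos)
  qed (use z in simp)
  ultimately have "(LINT t|M v. 1 / (of_real t - z)) = g v z" using LIMSEQ_unique by simp
  then show ?thesis by (subst integral_scalar_measure[OF v]) auto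
qed

text \<open>The lower half-plane follows by conjugation. Points of the real axis left of \<alpha>
  are approached from above, where the kernel stays bounded on the half-line.\<close>

lemma integral_cauchy_kernel:
  assumes v: "v \<in> polarisation_vectors" and z: "z \<in> cut_plane \<alpha>"
  shows "(LINT t|scalar_measure (half_line \<alpha>) \<sigma> v. 1 / (of_real t - z)) = g v z"
proof -
  consider "Im z > 0" | "Im z < 0" | "Im z = 0" by linarith
  then show ?thesis
  proof cases
    case 1
    then show ?thesis by (rule integral_cauchy_kernel_upper[OF v])
  next
    case 2
    have c: "cnj z \<in> cut_plane \<alpha>" using 2 by (auto simp: cut_plane_def complex_eq_iff)
    have "(LINT t|scalar_measure (half_line \<alpha>) \<sigma> v. 1 / (of_real t - z))
       = (LINT t|scalar_measure (half_line \<alpha>) \<sigma> v. cnj (1 / (of_real t - cnj z)))" by simp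
    also have "\<dots> = cnj (LINT t|scalar_measure (half_line \<alpha>) \<sigma> v. 1 / (of_real t - cnj z))"
      by (rule integral_bounded_linear[OF bounded_linear_cnj integrable_cauchy_kernel[OF c]])
    also have "\<dots> = cnj (g v (cnj z))" using integral_cauchy_kernel_upper[OF v, of "cnj z"] 2 by simp
    also have "\<dots> = g v z" using herm[OF c] by (simp add: qform_ctranspose)
    finally show ?thesis .
  next
    case 3
    define x where "x = Re z"
    have zx: "z = of_real x" using 3 by (simp add: complex_eq_iff x_def)
    then have x: "x < \<alpha>" using z by (metis ComplD atLeast_iff cut_plane_def imageI not_le)
    define zn where "zn n = complex_of_real x + \<i> * of_real (eps n)" for n
    have zn: "zn \<longlonglongrightarrow> z"
      using tendsto_add[OF tendsto_const[of "complex_of_real x"] tendsto_mult[OF tendsto_const[of \<i>] tendsto_of_real[OF eps(3)]]]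
      by (simp add: zn_def[abs_def] zx)
    have zn': "Im (zn n) > 0" for n using eps(1) by (simp add: zn_def)
    interpret mv: finite_measure "scalar_measure (half_line \<alpha>) \<sigma> v" by (rule scalar_measure)
    have "(\<lambda>n. LINT t|scalar_measure (half_line \<alpha>) \<sigma> v. 1 / (of_real t - zn n))
       \<longlonglongrightarrow> (LINT t|scalar_measure (half_line \<alpha>) \<sigma> v. 1 / (of_real t - z))"
    proof (rule integral_dominated_convergence[where w = "\<lambda>_. 1 / (\<alpha> - x)"])
      have sp: "t \<ge> \<alpha>" if "t \<in> space (scalar_measure (half_line \<alpha>) \<sigma> v)" for t
        using that by (simp add: scalar_measure(2) space_restrict_space)
      show "AE t in scalar_measure (half_line \<alpha>) \<sigma> v. (\<lambda>n. 1 / (of_real t - zn n)) \<longlonglongrightarrow> 1 / (of_real t - z)"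
        by (intro AE_I2 tendsto_intros zn) (use sp x zx in force)
      show "AE t in scalar_measure (half_line \<alpha>) \<sigma> v. norm (1 / (of_real t - zn n)) \<le> 1 / (\<alpha> - x)" for n
      proof (rule AE_I2)
        fix t assume "t \<in> space (scalar_measure (half_line \<alpha>) \<sigma> v)"
        then have "\<alpha> - x \<le> cmod (of_real t - zn n)"
          using complex_Re_le_cmod[of "of_real t - zn n"] sp[of t] by (simp add: zn_def)
        then show "norm (1 / (of_real t - zn n)) \<le> 1 / (\<alpha> - x)"
          using x by (simp add: norm_divide frac_le)
      qed
    qed (auto simp: measurable_iff measurable_restrict_space1)
    moreover have "(LINT t|scalar_measure (half_line \<alpha>) \<sigma> v. 1 / (of_real t - zn n)) = g v (zn n)" for n
      by (rule integral_cauchy_kernel_upper[OF v zn'])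
    moreover have zc: "zn n \<in> cut_plane \<alpha>" for n using zn' upper_half_subset by blast
    have "(\<lambda>n. g v (zn n)) \<longlonglongrightarrow> g v z"
      by (rule continuous_on_tendsto_compose[OF holomorphic_on_imp_continuous_on[OF holo_qform] zn z])
         (use zc in simp)
    ultimately show ?thesis using LIMSEQ_unique by simp
  qed
qed

lemma stieltjes_measure: "stieltjes_measure \<alpha> G \<sigma>"
  unfolding stieltjes_measure_def
  by (intro conjI ballI nonneg_measure has_matrix_integralI integrable_cauchy_kernel integral_cauchy_kernel)
     (auto simp: measurable_restrict_space1)

end

theorem (in stieltjes_matrix_function) ex_stieltjes_measure:
  obtains \<sigma> where "stieltjes_measure \<alpha> G \<sigma>"
proof -
  obtain r M where "strict_mono r" "\<forall>v\<in>polarisation_vectors. boundary_limit (g v) r (M v)"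
    using joint_convergent_subsequence[of polarisation_vectors g "\<lambda>v. Re (qform S v)",
        OF finite_polarisation_vectors upper] by blast
  then interpret stieltjes_limit \<alpha> G S r M by unfold_locales auto
  show ?thesis using that stieltjes_measure by blast
qed

section \<open>Matrix Stieltjes transforms\<close>

lemma moore_penrose_invertible:
  fixes A :: "complex^'n^'n"
  assumes "det A \<noteq> 0"
  shows "A ** moore_penrose A = mat 1" "moore_penrose A ** A = mat 1"
proof -
  obtain B where B: "A ** B = mat 1" "B ** A = mat 1"
    using assms by (metis invertible_def invertible_det_nz)
  then have "moore_penrose A = B" by (rule moore_penrose_inverse)
  then show "A ** moore_penrose A = mat 1" "moore_penrose A ** A = mat 1" using B by auto
qed

text \<open>\<open>moore_penrose\<close> is given by a description only. Cramer's rule exhibits its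
  entries as rational functions of those of A, from which holomorphy and continuity follow.\<close>

lemma moore_penrose_cramer:
  fixes A :: "complex^'n^'n"
  assumes "det A \<noteq> 0"
  shows "moore_penrose A $ k $ l = det (\<chi> i j. if j = k then (if i = l then 1 else 0) else A $ i $ j) / det A"
proof -
  have "A *v (moore_penrose A *v axis l 1) = axis l 1"
    using moore_penrose_invertible(1)[OF assms] by (simp add: matrix_vector_mul_assoc)
  then have "moore_penrose A *v axis l 1 = (\<chi> k. det (\<chi> i j. if j = k then axis l 1 $ i else A $ i $ j) / det A)"
    using cramer[OF assms] by blast
  then have "moore_penrose A $ k $ l = det (\<chi> i j. if j = k then axis l 1 $ i else A $ i $ j) / det A"
    by (metis (no_types, lifting) matrix_axis vec_lambda_beta)
  also have "(\<chi> i j. if j = k then axis l 1 $ i else A $ i $ j)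
      = (\<chi> i j. if j = k then (if i = l then 1 else 0) else A $ i $ j)"
    by (auto simp: vec_eq_iff axis_def)
  finally show ?thesis .
qed

lemma det_nonzeroI:
  fixes A :: "complex^'n^'n"
  assumes "\<And>v. A *v v = 0 \<Longrightarrow> v = 0"
  shows "det A \<noteq> 0"
  using assms matrix_left_invertible_ker[of A] invertible_left_inverse[of A] invertible_det_nz[of A] by blast

lemma holomorphic_on_det:
  fixes A :: "complex \<Rightarrow> complex^'n^'n"
  assumes "\<And>i j. (\<lambda>z. A z $ i $ j) holomorphic_on U"
  shows "(\<lambda>z. det (A z)) holomorphic_on U"
  unfolding det_def by (intro holomorphic_intros assms)

lemma tendsto_det:
  fixes A :: "'a \<Rightarrow> complex^'n^'n"
  assumes "\<And>i j. ((\<lambda>z. A z $ i $ j) \<longlongrightarrow> L $ i $ j) F"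
  shows "((\<lambda>z. det (A z)) \<longlongrightarrow> det L) F"
  unfolding det_def by (intro tendsto_intros assms)

lemma holomorphic_on_moore_penrose:
  fixes A :: "complex \<Rightarrow> complex^'n^'n"
  assumes "\<And>i j. (\<lambda>z. A z $ i $ j) holomorphic_on U" "\<And>z. z \<in> U \<Longrightarrow> det (A z) \<noteq> 0"
  shows "(\<lambda>z. moore_penrose (A z) $ k $ l) holomorphic_on U"
proof -
  have "(\<lambda>z. det (\<chi> i j. if j = k then (if i = l then 1 else 0) else A z $ i $ j) / det (A z)) holomorphic_on U"
  proof (intro holomorphic_on_divide holomorphic_on_det assms(2))
    fix i j
    have "(\<lambda>z. if j = k then (if i = l then 1 else 0) else A z $ i $ j) holomorphic_on U"
      by (cases "j = k") (auto intro: assms(1))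
    then show "(\<lambda>z. (\<chi> i j. if j = k then (if i = l then 1 else 0) else A z $ i $ j) $ i $ j) holomorphic_on U"
      by simp
  qed (rule assms(1))
  then show ?thesis
    by (rule holomorphic_transform) (simp add: moore_penrose_cramer assms(2))
qed

lemma matrix_tendstoI:
  fixes X :: "'a \<Rightarrow> complex^'n^'m"
  shows "(\<And>i j. ((\<lambda>n. X n $ i $ j) \<longlongrightarrow> Y $ i $ j) F) \<Longrightarrow> (X \<longlongrightarrow> Y) F"
  by (intro vec_tendstoI)

lemma matrix_tendstoD:
  fixes X :: "'a \<Rightarrow> complex^'n^'m"
  shows "(X \<longlongrightarrow> Y) F \<Longrightarrow> ((\<lambda>n. X n $ i $ j) \<longlongrightarrow> Y $ i $ j) F"
  by (intro tendsto_vec_nth)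

lemma tendsto_moore_penrose:
  fixes A :: "'a \<Rightarrow> complex^'n^'n"
  assumes "(A \<longlongrightarrow> L) F" "det L \<noteq> 0" "\<And>x. det (A x) \<noteq> 0"
  shows "((\<lambda>x. moore_penrose (A x)) \<longlongrightarrow> moore_penrose L) F"
proof (rule matrix_tendstoI)
  fix k l
  have "((\<lambda>z. det (\<chi> i j. if j = k then (if i = l then 1 else 0) else A z $ i $ j) / det (A z))
    \<longlongrightarrow> det (\<chi> i j. if j = k then (if i = l then 1 else 0) else L $ i $ j) / det L) F"
    by (intro tendsto_divide tendsto_det assms(2)) (auto intro: matrix_tendstoD[OF assms(1)])
  then show "((\<lambda>x. moore_penrose (A x) $ k $ l) \<longlongrightarrow> moore_penrose L $ k $ l) F"
    by (simp add: moore_penrose_cramer assms)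
qed

lemma tendsto_matrix_mult [tendsto_intros]:
  fixes X :: "'a \<Rightarrow> complex^'n^'m" and Y :: "'a \<Rightarrow> complex^'k^'n"
  assumes "(X \<longlongrightarrow> X0) F" "(Y \<longlongrightarrow> Y0) F"
  shows "((\<lambda>n. X n ** Y n) \<longlongrightarrow> X0 ** Y0) F"
  by (rule matrix_tendstoI) (simp add: matrix_matrix_mult_def, intro tendsto_intros matrix_tendstoD assms)

lemma tendsto_matrix_qform:
  fixes X :: "'a \<Rightarrow> complex^'n^'n"
  assumes "\<And>v. ((\<lambda>n. qform (X n) v) \<longlongrightarrow> qform Y v) F"
  shows "(X \<longlongrightarrow> Y) F"
proof (rule matrix_tendstoI)
  fix i j
  have "((\<lambda>n. polar (qform (X n)) $ i $ j) \<longlongrightarrow> polar (qform Y) $ i $ j) F"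
    by (rule tendsto_polar) (rule assms)
  then show "((\<lambda>n. X n $ i $ j) \<longlongrightarrow> Y $ i $ j) F" by (simp add: polar_qform)
qed

lemma qform_scaleR: "qform (r *\<^sub>R H) v = of_real r * qform H v"
  using linear_scale[OF bounded_linear.linear[OF bounded_linear_qform]] by (simp add: scaleR_conv_of_real)

lemma qform_matrix_sum: "qform (sum f S) v = (\<Sum>i\<in>S. qform (f i) v)"
  using linear_sum[OF bounded_linear.linear[OF bounded_linear_qform]] .

lemma op_norm_le:
  fixes A :: "complex^'n^'n"
  shows "op_norm A \<le> (\<Sum>i\<in>UNIV. \<Sum>j\<in>UNIV. cmod (A $ i $ j))"
  unfolding op_norm_def
proof (rule onorm_le)
  fix x :: "complex^'n"
  have "norm (A *v x) \<le> (\<Sum>i\<in>UNIV. cmod ((A *v x) $ i))"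
    unfolding norm_vec_def by (rule L2_set_le_sum) simp
  also have "\<dots> \<le> (\<Sum>i\<in>UNIV. \<Sum>j\<in>UNIV. cmod (A $ i $ j) * norm x)"
  proof (rule sum_mono)
    fix i
    have "cmod ((A *v x) $ i) \<le> (\<Sum>j\<in>UNIV. cmod (A $ i $ j * x $ j))"
      unfolding matrix_vector_mult_def vec_lambda_beta by (rule norm_sum)
    also have "\<dots> \<le> (\<Sum>j\<in>UNIV. cmod (A $ i $ j) * norm x)"
      unfolding norm_mult by (intro sum_mono mult_left_mono Finite_Cartesian_Product.norm_nth_le norm_ge_zero)
    finally show "cmod ((A *v x) $ i) \<le> (\<Sum>j\<in>UNIV. cmod (A $ i $ j) * norm x)" .
  qed
  finally show "norm (A *v x) \<le> (\<Sum>i\<in>UNIV. \<Sum>j\<in>UNIV. cmod (A $ i $ j)) * norm x"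
    by (simp add: sum_distrib_right)
qed

lemma op_norm_nonneg: "0 \<le> op_norm (A :: complex^'n^'n)"
  unfolding op_norm_def
  by (rule onorm_pos_le) (simp add: linear_conv_bounded_linear[symmetric] matrix_vector_mul_linear)

lemma cut_plane_cnj: "z \<in> cut_plane \<alpha> \<Longrightarrow> cnj z \<in> cut_plane \<alpha>"
  unfolding cut_plane_def by (metis ComplI ComplD complex_cnj_cnj complex_cnj_complex_of_real image_iff)

lemma cut_plane_real: "of_real x \<in> cut_plane \<alpha> \<longleftrightarrow> x < \<alpha>"
  by (auto simp: cut_plane_def)

section \<open>Stieltjes transforms of a matrix measure\<close>

locale stieltjes_transform = matrix_measure "half_line \<alpha>" \<sigma>
  for \<alpha> :: real and \<sigma> :: "real set \<Rightarrow> complex^'q^'q" +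
  fixes F :: "complex \<Rightarrow> complex^'q^'q"
  assumes F: "\<And>z. z \<in> cut_plane \<alpha> \<Longrightarrow> has_matrix_integral (half_line \<alpha>) \<sigma> (\<lambda>t. 1 / (of_real t - z)) (F z)"

lemma stieltjes_measure_iff: "stieltjes_measure \<alpha> F \<sigma> \<longleftrightarrow> stieltjes_transform \<alpha> \<sigma> F"
  by (simp add: stieltjes_measure_def stieltjes_transform_def matrix_measure_def stieltjes_transform_axioms_def
      Ball_def)

context stieltjes_transform
begin

lemma space_\<mu>: "space (\<mu> v) = {\<alpha>..}"
  by (simp add: scalar_measure space_restrict_space)

lemma half_line_measure: "half_line_measure (\<mu> v) \<alpha>"
  by (simp add: half_line_measure_def half_line_measure_axioms_def scalar_measure)

lemma kernel:
  assumes "z \<in> cut_plane \<alpha>"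
  shows "integrable (\<mu> v) (\<lambda>t. 1 / (of_real t - z))" "(LINT t|\<mu> v. 1 / (of_real t - z)) = qform (F z) v"
  using has_matrix_integralD[OF F[OF assms]] by auto

lemma F_cnj:
  assumes "z \<in> cut_plane \<alpha>"
  shows "F (cnj z) = ctranspose (F z)"
proof (rule qform_ext)
  fix v
  have "qform (F (cnj z)) v = (LINT t|\<mu> v. cnj (1 / (of_real t - z)))"
    using kernel[OF cut_plane_cnj[OF assms], of v] by simp
  also have "\<dots> = cnj (qform (F z) v)"
    using integral_bounded_linear[OF bounded_linear_cnj kernel(1)[OF assms]] kernel(2)[OF assms] by metis
  finally show "qform (F (cnj z)) v = qform (ctranspose (F z)) v" by (simp add: qform_ctranspose)
qed

lemma qform_real:
  assumes "x < \<alpha>"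
  shows "qform (F (of_real x)) v = of_real (LINT t|\<mu> v. 1 / (t - x))" "0 \<le> (LINT t|\<mu> v. 1 / (t - x))"
proof -
  have "qform (F (of_real x)) v = (LINT t|\<mu> v. 1 / (of_real t - of_real x))"
    using kernel(2)[of "of_real x" v] assms by (simp add: cut_plane_real)
  also have "\<dots> = (LINT t|\<mu> v. complex_of_real (1 / (t - x)))" by simp
  also have "\<dots> = of_real (LINT t|\<mu> v. 1 / (t - x))" by (rule integral_complex_of_real)
  finally show "qform (F (of_real x)) v = of_real (LINT t|\<mu> v. 1 / (t - x))" .
  show "0 \<le> (LINT t|\<mu> v. 1 / (t - x))"
    by (rule integral_nonneg_AE) (use assms in \<open>auto simp: space_\<mu> intro!: AE_I2\<close>)
qed

text \<open>The second inequality uses the half-line: Im ((z - \<alpha>)/(t - z)) is (t - \<alpha>)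
  Im z divided by the squared distance of t and z, and t \<ge> \<alpha>. It drives both the
  invertibility of \<open>Q\<close> and the positivity of \<open>G\<close>.\<close>

lemma Im_qform:
  assumes z: "Im z > 0"
  shows "0 \<le> Im (qform (F z) v)" "0 \<le> Im ((z - of_real \<alpha>) * qform (F z) v)"
proof -
  have zc: "z \<in> cut_plane \<alpha>" using z by (auto simp: cut_plane_def)
  note k = kernel[OF zc, of v]
  have Im_k: "Im (1 / (of_real t - z)) = Im z / ((t - Re z)\<^sup>2 + (Im z)\<^sup>2)" for t
    by (simp add: Im_divide)
  have "Im (qform (F z) v) = (LINT t|\<mu> v. Im (1 / (of_real t - z)))"
    using integral_Im[OF k(1)] k(2) by simp
  also have "\<dots> \<ge> 0" unfolding Im_k using z by (intro Bochner_Integration.integral_nonneg) auto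
  finally show "0 \<le> Im (qform (F z) v)" .
  have Im_k': "Im ((z - of_real \<alpha>) * (1 / (of_real t - z))) = (t - \<alpha>) * Im z / ((t - Re z)\<^sup>2 + (Im z)\<^sup>2)" for t
    by (simp add: Im_divide Re_divide) (simp add: field_simps add_divide_distrib[symmetric])
  have "Im ((z - of_real \<alpha>) * qform (F z) v) = (LINT t|\<mu> v. Im ((z - of_real \<alpha>) * (1 / (of_real t - z))))"
    by (simp only: integral_Im[OF integrable_mult_right[OF k(1)]] integral_mult_right_zero k(2))
  also have "\<dots> \<ge> 0" unfolding Im_k' using z
    by (intro integral_nonneg_AE AE_I2) (auto simp: space_\<mu>)
  finally show "0 \<le> Im ((z - of_real \<alpha>) * qform (F z) v)" .
qed

lemma F_null:
  assumes 0: "measure (\<mu> v) {\<alpha>..} = 0" and z: "z \<in> cut_plane \<alpha>"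
  shows "F z *v v = 0"
proof -
  have sv: "\<sigma> B *v v = 0" if B: "B \<in> sets (half_line \<alpha>)" for B
  proof -
    interpret finite_measure "\<mu> v" by (rule scalar_measure)
    have "measure (\<mu> v) B \<le> measure (\<mu> v) (space (\<mu> v))" by (rule bounded_measure)
    then have "measure (\<mu> v) B = 0" using 0 measure_nonneg[of "\<mu> v" B] by (simp add: space_\<mu>)
    then have "qform (\<sigma> B) v = 0"
      using nonneg_hermD(3)[OF nonneg[OF B], of v] by (simp add: scalar_measure(5)[OF B])
    then show ?thesis using nonneg_herm_null[OF nonneg[OF B]] by blast
  qed
  have eq: "qform (F z) (w + c *s v) = qform (F z) w" for w c
  proof -
    have "\<mu> (w + c *s v) = \<mu> w"
    proof (rule measure_eqI)
      fix B assume "B \<in> sets (\<mu> (w + c *s v))"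
      then have B: "B \<in> sets (half_line \<alpha>)" by (simp add: scalar_measure)
      have h: "ctranspose (\<sigma> B) = \<sigma> B" using nonneg[OF B] by (simp add: nonneg_herm_iff)
      have "cdot v (\<sigma> B *v w) = cdot (\<sigma> B *v v) w" by (simp add: cdot_mult_left h)
      then have "qform (\<sigma> B) (w + c *s v) = qform (\<sigma> B) w"
        by (simp add: qform_def cdot_simps matrix_vector_right_distrib matrix_smult_right sv[OF B])
      then show "emeasure (\<mu> (w + c *s v)) B = emeasure (\<mu> w) B" by (simp add: scalar_measure(4)[OF B])
    qed (simp add: scalar_measure)
    then show ?thesis using kernel(2)[OF z] by metis
  qed
  have "cdot w (F z *v v) = 0" for w
  proof -
    have "w + v = w + 1 *s v" "w - v = w + (-1) *s v" "w - \<i> *s v = w + (- \<i>) *s v" by simp_all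
    then show ?thesis unfolding polarisation[of w "F z" v] by (simp only: eq) simp
  qed
  then show ?thesis using cdot_self_eq_0 by blast
qed

text \<open>A common distance d from the half-line gives the dominating constant 1/d. It covers both
  limits needed later: real points tending to minus infinity, and points of a half-plane Im z \<ge>
  \<epsilon>.\<close>

lemma F_tendsto_0:
  assumes z: "\<And>n. z n \<in> cut_plane \<alpha>" "filterlim (\<lambda>n. cmod (z n)) at_top sequentially"
    and d: "d > 0" "\<And>n t. t \<ge> \<alpha> \<Longrightarrow> d \<le> cmod (of_real t - z n)"
  shows "(\<lambda>n. F (z n)) \<longlonglongrightarrow> 0"
proof (rule tendsto_matrix_qform)
  fix v
  interpret m: finite_measure "\<mu> v" by (rule scalar_measure)
  have "(\<lambda>n. LINT t|\<mu> v. 1 / (of_real t - z n)) \<longlonglongrightarrow> (LINT t|\<mu> v. 0)"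
  proof (rule integral_dominated_convergence[where w = "\<lambda>_. 1 / d"])
    show "AE t in \<mu> v. (\<lambda>n. 1 / (of_real t - z n)) \<longlonglongrightarrow> 0"
    proof (rule AE_I2)
      fix t
      have "filterlim (\<lambda>n. - \<bar>t\<bar> + cmod (z n)) at_top sequentially"
        by (rule filterlim_tendsto_add_at_top[OF tendsto_const z(2)])
      then have "filterlim (\<lambda>n. cmod (of_real t - z n)) at_top sequentially"
      proof (rule filterlim_at_top_mono)
        show "\<forall>\<^sub>F n in sequentially. - \<bar>t\<bar> + cmod (z n) \<le> cmod (of_real t - z n)"
        proof (intro always_eventually allI)
          fix n show "- \<bar>t\<bar> + cmod (z n) \<le> cmod (of_real t - z n)"
            using norm_triangle_ineq2[of "z n" "of_real t"] by (simp add: norm_minus_commute)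
        qed
      qed
      then have "filterlim (\<lambda>n. of_real t - z n) at_infinity sequentially"
        by (rule filterlim_norm_at_top_imp_at_infinity)
      then show "(\<lambda>n. 1 / (of_real t - z n)) \<longlonglongrightarrow> 0"
        by (rule tendsto_divide_0[OF tendsto_const])
    qed
    show "AE t in \<mu> v. norm (1 / (of_real t - z n)) \<le> 1 / d" for n
    proof (rule AE_I2)
      fix t assume "t \<in> space (\<mu> v)"
      then show "norm (1 / (of_real t - z n)) \<le> 1 / d"
        using d(1) d(2)[of t n] by (simp add: space_\<mu> norm_divide frac_le)
    qed
  qed (auto simp: measurable_iff measurable_restrict_space1)
  then show "(\<lambda>n. qform (F (z n)) v) \<longlonglongrightarrow> qform 0 v" by (simp add: kernel(2)[OF z(1)])
qed

text \<open>On the imaginary axis the kernel is at most 1/y, so each form of y F(iy) is bounded by a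
  total mass. This is the growth condition of \<open>S0_class\<close>.\<close>

lemma bounded_growth: "bdd_above ((\<lambda>y::real. y * op_norm (F (\<i> * complex_of_real y))) ` {1..})"
proof -
  have q: "y * cmod (qform (F (\<i> * of_real y)) v) \<le> measure (\<mu> v) {\<alpha>..}" if "y \<ge> 1" for y v
  proof -
    interpret m: finite_measure "\<mu> v" by (rule scalar_measure)
    have zc: "\<i> * of_real y \<in> cut_plane \<alpha>" using that by (auto simp: cut_plane_def complex_eq_iff)
    have "cmod (qform (F (\<i> * of_real y)) v) \<le> (LINT t|\<mu> v. cmod (1 / (of_real t - \<i> * of_real y)))"
      unfolding kernel(2)[OF zc, symmetric] by (rule integral_norm_bound)
    also have "\<dots> \<le> (LINT t|\<mu> v. 1 / y)"
    proof (rule integral_mono)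
      show "integrable (\<mu> v) (\<lambda>t. cmod (1 / (of_real t - \<i> * of_real y)))"
        using kernel(1)[OF zc] by (rule integrable_norm)
      fix t
      have "y \<le> cmod (of_real t - \<i> * of_real y)"
        using abs_Im_le_cmod[of "of_real t - \<i> * of_real y"] that by simp
      then show "cmod (1 / (of_real t - \<i> * of_real y)) \<le> 1 / y" using that by (simp add: norm_divide frac_le)
    qed simp
    also have "\<dots> = measure (\<mu> v) {\<alpha>..} / y" by (simp add: space_\<mu>)
    finally show ?thesis using that by (simp add: field_simps)
  qed
  define m where "m v = measure (\<mu> v) {\<alpha>..}" for v
  have entry: "y * cmod (F (\<i> * of_real y) $ i $ j) \<le> (m (axis i 1 + axis j 1) + m (axis i 1 - axis j 1)
     + m (axis i 1 + \<i> *s axis j 1) + m (axis i 1 - \<i> *s axis j 1)) / 4" (is "_ \<le> ?m i j") if "y \<ge> 1" for y i j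
  proof -
    have tri: "cmod (a - b - \<i> * c + \<i> * d) \<le> cmod a + cmod b + cmod c + cmod d" for a b c d
      using norm_triangle_ineq[of "a - b - \<i> * c" "\<i> * d"] norm_triangle_ineq4[of "a - b" "\<i> * c"]
        norm_triangle_ineq4[of a b] by (simp add: norm_mult)
    let ?q = "\<lambda>v. cmod (qform (F (\<i> * of_real y)) v)"
    have "y * cmod (F (\<i> * of_real y) $ i $ j) \<le> y * ((?q (axis i 1 + axis j 1) + ?q (axis i 1 - axis j 1)
     + ?q (axis i 1 + \<i> *s axis j 1) + ?q (axis i 1 - \<i> *s axis j 1)) / 4)"
      using that tri unfolding polarisation_entry[of "F (\<i> * of_real y)" i j]
      by (intro mult_left_mono) (auto simp: norm_divide intro!: divide_right_mono)
    also have "\<dots> \<le> ?m i j"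
      using q[OF that, of "axis i 1 + axis j 1"] q[OF that, of "axis i 1 - axis j 1"]
        q[OF that, of "axis i 1 + \<i> *s axis j 1"] q[OF that, of "axis i 1 - \<i> *s axis j 1"]
      by (simp add: m_def distrib_left)
    finally show ?thesis .
  qed
  show ?thesis
  proof (rule bdd_aboveI2)
    fix y :: real assume "y \<in> {1..}"
    then have y: "y \<ge> 1" by simp
    have "y * op_norm (F (\<i> * of_real y)) \<le> y * (\<Sum>i\<in>UNIV. \<Sum>j\<in>UNIV. cmod (F (\<i> * of_real y) $ i $ j))"
      using y by (intro mult_left_mono op_norm_le) auto
    also have "\<dots> \<le> (\<Sum>i\<in>UNIV. \<Sum>j\<in>UNIV. (m (axis i 1 + axis j 1) + m (axis i 1 - axis j 1)
     + m (axis i 1 + \<i> *s axis j 1) + m (axis i 1 - \<i> *s axis j 1)) / 4)"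
      unfolding sum_distrib_left by (intro sum_mono entry y)
    finally show "y * op_norm (F (\<i> * of_real y)) \<le> (\<Sum>i\<in>UNIV. \<Sum>j\<in>UNIV. (m (axis i 1 + axis j 1) + m (axis i 1 - axis j 1)
     + m (axis i 1 + \<i> *s axis j 1) + m (axis i 1 - \<i> *s axis j 1)) / 4)" .
  qed
qed

section \<open>Moments and expansions of matrix transforms\<close>

lemma moment_iff:
  "has_moment \<alpha> \<sigma> j J \<longleftrightarrow> (\<forall>v. integrable (\<mu> v) (\<lambda>t. t ^ j) \<and> qform J v = of_real (LINT t|\<mu> v. t ^ j))"
proof -
  have m: "(\<lambda>t. complex_of_real (t ^ j)) \<in> borel_measurable (half_line \<alpha>)"
    by (rule measurable_restrict_space1) simp
  have "integrable (\<mu> v) (\<lambda>t. complex_of_real (t ^ j)) \<longleftrightarrow> integrable (\<mu> v) (\<lambda>t. t ^ j)" for v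
    using integrable_Re[of "\<mu> v" "\<lambda>t. complex_of_real (t ^ j)"] integrable_of_real[of "\<mu> v" "\<lambda>t. t ^ j"] by auto
  moreover have "(LINT t|\<mu> v. complex_of_real (t ^ j)) = of_real (LINT t|\<mu> v. t ^ j)" for v
    by (rule integral_complex_of_real)
  ultimately have iff: "(integrable (\<mu> v) (\<lambda>t. t ^ j) \<and> qform J v = of_real (LINT t|\<mu> v. t ^ j)) \<longleftrightarrow>
     integrable (\<mu> v) (\<lambda>t. complex_of_real (t ^ j)) \<and> (LINT t|\<mu> v. complex_of_real (t ^ j)) = qform J v" for v
    by auto
  show ?thesis
    unfolding has_moment_def iff
  proof (intro iffI allI)
    assume "has_matrix_integral (half_line \<alpha>) \<sigma> (\<lambda>t. complex_of_real (t ^ j)) J"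
    from has_matrix_integralD[OF this]
    show "integrable (\<mu> v) (\<lambda>t. complex_of_real (t ^ j)) \<and> (LINT t|\<mu> v. complex_of_real (t ^ j)) = qform J v" for v
      by blast
  next
    assume "\<forall>v. integrable (\<mu> v) (\<lambda>t. complex_of_real (t ^ j)) \<and> (LINT t|\<mu> v. complex_of_real (t ^ j)) = qform J v"
    then show "has_matrix_integral (half_line \<alpha>) \<sigma> (\<lambda>t. complex_of_real (t ^ j)) J"
      by (intro has_matrix_integralI m) auto
  qed
qed

lemma moments_expansion:
  assumes "\<And>j. j \<le> n \<Longrightarrow> has_moment \<alpha> \<sigma> j (c j)"
  defines "x \<equiv> \<lambda>k. - real k"
  shows "(\<lambda>k. x k ^ Suc n *\<^sub>R (F (of_real (x k)) + (\<Sum>j\<le>n. (1 / x k ^ Suc j) *\<^sub>R c j))) \<longlonglongrightarrow> 0"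
proof (rule tendsto_matrix_qform)
  fix v
  interpret half_line_measure "\<mu> v" \<alpha> by (rule half_line_measure)
  have c: "integrable (\<mu> v) (\<lambda>t. t ^ j)" "qform (c j) v = of_real (LINT t|\<mu> v. t ^ j)" if "j \<le> n" for j
    using assms(1)[OF that] moment_iff by auto
  have "(\<lambda>k. complex_of_real (x k ^ Suc n * ((LINT t|\<mu> v. 1 / (t - x k)) + (\<Sum>j\<le>n. (LINT t|\<mu> v. t ^ j) / x k ^ Suc j))))
     \<longlonglongrightarrow> of_real 0"
    unfolding x_def by (intro tendsto_of_real moment_expansion c) simp
  moreover have "\<forall>\<^sub>F k in sequentially. complex_of_real (x k ^ Suc n * ((LINT t|\<mu> v. 1 / (t - x k)) + (\<Sum>j\<le>n. (LINT t|\<mu> v. t ^ j) / x k ^ Suc j)))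
     = qform (x k ^ Suc n *\<^sub>R (F (of_real (x k)) + (\<Sum>j\<le>n. (1 / x k ^ Suc j) *\<^sub>R c j))) v"
    using eventually_gt_at_top[of "nat \<lceil>\<bar>\<alpha>\<bar>\<rceil>"]
  proof eventually_elim
    case (elim k)
    then have "x k < \<alpha>" unfolding x_def by linarith
    then have "qform (F (of_real (x k))) v = of_real (LINT t|\<mu> v. 1 / (t - x k))" by (rule qform_real)
    moreover have "(\<Sum>j\<le>n. complex_of_real (1 / x k ^ Suc j) * qform (c j) v)
      = (\<Sum>j\<le>n. of_real ((LINT t|\<mu> v. t ^ j) / x k ^ Suc j))"
      by (intro sum.cong) (auto simp: c)
    ultimately show ?case
      by (simp only: qform_scaleR qform_add qform_matrix_sum of_real_mult of_real_add of_real_sum)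
  qed
  ultimately show "(\<lambda>k. qform (x k ^ Suc n *\<^sub>R (F (of_real (x k)) + (\<Sum>j\<le>n. (1 / x k ^ Suc j) *\<^sub>R c j))) v)
    \<longlonglongrightarrow> qform 0 v"
    by (simp add: tendsto_cong)
qed

lemma expansion_moments:
  assumes herm: "\<And>j. j \<le> n \<Longrightarrow> ctranspose (c j) = c j"
  defines "x \<equiv> \<lambda>k. - real k"
  assumes lim: "(\<lambda>k. x k ^ Suc n *\<^sub>R (F (of_real (x k)) + (\<Sum>j\<le>n. (1 / x k ^ Suc j) *\<^sub>R c j))) \<longlonglongrightarrow> 0"
    and j: "j \<le> n"
  shows "has_moment \<alpha> \<sigma> j (c j)"
  unfolding moment_iff
proof
  fix v
  interpret half_line_measure "\<mu> v" \<alpha> by (rule half_line_measure)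
  have c: "qform (c j) v = of_real (Re (qform (c j) v))" if "j \<le> n" for j
    using herm[OF that] hermitian_iff_real[of "c j"] by simp
  have "(\<lambda>k. Re (qform (x k ^ Suc n *\<^sub>R (F (of_real (x k)) + (\<Sum>j\<le>n. (1 / x k ^ Suc j) *\<^sub>R c j))) v)) \<longlonglongrightarrow> Re (qform 0 v)"
    by (intro tendsto_Re tendsto_qform matrix_tendstoD lim)
  moreover have "\<forall>\<^sub>F k in sequentially. Re (qform (x k ^ Suc n *\<^sub>R (F (of_real (x k)) + (\<Sum>j\<le>n. (1 / x k ^ Suc j) *\<^sub>R c j))) v)
     = x k ^ Suc n * ((LINT t|\<mu> v. 1 / (t - x k)) + (\<Sum>j\<le>n. Re (qform (c j) v) / x k ^ Suc j))"
    using eventually_gt_at_top[of "nat \<lceil>\<bar>\<alpha>\<bar>\<rceil>"]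
  proof eventually_elim
    case (elim k)
    then have "x k < \<alpha>" unfolding x_def by linarith
    then have 1: "qform (F (of_real (x k))) v = of_real (LINT t|\<mu> v. 1 / (t - x k))" by (rule qform_real)
    have "(\<Sum>j\<le>n. complex_of_real (1 / x k ^ Suc j) * qform (c j) v)
      = (\<Sum>j\<le>n. of_real (Re (qform (c j) v) / x k ^ Suc j))"
      by (intro sum.cong refl) (subst c, auto)
    then have "qform (x k ^ Suc n *\<^sub>R (F (of_real (x k)) + (\<Sum>j\<le>n. (1 / x k ^ Suc j) *\<^sub>R c j))) v
       = of_real (x k ^ Suc n * ((LINT t|\<mu> v. 1 / (t - x k)) + (\<Sum>j\<le>n. Re (qform (c j) v) / x k ^ Suc j)))"
      by (simp only: qform_scaleR qform_add qform_matrix_sum 1 of_real_mult of_real_add of_real_sum)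
    then show ?case by (simp only: Re_complex_of_real)
  qed
  ultimately have "(\<lambda>k. x k ^ Suc n * ((LINT t|\<mu> v. 1 / (t - x k)) + (\<Sum>j\<le>n. Re (qform (c j) v) / x k ^ Suc j))) \<longlonglongrightarrow> 0"
    by (simp add: tendsto_cong)
  from moments_from_expansion[OF this[unfolded x_def] j]
  show "integrable (\<mu> v) (\<lambda>t. t ^ j) \<and> qform (c j) v = of_real (LINT t|\<mu> v. t ^ j)"
    using c[OF j] by simp
qed

end

section \<open>The inverse transform of functions\<close>

lemma matrix_vector_mult_minus:
  "(A :: complex^'n^'m) *v (- v) = - (A *v v)" "(- A) *v v = - (A *v v)"
  by (simp_all add: matrix_vector_mult_def vec_eq_iff sum_negf)

text \<open>The convolution identities settle all products with i + j \<le> m. The remaining pairs,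
  collected in \<open>T\<close>, carry at least one more power of 1/x than the factor x^m can
  compensate.\<close>

lemma truncated_product_limit:
  fixes a b :: "nat \<Rightarrow> complex^'q^'q"
  assumes conv: "\<And>k. k \<le> m \<Longrightarrow> (\<Sum>i\<le>k. a i ** b (k - i)) = (if k = 0 then C else 0)"
    and x: "\<And>k :: nat. x k \<noteq> (0::real)" "(\<lambda>k. 1 / x k) \<longlonglongrightarrow> 0"
  shows "(\<lambda>k. x k ^ m *\<^sub>R ((\<Sum>i\<le>m. (1 / x k) ^ i *\<^sub>R a i) ** (\<Sum>j\<le>m. (1 / x k) ^ j *\<^sub>R b j) - C)) \<longlonglongrightarrow> 0"
proof -
  define T where "T = {..m} \<times> {..m} - {(i, j). i + j \<le> m}"
  have fin: "finite T" by (simp add: T_def)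
  have eq: "(\<Sum>i\<le>m. w ^ i *\<^sub>R a i) ** (\<Sum>j\<le>m. w ^ j *\<^sub>R b j)
      = C + (\<Sum>(i, j)\<in>T. w ^ (i + j) *\<^sub>R (a i ** b j))" for w :: real
  proof -
    have sub: "{(i, j). i + j \<le> m} \<subseteq> {..m} \<times> {..m}" by auto
    have "(\<Sum>i\<le>m. w ^ i *\<^sub>R a i) ** (\<Sum>j\<le>m. w ^ j *\<^sub>R b j)
      = (\<Sum>(i, j)\<in>{..m} \<times> {..m}. w ^ (i + j) *\<^sub>R (a i ** b j))"
      by (subst matrix_mult_sum_left)
         (simp add: matrix_mult_sum_right matrix_mult_scaleR power_add scaleR_sum_right sum.cartesian_product
           case_prod_beta mult.commute)
    also have "\<dots> = (\<Sum>(i, j)\<in>T. w ^ (i + j) *\<^sub>R (a i ** b j))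
       + (\<Sum>(i, j)\<in>{(i, j). i + j \<le> m}. w ^ (i + j) *\<^sub>R (a i ** b j))"
      unfolding T_def by (rule sum.subset_diff[OF sub]) simp
    also have "(\<Sum>(i, j)\<in>{(i, j). i + j \<le> m}. w ^ (i + j) *\<^sub>R (a i ** b j))
       = (\<Sum>k\<le>m. \<Sum>i\<le>k. w ^ (i + (k - i)) *\<^sub>R (a i ** b (k - i)))"
      by (rule sum.triangle_reindex_eq)
    also have "\<dots> = (\<Sum>k\<le>m. w ^ k *\<^sub>R (\<Sum>i\<le>k. a i ** b (k - i)))"
      by (simp add: scaleR_sum_right)
    also have "\<dots> = (\<Sum>k\<le>m. if k = 0 then C else 0)"
      by (intro sum.cong refl) (auto simp: conv)
    also have "\<dots> = C" by simp
    finally show ?thesis by (simp add: add.commute)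
  qed
  have "(\<lambda>k. \<Sum>(i, j)\<in>T. (1 / x k) ^ (i + j - m) *\<^sub>R (a i ** b j)) \<longlonglongrightarrow> (\<Sum>(i, j)\<in>T. 0 *\<^sub>R (a i ** b j))"
    unfolding case_prod_beta
  proof (intro tendsto_intros tendsto_null_power x(2))
    show "0 < fst p + snd p - m" if "p \<in> T" for p using that by (auto simp: T_def)
  qed
  moreover have "x k ^ m *\<^sub>R ((\<Sum>i\<le>m. (1 / x k) ^ i *\<^sub>R a i) ** (\<Sum>j\<le>m. (1 / x k) ^ j *\<^sub>R b j) - C)
     = (\<Sum>(i, j)\<in>T. (1 / x k) ^ (i + j - m) *\<^sub>R (a i ** b j))" for k
  proof -
    have pw: "x k ^ m * (1 / x k) ^ (i + j) = (1 / x k) ^ (i + j - m)" if "(i, j) \<in> T" for i j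
    proof -
      have "(1 / x k) ^ (i + j) = (1 / x k) ^ m * (1 / x k) ^ (i + j - m)"
        using that by (subst power_add[symmetric]) (auto simp: T_def)
      then show ?thesis using x(1)[of k] by (simp add: power_one_over)
    qed
    show ?thesis
      unfolding eq add_diff_cancel_left' scaleR_sum_right case_prod_beta
      by (intro sum.cong refl) (use pw in \<open>auto simp del: power_one_over\<close>)
  qed
  ultimately show ?thesis by simp
qed

text \<open>The condition \<open>null\<close> confines F to the range of A on both sides, see
  \<open>F_proj\<close>. In the application it is read off from the zeroth moment of F.\<close>

locale inverse_transform = stieltjes_transform \<alpha> \<sigma> F
  for \<alpha> :: real and \<sigma> :: "real set \<Rightarrow> complex^'q^'q" and F +
  fixes A :: "complex^'q^'q"
  assumes A: "nonneg_herm A"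
    and null: "\<And>v. A *v v = 0 \<Longrightarrow> measure (scalar_measure (half_line \<alpha>) \<sigma> v) {\<alpha>..} = 0"
    and holo_F: "\<And>i j. (\<lambda>z. F z $ i $ j) holomorphic_on cut_plane \<alpha>"
begin

abbreviation "A' \<equiv> moore_penrose A"
abbreviation "P \<equiv> range_proj A"
abbreviation "G \<equiv> inv_S_transform \<alpha> A F"
definition "Q z = mat 1 + A' ** F z"
definition "B z = moore_penrose (Q z)"

lemma herm_A: "ctranspose A = A" using A by (simp add: nonneg_herm_iff)

lemmas rp = range_proj[OF herm_A]

lemma G_eq: "G z = - cscale (inverse (z - of_real \<alpha>)) (A ** B z)"
  by (simp add: inv_S_transform_def B_def Q_def)

lemma F_proj:
  assumes z: "z \<in> cut_plane \<alpha>"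
  shows "F z ** P = F z" "P ** F z = F z"
proof -
  have *: "F z ** P = F z" if z: "z \<in> cut_plane \<alpha>" for z
  proof -
    have "F z *v (w - P *v w) = 0" for w
      by (intro F_null null z) (simp add: matrix_vector_mult_diff_distrib matrix_vector_mul_assoc rp)
    then show ?thesis
      by (simp add: matrix_eq_iff_vector matrix_vector_mult_diff_distrib matrix_vector_mul_assoc)
  qed
  show "F z ** P = F z" by (rule *[OF z])
  have "F z = ctranspose (F (cnj z))" using F_cnj[OF cut_plane_cnj[OF z]] by simp
  then show "P ** F z = F z"
    using *[OF cut_plane_cnj[OF z]] ctranspose_mult[of "F (cnj z)" P] by (simp only: rp(1))
qed

text \<open>A null vector v of \<open>Q z\<close> satisfies F v = -A v, so the form of F at v is the
  non-positive number -a. Positivity of Im ((z - \<alpha>) F), or of F itself on the real axis,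
  forces a = 0; then A v = 0, hence F v = 0 and v = 0.\<close>

lemma det_Q:
  assumes z: "z \<in> cut_plane \<alpha>"
  shows "det (Q z) \<noteq> 0"
proof (rule det_nonzeroI)
  fix v assume "Q z *v v = 0"
  then have v: "v = - (A' *v (F z *v v))"
    by (simp add: Q_def matrix_vector_mult_add_rdistrib matrix_vector_mul_assoc eq_neg_iff_add_eq_0)
  have Fv: "F z *v v = - (A *v v)"
  proof -
    have "A *v v = - (A *v (A' *v (F z *v v)))"
      using arg_cong[OF v, of "(*v) A"] by (simp add: matrix_vector_mult_minus)
    then show ?thesis by (simp add: matrix_vector_mul_assoc matrix_mul_assoc F_proj[OF z])
  qed
  define a where "a = Re (qform A v)"
  have a: "qform A v = of_real a" "a \<ge> 0"
    using nonneg_hermD[OF A] by (auto simp: a_def)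
  have q: "qform (F z) v = - of_real a" using a(1) by (simp add: qform_def Fv cdot_simps)
  have pos: "a = 0" if "Im y > 0" "qform (F y) v = - of_real a" for y
  proof -
    have "a * Im y \<le> 0" using Im_qform(2)[OF that(1), of v] that(2) by (simp add: mult.commute)
    then show ?thesis using that(1) a(2) by (simp add: mult_le_0_iff)
  qed
  have "a = 0"
  proof -
    consider "Im z > 0" | "Im z < 0" | "Im z = 0" by linarith
    then show ?thesis
    proof cases
      case 1 then show ?thesis using pos q by blast
    next
      case 2
      then show ?thesis using pos[of "cnj z"] q F_cnj[OF z] by (simp add: qform_ctranspose)
    next
      case 3
      then have zx: "z = of_real (Re z)" by (simp add: complex_eq_iff)
      then have "Re z < \<alpha>" using z cut_plane_real by metis
      from qform_real[OF this, of v] q zx have "complex_of_real (LINT t|\<mu> v. 1 / (t - Re z)) = of_real (- a)"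
        "0 \<le> (LINT t|\<mu> v. 1 / (t - Re z))" by simp_all
      then show ?thesis using a(2) by (simp only: of_real_eq_iff)
    qed
  qed
  then have "A *v v = 0" using nonneg_herm_null[OF A] a by simp
  then show "v = 0" using v Fv by simp
qed

lemma QB:
  assumes "z \<in> cut_plane \<alpha>"
  shows "Q z ** B z = mat 1" "B z ** Q z = mat 1"
  unfolding B_def by (rule moore_penrose_invertible[OF det_Q[OF assms]])+

text \<open>Evaluating at \<open>Q z *v y\<close> removes the inverse, as B Q = 1. What is left of
  the mixed term is the adjoint of F, because the product of the Moore-Penrose inverse and A is
  absorbed by F.\<close>

lemma qform_G:
  assumes z: "z \<in> cut_plane \<alpha>"
  shows "qform (G z) (Q z *v y) = - (inverse (z - of_real \<alpha>) * (qform A y + cnj (qform (F z) y)))"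
proof -
  have "A *v (B z *v (Q z *v y)) = A *v y"
    using QB(2)[OF z] by (simp add: matrix_vector_mul_assoc[of "B z"])
  then have 1: "qform (G z) (Q z *v y) = - (inverse (z - of_real \<alpha>) * cdot (Q z *v y) (A *v y))"
    by (simp add: G_eq qform_def cdot_simps matrix_vector_mult_minus cscale_mult_vector
        matrix_vector_mul_assoc[symmetric])
  have "cdot (A' *v (F z *v y)) (A *v y) = cdot (F z *v y) (ctranspose A' *v (A *v y))"
    by (rule cdot_mult_left)
  also have "\<dots> = cdot (F z *v y) (P *v y)" by (simp add: rp matrix_vector_mul_assoc)
  also have "\<dots> = cdot (P *v (F z *v y)) y" by (simp add: cdot_mult_left[of P] rp)
  also have "\<dots> = cnj (qform (F z) y)" by (simp add: matrix_vector_mul_assoc F_proj[OF z] qform_def cnj_cdot)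
  finally show ?thesis
    unfolding 1 by (simp add: Q_def matrix_vector_mult_add_rdistrib cdot_simps qform_def matrix_vector_mul_assoc)
qed

lemma qform_G':
  assumes z: "z \<in> cut_plane \<alpha>"
  shows "qform (G z) v = - (inverse (z - of_real \<alpha>) * (qform A (B z *v v) + cnj (qform (F z) (B z *v v))))"
  using qform_G[OF z, of "B z *v v"] QB(1)[OF z] by (simp add: matrix_vector_mul_assoc)

text \<open>With \<zeta> = z - \<alpha> and w the sum of the forms of A and F at y, the form of G is
  minus the conjugate of \<zeta> w over \<bar>\<zeta>\<bar>^2. Conjugation and sign cancel in the
  imaginary part, which reduces to \<open>Im_qform\<close>.\<close>

lemma Im_G:
  assumes z: "Im z > 0"
  shows "0 \<le> Im (qform (G z) v)"
proof -
  have zc: "z \<in> cut_plane \<alpha>" using z by (auto simp: cut_plane_def)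
  define y where "y = B z *v v"
  define \<zeta> where "\<zeta> = z - of_real \<alpha>"
  define w where "w = qform A y + qform (F z) y"
  have A': "qform A y = cnj (qform A y)" "Im (qform A y) = 0" "Re (qform A y) \<ge> 0"
    using nonneg_hermD[OF A] by (metis complex_cnj_complex_of_real, metis Im_complex_of_real, metis)
  have "Im (\<zeta> * w) = Im z * Re (qform A y) + Im (\<zeta> * qform (F z) y)"
    by (simp add: w_def \<zeta>_def A'(2) algebra_simps)
  also have "\<dots> \<ge> 0" using z A'(3) Im_qform(2)[OF z, of y] by (simp add: \<zeta>_def)
  finally have "Im (\<zeta> * w) \<ge> 0" .
  have "\<zeta> \<noteq> 0" using z by (auto simp: \<zeta>_def complex_eq_iff)
  have "qform (G z) v = - (inverse \<zeta> * cnj w)"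
    unfolding qform_G'[OF zc] using A'(1) by (simp add: y_def[symmetric] \<zeta>_def w_def)
  also have "\<dots> = - cnj (\<zeta> * w) / of_real ((cmod \<zeta>)\<^sup>2)"
    using \<open>\<zeta> \<noteq> 0\<close> complex_norm_square[of \<zeta>] by (simp add: field_simps)
  finally have "Im (qform (G z) v) = Im (\<zeta> * w) / (cmod \<zeta>)\<^sup>2"
    by (simp only: Im_divide_of_real uminus_complex.sel complex_cnj) simp
  then show ?thesis using \<open>Im (\<zeta> * w) \<ge> 0\<close> by simp
qed

lemma G_nonneg:
  assumes x: "x < \<alpha>"
  shows "nonneg_herm (G (of_real x))"
proof -
  have z: "complex_of_real x \<in> cut_plane \<alpha>" using x by (simp add: cut_plane_real)
  have "\<exists>r\<ge>0. qform (G (of_real x)) v = of_real r" for v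
  proof -
    define y where "y = B (of_real x) *v v"
    define a where "a = Re (qform A y)"
    define f where "f = (LINT t|\<mu> y. 1 / (t - x))"
    have a: "qform A y = of_real a" "a \<ge> 0" using nonneg_hermD[OF A] by (auto simp: a_def)
    have f: "qform (F (of_real x)) y = of_real f" "f \<ge> 0" using qform_real[OF x, of y] by (auto simp: f_def)
    have "qform (G (of_real x)) v = of_real ((a + f) / (\<alpha> - x))"
      unfolding qform_G'[OF z] y_def[symmetric] a f using x by (simp add: divide_simps)  (simp add: algebra_simps)
    moreover have "(a + f) / (\<alpha> - x) \<ge> 0" using a f x by simp
    ultimately show ?thesis by blast
  qed
  then show ?thesis by (intro nonneg_hermI) (metis Reals_of_real, metis Re_complex_of_real)
qed

text \<open>A intertwines \<open>Q\<close> at conjugate points: the adjoint of Q(z) times A and A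
  times Q at the conjugate point both equal A plus F at the conjugate point. Inverting moves this to
  \<open>B\<close>.\<close>

lemma G_cnj:
  assumes z: "z \<in> cut_plane \<alpha>"
  shows "G (cnj z) = ctranspose (G z)"
proof -
  let ?z = "cnj z"
  have zc: "?z \<in> cut_plane \<alpha>" using cut_plane_cnj[OF z] .
  have "A ** Q ?z = A + F ?z"
    by (simp add: Q_def matrix_add_ldistrib matrix_mul_assoc F_proj[OF zc])
  moreover have "ctranspose (Q z) ** A = A + F ?z"
  proof -
    have "ctranspose (Q z) ** A = A + ctranspose (F z) ** (A' ** A)"
      by (simp add: Q_def ctranspose_linear ctranspose_mult rp(8) matrix_add_rdistrib matrix_mul_assoc)
    then show ?thesis using F_proj(1)[OF zc] by (simp add: rp F_cnj[OF z])
  qed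
  ultimately have eq: "ctranspose (Q z) ** A = A ** Q ?z" by simp
  have "ctranspose (B z) ** ctranspose (Q z) = mat 1"
    using QB(1)[OF z] by (metis ctranspose_mat_1 ctranspose_mult)
  then have "ctranspose (B z) ** A = ctranspose (B z) ** (ctranspose (Q z) ** A) ** B ?z"
    unfolding eq using QB(1)[OF zc] by (metis matrix_mul_assoc matrix_mul_rid)
  also have "\<dots> = A ** B ?z"
    using \<open>ctranspose (B z) ** ctranspose (Q z) = mat 1\<close> by (simp add: matrix_mul_assoc)
  finally have "ctranspose (A ** B z) = A ** B ?z" by (simp add: ctranspose_mult herm_A)
  moreover have "ctranspose (cscale c H) = cscale (cnj c) (ctranspose H)" for c and H :: "complex^'q^'q"
    by (simp add: cscale_def ctranspose_def vec_eq_iff)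
  ultimately show ?thesis by (simp add: G_eq ctranspose_linear)
qed

lemma G_holo: "(\<lambda>z. G z $ i $ j) holomorphic_on cut_plane \<alpha>"
proof -
  have Q: "(\<lambda>z. Q z $ i $ j) holomorphic_on cut_plane \<alpha>" for i j
    by (simp add: Q_def matrix_matrix_mult_def, intro holomorphic_intros holo_F)
  have "(\<lambda>z. B z $ i $ j) holomorphic_on cut_plane \<alpha>" for i j
    unfolding B_def by (rule holomorphic_on_moore_penrose[OF Q det_Q])
  then have "(\<lambda>z. - (inverse (z - of_real \<alpha>) * (\<Sum>k\<in>UNIV. A $ i $ k * B z $ k $ j))) holomorphic_on cut_plane \<alpha>"
    by (intro holomorphic_intros) (auto simp: cut_plane_def)
  then show ?thesis by (simp add: G_eq cscale_def matrix_matrix_mult_def)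
qed

lemma B_tendsto:
  assumes "\<And>n. z n \<in> cut_plane \<alpha>" "(\<lambda>n. F (z n)) \<longlonglongrightarrow> 0"
  shows "(\<lambda>n. B (z n)) \<longlonglongrightarrow> mat 1"
proof -
  have "(\<lambda>n. Q (z n)) \<longlonglongrightarrow> mat 1 + A' ** 0"
    unfolding Q_def by (intro tendsto_intros assms(2))
  then have "(\<lambda>n. moore_penrose (Q (z n))) \<longlonglongrightarrow> moore_penrose (mat 1)"
    by (intro tendsto_moore_penrose det_Q assms(1)) simp_all
  moreover have "moore_penrose (mat 1 :: complex^'q^'q) = mat 1" by (rule moore_penrose_inverse) simp_all
  ultimately show ?thesis by (simp add: B_def)
qed

text \<open>Argued by contradiction along a sequence, since dominated convergence is sequential. On
  Im z \<ge> \<epsilon> the matrices F tend to 0, so B tends to 1 and z G(z) = -(1 + \<alpha>/(z -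
  \<alpha>)) A B(z) to -A.\<close>

lemma G_decay:
  assumes \<epsilon>: "\<epsilon> > 0" and \<delta>: "\<delta> > 0"
  shows "\<exists>R. \<forall>z. Im z \<ge> \<epsilon> \<longrightarrow> cmod z \<ge> R \<longrightarrow> cmod (z * qform (G z) v + of_real (Re (qform A v))) \<le> \<delta>"
proof (rule ccontr)
  assume "\<not> ?thesis"
  then have "\<forall>n::nat. \<exists>z. Im z \<ge> \<epsilon> \<and> cmod z \<ge> real n \<and> \<not> cmod (z * qform (G z) v + of_real (Re (qform A v))) \<le> \<delta>"
    by blast
  then obtain z where z: "\<And>n. Im (z n) \<ge> \<epsilon>" "\<And>n. cmod (z n) \<ge> real n"
     "\<And>n. \<not> cmod (z n * qform (G (z n)) v + of_real (Re (qform A v))) \<le> \<delta>" by metis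
  have zc: "z n \<in> cut_plane \<alpha>" for n using z(1)[of n] \<epsilon> by (auto simp: cut_plane_def)
  have inf: "filterlim (\<lambda>n. cmod (z n)) at_top sequentially"
    by (rule filterlim_at_top_mono[OF filterlim_real_sequentially]) (use z(2) in auto)
  have "\<epsilon> \<le> cmod (of_real t - z n)" for t n
    using abs_Im_le_cmod[of "of_real t - z n"] z(1)[of n] by simp
  then have "(\<lambda>n. F (z n)) \<longlonglongrightarrow> 0" by (intro F_tendsto_0[OF zc inf \<epsilon>])
  from B_tendsto[OF zc this] have B: "(\<lambda>n. qform (A ** B (z n)) v) \<longlonglongrightarrow> qform (A ** mat 1) v"
    by (intro tendsto_qform matrix_tendstoD tendsto_matrix_mult tendsto_const)
  have "filterlim (\<lambda>n. - of_real \<alpha> + z n) at_infinity sequentially"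
    by (intro tendsto_add_filterlim_at_infinity[OF tendsto_const] filterlim_norm_at_top_imp_at_infinity inf)
  then have "(\<lambda>n. inverse (- of_real \<alpha> + z n)) \<longlonglongrightarrow> 0"
    by (rule filterlim_compose[OF tendsto_inverse_0])
  then have inv: "(\<lambda>n. inverse (z n - of_real \<alpha>)) \<longlonglongrightarrow> 0" by simp
  have ne: "z n - of_real \<alpha> \<noteq> 0" for n using z(1)[of n] \<epsilon> by (auto simp: complex_eq_iff)
  have eq: "z n * qform (G (z n)) v = - ((1 + of_real \<alpha> * inverse (z n - of_real \<alpha>)) * qform (A ** B (z n)) v)" for n
  proof -
    have "z n * inverse (z n - of_real \<alpha>) = 1 + of_real \<alpha> * inverse (z n - of_real \<alpha>)"
      using ne[of n] by (simp add: field_simps)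
    moreover have "qform (G (z n)) v = - (inverse (z n - of_real \<alpha>) * qform (A ** B (z n)) v)"
      using qform_diff[of 0 "cscale (inverse (z n - of_real \<alpha>)) (A ** B (z n))" v] by (simp add: G_eq qform_cscale)
    ultimately show ?thesis by (simp add: mult.assoc[symmetric])
  qed
  have "(\<lambda>n. - ((1 + of_real \<alpha> * inverse (z n - of_real \<alpha>)) * qform (A ** B (z n)) v) + of_real (Re (qform A v)))
     \<longlonglongrightarrow> - ((1 + of_real \<alpha> * 0) * qform (A ** mat 1) v) + of_real (Re (qform A v))"
    by (intro tendsto_intros inv B)
  then have "(\<lambda>n. z n * qform (G (z n)) v + of_real (Re (qform A v))) \<longlonglongrightarrow> 0"
    unfolding eq using nonneg_hermD(3)[OF A, of v] by simp
  then have "\<forall>\<^sub>F n in sequentially. dist (z n * qform (G (z n)) v + of_real (Re (qform A v))) 0 < \<delta>"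
    using \<delta> by (rule tendstoD)
  then obtain n where "cmod (z n * qform (G (z n)) v + of_real (Re (qform A v))) < \<delta>"
    by (auto simp: eventually_sequentially)
  then show False using z(3)[of n] by simp
qed

lemma ex_measure: obtains \<sigma>' where "stieltjes_measure \<alpha> G \<sigma>'"
proof -
  interpret G: stieltjes_matrix_function \<alpha> G A
    by unfold_locales (use G_holo Im_G G_cnj G_decay in blast)+
  show ?thesis using G.ex_stieltjes_measure that by blast
qed

lemma G_S_class: "G \<in> S_class \<alpha>"
  using G_holo Im_G G_nonneg by (simp add: S_class_def nonneg_herm_im_part_iff)

end

section \<open>Moments of the inverse transform\<close>

text \<open>In powers of 1/x this is u = (1 - \<alpha>/x) s; the last summand is what truncation at
  m leaves over.\<close>

lemma shift_seq_generating:
  fixes s :: "nat \<Rightarrow> complex^'q^'q"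
  assumes "x \<noteq> 0"
  shows "(\<Sum>j\<le>m. (1 / x) ^ j *\<^sub>R shift_seq \<alpha> s j)
     = (x - \<alpha>) *\<^sub>R (\<Sum>j\<le>m. (1 / x ^ Suc j) *\<^sub>R s j) + (\<alpha> / x ^ Suc m) *\<^sub>R s m"
proof (induction m)
  case 0
  show ?case using assms by (simp add: scaleR_add_left[symmetric] divide_simps)
next
  case (Suc m)
  have "(\<Sum>j\<le>Suc m. (1 / x) ^ j *\<^sub>R shift_seq \<alpha> s j)
     = (x - \<alpha>) *\<^sub>R (\<Sum>j\<le>m. (1 / x ^ Suc j) *\<^sub>R s j) + (\<alpha> / x ^ Suc m) *\<^sub>R s m
       + (1 / x) ^ Suc m *\<^sub>R (s (Suc m) - \<alpha> *\<^sub>R s m)"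
    by (simp only: sum.atMost_Suc Suc shift_seq_Suc)
  also have "\<dots> = (x - \<alpha>) *\<^sub>R (\<Sum>j\<le>m. (1 / x ^ Suc j) *\<^sub>R s j) + (1 / x ^ Suc m) *\<^sub>R s (Suc m)"
    by (simp add: scaleR_diff_right power_one_over divide_inverse mult.commute power_inverse)
  also have "(1 / x ^ Suc m) *\<^sub>R s (Suc m)
     = (x - \<alpha>) *\<^sub>R ((1 / x ^ Suc (Suc m)) *\<^sub>R s (Suc m)) + (\<alpha> / x ^ Suc (Suc m)) *\<^sub>R s (Suc m)"
    using assms by (simp add: scaleR_add_left[symmetric] diff_divide_distrib)
  finally show ?case by (simp only: sum.atMost_Suc scaleR_add_right add.assoc)
qed

context inverse_transform
begin

text \<open>With U and V the truncated series of u and its reciprocal, Q is 1 - P + V A up to a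
  remainder of size x^-(n+1) governed by D. Its approximate left inverse \<open>X0\<close> satisfies
  A X0 = U, so A B agrees with U - x^-(n+1) D to that order, and dividing by x - \<alpha> gives the
  expansion of -G.\<close>

lemma inverse_moments:
  fixes s :: "nat \<Rightarrow> complex^'q^'q"
  assumes s: "s \<in> K_ge_ext \<alpha> (Suc n)" "s 0 = A"
    and moments: "\<And>j. j < n \<Longrightarrow> has_moment \<alpha> \<sigma> j (S_transform \<alpha> s j)" "has_moment \<alpha> \<sigma> n J"
    and D: "nonneg_herm (S_transform \<alpha> s n - J)"
    and \<sigma>': "stieltjes_measure \<alpha> G \<sigma>'"
  defines "D \<equiv> S_transform \<alpha> s n - J"
  shows "j \<le> n \<Longrightarrow> has_moment \<alpha> \<sigma>' j (s j)" "has_moment \<alpha> \<sigma>' (Suc n) (s (Suc n) - D)"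
proof -
  interpret G: stieltjes_transform \<alpha> \<sigma>' G using \<sigma>' by (simp add: stieltjes_measure_iff)
  define t where "t = S_transform \<alpha> s"
  define u where "u = shift_seq \<alpha> s"
  define R where "R = recip_seq u"
  \<comment> \<open>Ensures that every \<open>x k\<close> is negative and lies left of
    \<alpha>.\<close>
  define K where "K = nat \<lceil>\<bar>\<alpha>\<bar>\<rceil> + 1"
  define x where "x k = - real (k + K)" for k
  define X where "X k = complex_of_real (x k)" for k
  let ?m = "Suc n"
  have herm: "ctranspose (s j) = s j" if "j \<le> ?m" for j
    using K_ge_hermitian K_ge_ext_subset s(1) that by blast
  have range: "s j ** P = s j" "P ** s j = s j" if "j \<le> ?m" for j
    using K_ge_ext_range[OF s(1) that] s(2) by auto
  have u: "u j ** P = u j" "P ** u j = u j" if "j \<le> ?m" for j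
    using that range by (cases j; simp add: u_def shift_seq_Suc matrix_ring_simps)+
  have u0: "u 0 = A" by (simp add: u_def s)
  have PR: "P ** R j = R j" for j
    using recip_seq_range[of u j] u0 herm_A by (simp add: R_def)
  have conv: "(\<Sum>i\<le>k. u i ** R (k - i)) = (if k = 0 then P else 0)" if "k \<le> ?m" for k
    using recip_seq_right_inverse[of u k] u0 herm_A u that by (simp add: R_def)
  have t: "t j = - (A ** R (Suc j) ** A)" for j
    by (simp add: t_def S_transform_def R_def u_def s)
  have x: "x k < \<alpha>" "x k < 0" "x k - \<alpha> \<noteq> 0" for k
  proof -
    have "\<bar>\<alpha>\<bar> < real (k + K)" unfolding K_def by linarith
    then show "x k < \<alpha>" "x k < 0" "x k - \<alpha> \<noteq> 0" by (auto simp: x_def)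
  qed
  then have x0: "x k \<noteq> 0" for k by (metis less_irrefl)
  have X: "X k \<in> cut_plane \<alpha>" for k using x by (simp add: X_def cut_plane_real)
  have w0: "(\<lambda>k. 1 / x k) \<longlonglongrightarrow> 0"
  proof -
    have "(\<lambda>k. 1 / - real k) \<longlonglongrightarrow> 0" by real_asymp
    from LIMSEQ_ignore_initial_segment[OF this, of K] show ?thesis by (simp add: x_def)
  qed
  have D_nn: "nonneg_herm D" using D by (simp add: D_def)
  \<comment> \<open>In a null direction of A there is no mass, so \<open>J\<close> vanishes there,
    and \<open>t n\<close> ends with the factor A. Hence the defect lives on the range of A.\<close>
  have Dv: "D *v v = 0" if v: "A *v v = 0" for v
  proof -
    interpret m: finite_measure "\<mu> v" by (rule scalar_measure)
    have "emeasure (\<mu> v) (space (\<mu> v)) = 0" using null[OF v] by (simp add: space_\<mu> m.emeasure_eq_measure)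
    then have "AE x in \<mu> v. x ^ n = 0"
      by (intro AE_I[of _ _ "space (\<mu> v)"]) auto
    then have "(LINT x|\<mu> v. x ^ n) = 0" by (rule integral_eq_zero_AE)
    then have "qform J v = 0" using moments(2) unfolding moment_iff by simp
    moreover have "t n *v v = 0"
      by (simp add: t matrix_vector_mult_minus matrix_vector_mul_assoc[symmetric] v)
    then have "qform (t n) v = 0" by (simp add: qform_def cdot_simps)
    ultimately have "qform D v = 0" by (simp add: D_def t_def qform_diff)
    then show ?thesis using nonneg_herm_null[OF D_nn] by blast
  qed
  have DP: "D ** P = D"
  proof -
    have "D *v (w - P *v w) = 0" for w
      by (rule Dv) (simp add: matrix_vector_mult_diff_distrib matrix_vector_mul_assoc rp)
    then show ?thesis
      by (simp add: matrix_eq_iff_vector matrix_vector_mult_diff_distrib matrix_vector_mul_assoc)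
  qed
  have hD: "ctranspose D = D" using D_nn by (simp add: nonneg_herm_iff)
  have PD: "P ** D = D" using DP ctranspose_mult[of D P] by (simp only: hD rp(1))

  \<comment> \<open>The scaled remainder when the top coefficient is \<open>t n\<close> instead of
    the true moment \<open>J\<close>; therefore it tends to D and not to 0.\<close>
  define E where "E k = x k ^ ?m *\<^sub>R (F (X k) + (\<Sum>j\<le>n. (1 / x k ^ Suc j) *\<^sub>R t j))" for k
  have E: "E \<longlonglongrightarrow> D"
  proof -
    define c where "c j = (if j < n then t j else J)" for j
    have "has_moment \<alpha> \<sigma> j (c j)" if "j \<le> n" for j
      using moments that by (auto simp: c_def t_def)
    from LIMSEQ_ignore_initial_segment[OF moments_expansion[of n c, OF this], of K]
    have "(\<lambda>k. x k ^ ?m *\<^sub>R (F (X k) + (\<Sum>j\<le>n. (1 / x k ^ Suc j) *\<^sub>R c j))) \<longlonglongrightarrow> 0"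
      by (simp add: x_def X_def)
    from tendsto_add[OF this tendsto_const[of D]]
    have "(\<lambda>k. x k ^ ?m *\<^sub>R (F (X k) + (\<Sum>j\<le>n. (1 / x k ^ Suc j) *\<^sub>R c j)) + D) \<longlonglongrightarrow> D" by simp
    moreover have "x k ^ ?m *\<^sub>R (F (X k) + (\<Sum>j\<le>n. (1 / x k ^ Suc j) *\<^sub>R c j)) + D = E k" for k
    proof -
      have "(\<Sum>j\<le>n. (1 / x k ^ Suc j) *\<^sub>R t j) = (\<Sum>j\<le>n. (1 / x k ^ Suc j) *\<^sub>R c j) + (1 / x k ^ ?m) *\<^sub>R D"
        by (simp add: lessThan_Suc_atMost[symmetric] c_def D_def t_def scaleR_diff_right)
      moreover have "x k ^ ?m *\<^sub>R ((1 / x k ^ ?m) *\<^sub>R D) = D" using x0[of k] by simp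
      ultimately show ?thesis by (simp only: E_def scaleR_add_right add.assoc)
    qed
    ultimately show ?thesis by simp
  qed

  define U where "U k = (\<Sum>j\<le>?m. (1 / x k) ^ j *\<^sub>R u j)" for k
  define V where "V k = (\<Sum>j\<le>?m. (1 / x k) ^ j *\<^sub>R R j)" for k
  \<comment> \<open>Inverse of 1 - P + V A to leading order: 1 - P on the complement, and on the
    range of A the inverse of V A, where U V is close to P.\<close>
  define X0 where "X0 k = mat 1 - P + A' ** U k" for k
  define Bk where "Bk k = B (X k)" for k
  have UP: "U k ** P = U k" "P ** U k = U k" for k
    unfolding U_def matrix_mult_sum_left matrix_mult_sum_right
    by (intro sum.cong refl; simp add: matrix_mult_scaleR u)+
  have PV: "P ** V k = V k" for k
    unfolding V_def matrix_mult_sum_right by (intro sum.cong refl) (simp add: matrix_mult_scaleR PR)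
  have UV: "(\<lambda>k. x k ^ ?m *\<^sub>R (U k ** V k - P)) \<longlonglongrightarrow> 0"
    unfolding U_def V_def by (rule truncated_product_limit[OF conv x0 w0])
  have R0: "R 0 = A'" by (simp add: R_def u0)
  \<comment> \<open>This identity is exact because \<open>t j\<close> is -A R(j + 1) A: truncating V
    at n + 1 corresponds to truncating t at n.\<close>
  have tV: "(\<Sum>j\<le>n. (1 / x k ^ Suc j) *\<^sub>R t j) = A - A ** V k ** A" for k
  proof -
    have "V k = A' + (\<Sum>j\<le>n. (1 / x k ^ Suc j) *\<^sub>R R (Suc j))"
      unfolding V_def by (subst sum.atMost_Suc_shift) (simp add: R0 power_one_over del: power_Suc)
    then have "A ** V k ** A = A ** A' ** A + (\<Sum>j\<le>n. (1 / x k ^ Suc j) *\<^sub>R (A ** R (Suc j) ** A))"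
      by (simp only: matrix_add_ldistrib matrix_add_rdistrib matrix_mult_sum_left matrix_mult_sum_right matrix_mult_scaleR)
    then show ?thesis by (simp add: t rp sum_negf)
  qed
  have Q: "Q (X k) = mat 1 - P + V k ** A + A' ** (F (X k) + (\<Sum>j\<le>n. (1 / x k ^ Suc j) *\<^sub>R t j))" for k
  proof -
    have "A' ** (A ** V k ** A) = V k ** A"
      using PV[of k] rp(7) by (metis matrix_mul_assoc)
    then have "A' ** (\<Sum>j\<le>n. (1 / x k ^ Suc j) *\<^sub>R t j) = P - V k ** A"
      unfolding tV by (simp add: matrix_sub_ldistrib rp)
    then show ?thesis by (simp add: Q_def matrix_add_ldistrib)
  qed
  have X0Q0: "X0 k ** (mat 1 - P + V k ** A) = mat 1 + A' ** (U k ** V k - P) ** A" for k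
  proof -
    have a: "(mat 1 - P) ** (mat 1 - P) = mat 1 - P"
      by (simp add: matrix_sub_ldistrib matrix_sub_rdistrib rp(2))
    have b: "(mat 1 - P) ** (V k ** A) = 0"
      by (simp add: matrix_sub_rdistrib matrix_mul_assoc PV)
    have c: "A' ** U k ** (mat 1 - P) = 0"
    proof -
      have "A' ** U k ** P = A' ** U k" using UP(1)[of k] by (metis matrix_mul_assoc)
      then show ?thesis by (simp add: matrix_sub_ldistrib)
    qed
    have d: "A' ** P ** A = P" by (simp only: rp)
    have "X0 k ** (mat 1 - P + V k ** A) = (mat 1 - P) ** (mat 1 - P) + (mat 1 - P) ** (V k ** A)
       + A' ** U k ** (mat 1 - P) + A' ** U k ** (V k ** A)"
      by (simp only: X0_def matrix_add_ldistrib matrix_add_rdistrib add.assoc)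
         (simp only: add.commute add.left_commute add.assoc)
    also have "\<dots> = mat 1 + (A' ** (U k ** V k) ** A - A' ** P ** A)"
      unfolding a b c d by (simp add: matrix_mul_assoc)
    also have "\<dots> = mat 1 + A' ** (U k ** V k - P) ** A"
      by (simp only: matrix_sub_ldistrib matrix_sub_rdistrib)
    finally show ?thesis .
  qed
  have X0_lim: "X0 \<longlonglongrightarrow> mat 1"
  proof -
    have "(\<lambda>k. \<Sum>j\<le>n. (1 / x k) ^ Suc j *\<^sub>R u (Suc j)) \<longlonglongrightarrow> (\<Sum>j\<le>n. 0 *\<^sub>R u (Suc j))"
      by (intro tendsto_intros tendsto_null_power w0) simp
    then have "(\<lambda>k. A + (\<Sum>j\<le>n. (1 / x k) ^ Suc j *\<^sub>R u (Suc j))) \<longlonglongrightarrow> A + 0"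
      by (intro tendsto_add tendsto_const) simp
    moreover have "A + (\<Sum>j\<le>n. (1 / x k) ^ Suc j *\<^sub>R u (Suc j)) = U k" for k
      unfolding U_def by (subst sum.atMost_Suc_shift) (simp add: u0)
    ultimately have "U \<longlonglongrightarrow> A" by simp
    then have "(\<lambda>k. mat 1 - P + A' ** U k) \<longlonglongrightarrow> mat 1 - P + A' ** A"
      by (intro tendsto_add tendsto_matrix_mult tendsto_const)
    then show ?thesis by (simp add: X0_def[abs_def] rp)
  qed
  have X0Q: "(\<lambda>k. x k ^ ?m *\<^sub>R (X0 k ** Q (X k) - mat 1)) \<longlonglongrightarrow> A' ** D"
  proof -
    have "x k ^ ?m *\<^sub>R (X0 k ** Q (X k) - mat 1)
       = A' ** (x k ^ ?m *\<^sub>R (U k ** V k - P)) ** A + X0 k ** (A' ** E k)" for k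
    proof -
      have "X0 k ** Q (X k) - mat 1 = A' ** (U k ** V k - P) ** A
         + X0 k ** (A' ** (F (X k) + (\<Sum>j\<le>n. (1 / x k ^ Suc j) *\<^sub>R t j)))"
        unfolding Q matrix_add_ldistrib[of "X0 k"] X0Q0 by simp
      then show ?thesis by (simp only: E_def matrix_mult_scaleR scaleR_add_right[symmetric])
    qed
    moreover have "(\<lambda>k. A' ** (x k ^ ?m *\<^sub>R (U k ** V k - P)) ** A + X0 k ** (A' ** E k))
       \<longlonglongrightarrow> A' ** 0 ** A + mat 1 ** (A' ** D)"
      by (intro tendsto_add tendsto_matrix_mult tendsto_const UV X0_lim E)
    ultimately show ?thesis by simp
  qed
  have F0: "(\<lambda>k. F (X k)) \<longlonglongrightarrow> 0"
  proof (rule F_tendsto_0[OF X])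
    have "(\<lambda>k. cmod (X k)) = (\<lambda>k. real (k + K))" unfolding X_def x_def norm_of_real by (simp add: add.commute)
    moreover have "filterlim (\<lambda>k. real (k + K)) at_top sequentially" by real_asymp
    ultimately show "filterlim (\<lambda>k. cmod (X k)) at_top sequentially" by simp
    fix k and y :: real assume "y \<ge> \<alpha>"
    have "\<alpha> - x 0 \<le> y - x k" using \<open>y \<ge> \<alpha>\<close> by (simp add: x_def)
    also have "\<dots> \<le> cmod (of_real y - X k)" using complex_Re_le_cmod[of "of_real y - X k"] by (simp add: X_def)
    finally show "\<alpha> - x 0 \<le> cmod (of_real y - X k)" .
  qed (use x(1)[of 0] in simp)
  have B_lim: "Bk \<longlonglongrightarrow> mat 1"
    unfolding Bk_def[abs_def] by (rule B_tendsto[OF X F0])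
  \<comment> \<open>Left multiplication by A turns \<open>X0\<close> into U, right multiplication by
    \<open>Bk\<close> cancels Q. The limit is A A' D = P D = D.\<close>
  have UAB: "(\<lambda>k. x k ^ ?m *\<^sub>R (U k - A ** Bk k)) \<longlonglongrightarrow> D"
  proof -
    have "x k ^ ?m *\<^sub>R (U k - A ** Bk k) = A ** ((x k ^ ?m *\<^sub>R (X0 k ** Q (X k) - mat 1)) ** Bk k)" for k
    proof -
      have "A ** X0 k = U k"
      proof -
        have "A ** X0 k = A - A ** P + P ** U k"
          by (simp add: X0_def matrix_add_ldistrib matrix_sub_ldistrib matrix_mul_assoc)
        then show ?thesis by (simp only: rp UP) simp
      qed
      moreover have "(X0 k ** Q (X k) - mat 1) ** Bk k = X0 k - Bk k"
        using QB(1)[OF X[of k]] by (simp add: matrix_sub_rdistrib Bk_def matrix_mul_assoc[symmetric])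
      ultimately show ?thesis by (simp add: matrix_mult_scaleR matrix_sub_ldistrib)
    qed
    moreover have "(\<lambda>k. A ** ((x k ^ ?m *\<^sub>R (X0 k ** Q (X k) - mat 1)) ** Bk k)) \<longlonglongrightarrow> A ** (A' ** D ** mat 1)"
      by (intro tendsto_matrix_mult tendsto_const X0Q B_lim)
    ultimately show ?thesis by (simp add: matrix_mul_assoc PD)
  qed

  \<comment> \<open>The candidate moments; only the top one carries the defect. Below, the limit is
    D from \<open>UAB\<close> minus the D put into \<open>c\<close>.\<close>
  define c where "c j = (if j \<le> n then s j else s j - D)" for j
  have lim: "(\<lambda>k. x k ^ Suc ?m *\<^sub>R (G (X k) + (\<Sum>j\<le>?m. (1 / x k ^ Suc j) *\<^sub>R c j))) \<longlonglongrightarrow> 0"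
  proof -
    have eq: "x k ^ Suc ?m *\<^sub>R (G (X k) + (\<Sum>j\<le>?m. (1 / x k ^ Suc j) *\<^sub>R c j))
       = (x k / (x k - \<alpha>)) *\<^sub>R (x k ^ ?m *\<^sub>R (U k - A ** Bk k)) - (\<alpha> / (x k - \<alpha>)) *\<^sub>R s ?m - D" for k
    proof -
      let ?y = "x k" and ?S = "\<Sum>j\<le>?m. (1 / x k ^ Suc j) *\<^sub>R s j"
      have Gk: "G (X k) = - ((1 / (?y - \<alpha>)) *\<^sub>R (A ** Bk k))"
      proof -
        have "inverse (X k - of_real \<alpha>) = of_real (1 / (?y - \<alpha>))"
          by (simp add: X_def divide_inverse)
        then show ?thesis
          by (simp add: G_eq Bk_def cscale_def vec_eq_iff scaleR_conv_of_real[where 'a=complex])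
      qed
      have "U k = (?y - \<alpha>) *\<^sub>R ?S + (\<alpha> / ?y ^ Suc ?m) *\<^sub>R s ?m"
        unfolding U_def u_def by (rule shift_seq_generating[OF x0])
      then have S: "?S = (1 / (?y - \<alpha>)) *\<^sub>R (U k - (\<alpha> / ?y ^ Suc ?m) *\<^sub>R s ?m)"
        using x(3)[of k] by simp
      have cS: "(\<Sum>j\<le>?m. (1 / ?y ^ Suc j) *\<^sub>R c j) = ?S - (1 / ?y ^ Suc ?m) *\<^sub>R D"
        by (simp add: c_def scaleR_diff_right)
      have "G (X k) + (\<Sum>j\<le>?m. (1 / ?y ^ Suc j) *\<^sub>R c j)
         = (1 / (?y - \<alpha>)) *\<^sub>R (U k - A ** Bk k) - (1 / (?y - \<alpha>) * (\<alpha> / ?y ^ Suc ?m)) *\<^sub>R s ?m - (1 / ?y ^ Suc ?m) *\<^sub>R D"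
        unfolding cS S Gk by (simp add: scaleR_diff_right)
      then have "?y ^ Suc ?m *\<^sub>R (G (X k) + (\<Sum>j\<le>?m. (1 / ?y ^ Suc j) *\<^sub>R c j))
         = (?y ^ Suc ?m * (1 / (?y - \<alpha>))) *\<^sub>R (U k - A ** Bk k)
           - (?y ^ Suc ?m * (1 / (?y - \<alpha>) * (\<alpha> / ?y ^ Suc ?m))) *\<^sub>R s ?m - (?y ^ Suc ?m * (1 / ?y ^ Suc ?m)) *\<^sub>R D"
        by (simp only: scaleR_diff_right scaleR_scaleR)
      also have "?y ^ Suc ?m * (1 / (?y - \<alpha>)) = ?y / (?y - \<alpha>) * ?y ^ ?m" by simp
      also have "?y ^ Suc ?m * (1 / (?y - \<alpha>) * (\<alpha> / ?y ^ Suc ?m)) = \<alpha> / (?y - \<alpha>)" using x0[of k] by simp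
      also have "?y ^ Suc ?m * (1 / ?y ^ Suc ?m) = 1" using x0[of k] by simp
      finally show ?thesis by (simp only: scaleR_scaleR scaleR_one)
    qed
    have "(\<lambda>k. - real k / (- real k - \<alpha>)) \<longlonglongrightarrow> 1" "(\<lambda>k. \<alpha> / (- real k - \<alpha>)) \<longlonglongrightarrow> 0" by real_asymp+
    from this[THEN LIMSEQ_ignore_initial_segment, of K]
    have r: "(\<lambda>k. x k / (x k - \<alpha>)) \<longlonglongrightarrow> 1" "(\<lambda>k. \<alpha> / (x k - \<alpha>)) \<longlonglongrightarrow> 0" by (simp_all only: x_def)
    have "(\<lambda>k. (x k / (x k - \<alpha>)) *\<^sub>R (x k ^ ?m *\<^sub>R (U k - A ** Bk k)) - (\<alpha> / (x k - \<alpha>)) *\<^sub>R s ?m - D)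
      \<longlonglongrightarrow> 1 *\<^sub>R D - 0 *\<^sub>R s ?m - D"
      by (intro tendsto_diff tendsto_scaleR r UAB tendsto_const)
    then show ?thesis unfolding eq by simp
  qed
  have "has_moment \<alpha> \<sigma>' j (c j)" if "j \<le> ?m" for j
  proof (rule G.expansion_moments[OF _ _ that])
    show "ctranspose (c j) = c j" if "j \<le> ?m" for j
      using herm[OF that] hD by (simp add: c_def ctranspose_linear)
    show "(\<lambda>k. (- real k) ^ Suc ?m *\<^sub>R (G (of_real (- real k)) + (\<Sum>j\<le>?m. (1 / (- real k) ^ Suc j) *\<^sub>R c j))) \<longlonglongrightarrow> 0"
      by (rule LIMSEQ_offset[of _ K]) (use lim in \<open>simp only: x_def X_def\<close>)
  qed
  from this[of j] this[of ?m] show "j \<le> n \<Longrightarrow> has_moment \<alpha> \<sigma>' j (s j)" "has_moment \<alpha> \<sigma>' ?m (s ?m - D)"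
    by (simp_all add: c_def)
qed

end

section \<open>The moment classes: stability under the inverse transform, and existence\<close>

lemma inv_S_transform_moment_class:
  fixes s :: "nat \<Rightarrow> complex^'q^'q"
  assumes s: "s \<in> K_ge_ext \<alpha> (Suc n)" and F: "F \<in> S_moment_class \<alpha> n (S_transform \<alpha> s)"
  shows "inv_S_transform \<alpha> (s 0) F \<in> S_moment_class \<alpha> (Suc n) s"
proof -
  let ?t = "S_transform \<alpha> s"
  have FS: "F \<in> S_class \<alpha>" using F by (simp add: S_moment_class_def S0_class_def)
  obtain \<sigma> J where \<sigma>: "stieltjes_measure \<alpha> F \<sigma>" "\<And>j. j < n \<Longrightarrow> has_moment \<alpha> \<sigma> j (?t j)"
     "has_moment \<alpha> \<sigma> n J" "nonneg_herm (?t n - J)"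
    using F by (auto simp: S_moment_class_def)
  interpret st: stieltjes_transform \<alpha> \<sigma> F using \<sigma>(1) by (simp add: stieltjes_measure_iff)
  have nn: "nonneg_herm (s 0)"
  proof -
    have "s \<in> K_ge \<alpha> (Suc n)" using s K_ge_ext_subset by blast
    then have "block_nonneg (Suc n div 2) (\<lambda>j k. s (j + k))" by (simp add: K_ge_iff H_nonneg_iff)
    from block_nonneg_restrict[OF this, of id 0] show ?thesis by (simp add: block_nonneg_0)
  qed
  interpret inverse_transform \<alpha> \<sigma> F "s 0"
  proof
    show "nonneg_herm (s 0)" by (rule nn)
    show "(\<lambda>z. F z $ i $ j) holomorphic_on cut_plane \<alpha>" for i j using FS by (simp add: S_class_def)
    fix v assume v: "s 0 *v v = 0"
    have tv: "qform (?t j) v = 0" for j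
      by (simp add: S_transform_def qform_def matrix_vector_mult_minus matrix_vector_mul_assoc[symmetric] v cdot_simps)
    interpret m: finite_measure "scalar_measure (half_line \<alpha>) \<sigma> v" by (rule st.scalar_measure)
    have mass: "(LINT t|scalar_measure (half_line \<alpha>) \<sigma> v. t ^ 0) = measure (scalar_measure (half_line \<alpha>) \<sigma> v) {\<alpha>..}"
      by (simp add: st.space_\<mu>)
    show "measure (scalar_measure (half_line \<alpha>) \<sigma> v) {\<alpha>..} = 0"
    \<comment> \<open>For n = 0 the total mass is the top moment and only bounded by
      \<open>?t 0\<close>, otherwise it equals \<open>?t 0\<close>. Since \<open>?t 0\<close> ends
      with the factor \<open>s 0\<close>, its form at v is 0 in both cases.\<close>
    proof (cases "n = 0")
      case True
      have "qform J v = of_real (measure (scalar_measure (half_line \<alpha>) \<sigma> v) {\<alpha>..})"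
        using \<sigma>(3) True mass unfolding st.moment_iff by metis
      moreover have "0 \<le> Re (qform (?t n) v - qform J v)"
        using nonneg_hermD(2)[OF \<sigma>(4), of v] by (simp add: qform_diff)
      ultimately have "measure (scalar_measure (half_line \<alpha>) \<sigma> v) {\<alpha>..} \<le> 0" by (simp add: tv)
      then show ?thesis using measure_nonneg by (rule antisym)
    next
      case False
      then have "qform (?t 0) v = of_real (measure (scalar_measure (half_line \<alpha>) \<sigma> v) {\<alpha>..})"
        using \<sigma>(2)[of 0] mass unfolding st.moment_iff by (metis gr0I)
      then show ?thesis by (simp add: tv)
    qed
  qed
  obtain \<sigma>' where \<sigma>': "stieltjes_measure \<alpha> G \<sigma>'" by (rule ex_measure)
  interpret G: stieltjes_transform \<alpha> \<sigma>' G using \<sigma>' by (simp add: stieltjes_measure_iff)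
  note mom = inverse_moments[OF s refl \<sigma>(2,3,4) \<sigma>']
  show ?thesis
    unfolding S_moment_class_def S0_class_def
  proof (intro CollectI conjI exI allI impI)
    show "G \<in> S_class \<alpha>" by (rule G_S_class)
    show "bdd_above ((\<lambda>y::real. y * op_norm (G (\<i> * complex_of_real y))) ` {1..})" by (rule G.bounded_growth)
    show "stieltjes_measure \<alpha> G \<sigma>'" by (rule \<sigma>')
    show "has_moment \<alpha> \<sigma>' j (s j)" if "j < Suc n" for j using mom(1) that by simp
    show "has_moment \<alpha> \<sigma>' (Suc n) (s (Suc n) - (?t n - J))" by (rule mom(2))
    show "nonneg_herm (s (Suc n) - (s (Suc n) - (?t n - J)))" using \<sigma>(4) by simp
  qed
qed

text \<open>Start of the induction: at order 0 no moment is prescribed exactly, only an upper bound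
  remains, and the zero measure satisfies it.\<close>

lemma zero_moment_class:
  fixes s :: "nat \<Rightarrow> complex^'q^'q"
  assumes "nonneg_herm (s 0)"
  shows "(\<lambda>_. 0) \<in> S_moment_class \<alpha> 0 s"
proof -
  let ?\<sigma> = "\<lambda>_ :: real set. 0 :: complex^'q^'q"
  have z: "nonneg_herm (0 :: complex^'q^'q)" by (rule nonneg_hermI) simp_all
  interpret matrix_measure "half_line \<alpha>" ?\<sigma>
    by standard (simp add: nonneg_herm_measure_def z)
  have int: "has_matrix_integral (half_line \<alpha>) ?\<sigma> f 0" if "f \<in> borel_measurable (half_line \<alpha>)" for f
  proof (rule has_matrix_integralI[OF that])
    fix v :: "complex^'q"
    have "emeasure (\<mu> v) (space (\<mu> v)) = 0"
      unfolding scalar_measure(2) by (subst scalar_measure(4)[OF sets.top]) simp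
    then have ae: "AE x in \<mu> v. f x = 0" by (intro AE_I[of _ _ "space (\<mu> v)"]) auto
    show "integrable (\<mu> v) f"
      by (rule integrable_cong_AE_imp[of _ "\<lambda>_. 0"]) (use that ae in \<open>auto simp: measurable_iff elim: eventually_mono\<close>)
    show "(LINT t|\<mu> v. f t) = qform 0 v" using integral_eq_zero_AE[OF ae] by simp
  qed
  show ?thesis
    unfolding S_moment_class_def S0_class_def
  proof (intro CollectI conjI exI allI impI)
    show "(\<lambda>_. 0 :: complex^'q^'q) \<in> S_class \<alpha>"
      by (simp add: S_class_def z nonneg_herm_im_part_iff)
    have "op_norm (0 :: complex^'q^'q) = 0"
      using op_norm_le[of "0 :: complex^'q^'q"] op_norm_nonneg[of "0 :: complex^'q^'q"] by simp
    then show "bdd_above ((\<lambda>y::real. y * op_norm (0 :: complex^'q^'q)) ` {1..})"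
      by (intro bdd_aboveI2[of _ _ 0]) simp
    show "stieltjes_measure \<alpha> (\<lambda>_. 0) ?\<sigma>"
      unfolding stieltjes_measure_def by (intro conjI ballI nonneg_measure int) (simp add: measurable_restrict_space1)
    show "has_moment \<alpha> ?\<sigma> 0 0" unfolding has_moment_def by (rule int) (simp add: measurable_restrict_space1)
    show "nonneg_herm (s 0 - 0)" using assms by simp
  qed simp
qed

lemma S_moment_class_nonempty:
  fixes s :: "nat \<Rightarrow> complex^'q^'q"
  assumes "s \<in> K_ge_ext \<alpha> n"
  shows "S_moment_class \<alpha> n s \<noteq> {}"
  using assms
proof (induction n arbitrary: s)
  case 0
  then have "s \<in> K_ge \<alpha> 0" using K_ge_ext_subset by blast
  then show ?case using zero_moment_class[of s \<alpha>] by (auto simp: K_ge_def)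
next
  case (Suc n)
  then show ?case using S_transform_K_ge_ext inv_S_transform_moment_class by blast
qed

theorem theorem10p5:
  fixes \<alpha> :: real and m :: nat and s :: "nat \<Rightarrow> complex^'q^'q"
  assumes "m \<ge> 1" and "s \<in> K_ge_ext \<alpha> m"
  shows "S_transform \<alpha> s \<in> K_ge \<alpha> (m - 1) \<and>
    S_moment_class \<alpha> (m - 1) (S_transform \<alpha> s) \<noteq> {} \<and>
    (\<forall>F \<in> S_moment_class \<alpha> (m - 1) (S_transform \<alpha> s).
       inv_S_transform \<alpha> (s 0) F \<in> S_moment_class \<alpha> m s)"
proof -
  obtain n where m: "m = Suc n" using assms(1) by (cases m) auto
  then have s: "s \<in> K_ge_ext \<alpha> (Suc n)" using assms(2) by simp
  have t: "S_transform \<alpha> s \<in> K_ge_ext \<alpha> n" by (rule S_transform_K_ge_ext[OF s])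
  then have "S_transform \<alpha> s \<in> K_ge \<alpha> n" using K_ge_ext_subset by blast
  then show ?thesis
    unfolding m diff_Suc_1 using S_moment_class_nonempty[OF t] inv_S_transform_moment_class[OF s] by blast
qed

end
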